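(* Let $f:\mathbb{R}^d\times\mathbb{R}\to\mathbb{R}^d$ satisfy the Flux Assumption, and let $I=(0,\infty)$. Let $u,\tilde u\in L^\infty(\mathbb{R}^d\times I)$ be entropy solutions of the scalar conservation law with flux $f$, with initial data $u_0,\tilde u_0\in L^\infty(\mathbb{R}^d)$ respectively. Set $M:=\max\{\|u\|_{L^\infty(\mathbb{R}^d\times I)},\|\tilde u\|_{L^\infty(\mathbb{R}^d\times I)}\}$ and, for $R\in(0,\infty)$, $$N_M(R):=\sup\Big\{\frac{|f(x,k)-f(x,k')|}{|k-k'|}\ :\ x\in B_R(0),\ k,k'\in[-M,M],\ k\ne k'\Big\}.$$ Assume that $$\lim_{R\to\infty}\frac{N_M(R)}{R}=0 .$$ Then there exists a set $\mathcal{N}\subset I$ with $\mathcal{L}^1(\mathcal{N})=0$ such that $$\int_{\mathbb{R}^d}|u(x,\tau)-\tilde u(x,\tau)|\,dx\ \le\ \int_{\mathbb{R}^d}|u(x,\rho)-\tilde u(x,\rho)|\,dx$$ for all $\rho,\tau\in I\setminus\mathcal{N}$ with $\rho\le\tau$ (the integrals are allowed to equal $+\infty$).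
   Context: Notation: $\mathcal{L}^m$ is $m$-dimensional Lebesgue measure; "almost every" refers to Lebesgue measure; $B_R(0)=\{x\in\mathbb{R}^d:|x|<R\}$; $D_xf(x,k)$ is the differential of $f(\cdot,k)$ at $x$; $\operatorname{Lip}_c(\mathbb{R}^d\times I)$ is the set of Lipschitz functions of $(x,t)\in\mathbb{R}^d\times I$ with compact support in $\mathbb{R}^d\times I$. The supremum defining $N_M(R)$ is $0$ if $M=0$. Fixed measurable representatives of $u,\tilde u$ are used. Flux Assumption on $f=f(x,k):\mathbb{R}^d\times\mathbb{R}\to\mathbb{R}^d$: (1) $f$ is locally Lipschitz on $\mathbb{R}^d\times\mathbb{R}$. (2a) There is a set $\Theta\subset\mathbb{R}^d$ with $\mathcal{L}^d(\Theta)=0$ such that for every $k\in\mathbb{R}$ the function $f(\cdot,k)$ is differentiable at every $x\in\mathbb{R}^d\setminus\Theta$; moreover, for every $x\in\mathbb{R}^d\setminus\Theta$ the function $k\mapsto D_xf(x,k)$ is continuous. (2b) For every $x\in\mathbb{R}^d\setminus\Theta$ and every compact $K\subset\mathbb{R}$, $\displaystyle\lim_{y\to x}\sup_{k\in K}\frac{|f(y,k)-f(x,k)-D_xf(x,k)(y-x)|}{|y-x|}=0$. Entropy pair: for a convex $\eta\in C^2(\mathbb{R})$ and $k_0\in\mathbb{R}$, put $q(x,k)=\int_{k_0}^k\eta'(\omega)\,\partial_\omega f(x,\omega)\,d\omega$; then $(\eta,q)$ is called an entropy pair. Entropy solution: consider the Cauchy problem $\partial_tu+\operatorname{div}f(x,u)=0$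 in $\mathbb{R}^d\times I$, $u(\cdot,0)=u_0$, with $u_0\in L^\infty(\mathbb{R}^d)$. A function $u\in L^\infty(\mathbb{R}^d\times I)$ is an entropy solution with initial data $u_0$ if: (i) for every entropy pair $(\eta,q)$ and every $0\le\varphi\in\operatorname{Lip}_c(\mathbb{R}^d\times I)$, $$\int_I\int_{\mathbb{R}^d}\Big[\partial_t\varphi\,\eta(u)+\varphi\big(\operatorname{div}_xq(x,u)-\eta'(u)\operatorname{div}_xf(x,u)\big)+\nabla_x\varphi\cdot q(x,u)\Big]dx\,dt\ge0,$$ where $u=u(x,t)$ and $\operatorname{div}_xf(x,u(x,t))$ means the divergence of $f(\cdot,k)$ at $x$ evaluated at $k=u(x,t)$ (derivative only in the explicit $x$-variable), and likewise for $q$ (these are defined for almost every $(x,t)$ and locally bounded); (ii) there is a set $\Psi\subset I$ with $\mathcal{L}^1(\Psi)=0$ such that for every $R\in(0,\infty)$, $\displaystyle\lim_{t\to0^+,\ t\in I\setminus\Psi}\int_{B_R(0)}|u(x,t)-u_0(x)|\,dx=0$. *)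

theory Defs
  imports "HOL-Analysis.Analysis" "HOL-Probability.Essential_Supremum"
begin

(* The space R^d is an arbitrary type 'a :: euclidean_space. Functions of (x, k) or of (x, t)
   are functions on the product space 'a \<times> real, whose Lebesgue measure is L^(d+1). *)

definition grad :: "('a::euclidean_space \<Rightarrow> real) \<Rightarrow> 'a \<Rightarrow> 'a" where
  "grad g x = (\<Sum>b\<in>Basis. frechet_derivative g (at x) b *\<^sub>R b)"

definition divergence :: "('a::euclidean_space \<Rightarrow> 'a) \<Rightarrow> 'a \<Rightarrow> real" where
  "divergence F x = (\<Sum>b\<in>Basis. frechet_derivative F (at x) b \<bullet> b)"

definition Linf_norm :: "'b measure \<Rightarrow> ('b \<Rightarrow> real) \<Rightarrow> ereal" where
  "Linf_norm M u = esssup M (\<lambda>p. ereal \<bar>u p\<bar>)"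

definition Linf :: "'b measure \<Rightarrow> ('b \<Rightarrow> real) set" where
  "Linf M = {u \<in> borel_measurable M. Linf_norm M u < \<infinity>}"

(* The supremum over K is taken in ennreal, so that it is 0 for empty K and has its
   usual meaning without a separate boundedness condition. *)
definition flux_assumption :: "('a::euclidean_space \<times> real \<Rightarrow> 'a) \<Rightarrow> bool" where
  "flux_assumption f \<longleftrightarrow>
     (\<forall>p. \<exists>e>0. \<exists>L. L-lipschitz_on (ball p e) f) \<and>
     (\<exists>\<Theta>\<in>null_sets lebesgue.
        (\<forall>k. \<forall>x. x \<notin> \<Theta> \<longrightarrow> (\<lambda>y. f (y, k)) differentiable (at x)) \<and>
        (\<forall>x. x \<notin> \<Theta> \<longrightarrow>
           continuous_on UNIV (\<lambda>k. Blinfun (frechet_derivative (\<lambda>y. f (y, k)) (at x)))) \<and>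
        (\<forall>x. x \<notin> \<Theta> \<longrightarrow> (\<forall>K. compact K \<longrightarrow>
           ((\<lambda>y. SUP k\<in>K. ennreal
               (norm (f (y, k) - f (x, k) - frechet_derivative (\<lambda>z. f (z, k)) (at x) (y - x))
                 / norm (y - x))) \<longlongrightarrow> 0) (at x))))"

(* The integral is oriented, so k < k0 is allowed. For fixed x the map f (x, _) is locally
   Lipschitz, so its derivative exists for almost every \<omega>; the arbitrary value of
   vector_derivative elsewhere does not affect the integral. *)
definition entropy_pair ::
  "('a::euclidean_space \<times> real \<Rightarrow> 'a) \<Rightarrow> (real \<Rightarrow> real) \<Rightarrow> ('a \<times> real \<Rightarrow> 'a) \<Rightarrow> bool" where
  "entropy_pair f \<eta> q \<longleftrightarrow>
     convex_on UNIV \<eta> \<and> \<eta> C1_differentiable_on UNIV \<and> deriv \<eta> C1_differentiable_on UNIV \<and>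
     (\<exists>k0. \<forall>x k. q (x, k) =
        (LBINT \<omega>=ereal k0..ereal k. deriv \<eta> \<omega> *\<^sub>R vector_derivative (\<lambda>s. f (x, s)) (at \<omega>)))"

(* Elements are represented by their extension by zero to the whole space. *)
definition Lip_c :: "('a::euclidean_space \<times> real) set \<Rightarrow> ('a \<times> real \<Rightarrow> real) set" where
  "Lip_c S = {\<phi>. (\<exists>L. L-lipschitz_on S \<phi>) \<and>
                 compact (closure {p. \<phi> p \<noteq> 0}) \<and> closure {p. \<phi> p \<noteq> 0} \<subseteq> S}"

(* I is meant to be an open interval. The derivatives of \<phi>, f and q in the entropy inequality
   exist at almost every (x, t), where the integrand is measurable and bounded with bounded
   support, so the integrals do not take their default values. In the initial condition the
   nonnegative integral is used so that a non-integrable slice has integral \<infinity> rather than 0. *)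
definition entropy_solution ::
  "real set \<Rightarrow> ('a::euclidean_space \<times> real \<Rightarrow> 'a) \<Rightarrow> ('a \<Rightarrow> real) \<Rightarrow> ('a \<times> real \<Rightarrow> real) \<Rightarrow> bool" where
  "entropy_solution I f u0 u \<longleftrightarrow>
     u \<in> Linf (lebesgue_on (UNIV \<times> I)) \<and>
     (\<forall>\<eta> q \<phi>. entropy_pair f \<eta> q \<and> \<phi> \<in> Lip_c (UNIV \<times> I) \<and> (\<forall>p. 0 \<le> \<phi> p) \<longrightarrow>
        0 \<le> (\<integral>t\<in>I. (\<integral>x.
               deriv (\<lambda>s. \<phi> (x, s)) t * \<eta> (u (x, t))
               + \<phi> (x, t) * (divergence (\<lambda>y. q (y, u (x, t))) x
                             - deriv \<eta> (u (x, t)) * divergence (\<lambda>y. f (y, u (x, t))) x)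
               + grad (\<lambda>y. \<phi> (y, t)) x \<bullet> q (x, u (x, t)) \<partial>lebesgue) \<partial>lebesgue)) \<and>
     (\<exists>\<Psi>\<subseteq>I. \<Psi> \<in> null_sets lebesgue \<and>
        (\<forall>R>0. ((\<lambda>t. \<integral>\<^sup>+x\<in>ball 0 R. ennreal \<bar>u (x, t) - u0 x\<bar> \<partial>lebesgue) \<longlongrightarrow> 0)
                  (at 0 within ((I - \<Psi>) \<inter> {0<..}))))"

(* The case M = 0 is separate because the supremum of the empty set of reals is unspecified. *)
definition flux_speed :: "('a::euclidean_space \<times> real \<Rightarrow> 'a) \<Rightarrow> real \<Rightarrow> real \<Rightarrow> real" where
  "flux_speed f M R =
     (if M = 0 then 0
      else Sup {norm (f (x, k) - f (x, k')) / \<bar>k - k'\<bar> | x k k'.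
                  x \<in> ball 0 R \<and> k \<in> {-M..M} \<and> k' \<in> {-M..M} \<and> k \<noteq> k'})"

end

theory Submission
  imports Defs "HOL-Analysis.Radon_Nikodym"
begin

text \<open>
  The entropies \<open>sqrt ((s - k)\<^sup>2 + \<delta>\<^sup>2)\<close> based at \<open>k\<close> give Kruzhkov's inequality for \<open>\<bar>u - k\<bar>\<close>
  as \<open>\<delta> \<rightarrow> 0\<close>. Doubling the variables with the test function \<open>\<psi>(p) P((p - q)/\<epsilon>)\<close> and substituting
  \<open>p = q + \<epsilon> w\<close> leaves, besides the expected terms, the difference quotients of \<open>f\<close> paired with \<open>\<nabla>P(w)\<close>.
  By the differentiability of \<open>f\<close> in \<open>x\<close>, uniformly in \<open>k\<close>, these converge for almost every \<open>(q, w)\<close> along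
  a sequence for which the translates of \<open>u\<close> and \<open>v\<close> converge, and integration by parts in \<open>w\<close> cancels
  them against the divergence terms. The resulting inequality for \<open>\<bar>u - v\<bar>\<close> is tested with functions whose
  support shrinks at the speed of \<open>f\<close>; sublinear growth of that speed lets the radius tend to infinity.
\<close>

text \<open>The obstacle is the low regularity of \<open>f\<close>. Its divergence in
  \<open>x\<close> exists only almost everywhere, is continuous in \<open>k\<close> there, but
  merely measurable in \<open>x\<close>, so it cannot be expanded around the diagonal of the doubled
  integral. What survives is that values of \<open>f\<close> at points a distance \<epsilon> apart
  differ by O(\<epsilon>), which balances the factor 1/\<epsilon> from the gradient of the bump; the
  merely measurable terms are compared with translates in the integral norm. Since \<open>u\<close>
  and \<open>v\<close> are only measurable as well, their translates converge pointwise only along a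
  sequence and for almost every pair (q, w). The derivative of \<open>f\<close> in \<open>k\<close>,
  which enters every entropy flux, also exists only almost everywhere. Integration by parts in
  \<open>k\<close>, which rests on calculus for Lipschitz functions of one variable, replaces it by
  an integral of \<open>f\<close> itself, and that integral can be differentiated in
  \<open>x\<close>. The flux has a finite speed \<open>N\<close> only on bounded balls. For a time
  horizon T0 with N * T0 \<le> R, a support of radius R + N * (T0 - t) never leaves the ball of
  radius 2R, where the speed is measured.\<close>

subsection \<open>Lipschitz functions of one variable\<close>

text \<open>A Radon-Nikodym density of the image of Lebesgue measure under the inverse of \<open>m\<close>; the Lipschitz
  bound makes this measure absolutely continuous.\<close>

lemma bilipschitz_density:
  fixes m :: "real \<Rightarrow> real"
  assumes lip: "\<And>x y. \<bar>m x - m y\<bar> \<le> K * \<bar>x - y\<bar>"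
    and low: "\<And>x y. x \<le> y \<Longrightarrow> y - x \<le> m y - m x"
  obtains H :: "real \<Rightarrow> real" where
    "\<And>a b. a \<le> b \<Longrightarrow> (H has_integral (m b - m a)) {a..b}"
proof -
  have mono: "strict_mono m"
    by (rule strict_monoI) (smt (verit) low)
  then have inj: "inj m" by (rule strict_mono_imp_inj_on)
  have "K-lipschitz_on UNIV m"
    using lip lip[of 1 0] by (intro lipschitz_onI) (auto simp: dist_real_def)
  then have cont: "continuous_on UNIV m"
    by (rule lipschitz_on_continuous_on)
  have surj: "surj m"
  proof -
    have "\<exists>x. m x = y" for y
    proof -
      let ?b = "\<bar>y - m 0\<bar>"
      have "m (- ?b) \<le> y" "y \<le> m ?b"
        using low[of "- ?b" 0] low[of 0 ?b] by auto
      then show ?thesis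
        using IVT'[of m "- ?b" y ?b] continuous_on_subset[OF cont] by auto
    qed
    then show ?thesis by (metis surjI)
  qed
  define g where "g = inv m"
  have mg: "m (g y) = y" and gm: "g (m x) = x" for x y
    using surj inj by (auto simp: g_def surj_f_inv_f)
  have glip: "1-lipschitz_on UNIV g"
  proof (intro lipschitz_onI)
    fix x y
    have "\<bar>a - b\<bar> \<le> \<bar>m a - m b\<bar>" for a b
      using low[of a b] low[of b a] by (cases "a \<le> b") auto
    from this[of "g x" "g y"] show "dist (g x) (g y) \<le> 1 * dist x y"
      by (simp add: mg dist_real_def)
  qed auto
  then have gcont: "continuous_on UNIV g" by (rule lipschitz_on_continuous_on)
  then have [measurable]: "g \<in> borel_measurable borel"
    by (rule borel_measurable_continuous_onI)
  have vim: "g -` A = m ` A" for A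
    using mg gm by (auto simp: image_iff) metis
  \<comment> \<open>The measure of a set under \<open>N\<close> is the Lebesgue measure of its image
    under \<open>m\<close>, because preimages under \<open>g\<close> are images under
    \<open>m\<close>.\<close>
  define N where "N = distr lborel borel g"
  have "absolutely_continuous lborel N"
    unfolding absolutely_continuous_def
  proof
    fix A :: "real set" assume A: "A \<in> null_sets lborel"
    then have [measurable]: "A \<in> sets borel" by auto
    have "negligible A"
      using A by (simp add: negligible_iff_null_sets null_sets_completionI)
    then have "negligible (m ` A)"
      by (rule negligible_locally_Lipschitz_image[OF order_refl])
         (use lip in \<open>auto intro!: exI[of _ UNIV] exI[of _ K]\<close>)
    then have "m ` A \<in> null_sets lebesgue" by (simp add: negligible_iff_null_sets)
    moreover have "m ` A \<in> sets borel"
      unfolding vim[symmetric] using measurable_sets[of g borel borel A] by simp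
    ultimately have "m ` A \<in> null_sets lborel"
      by (simp add: null_sets_completion_iff)
    then show "A \<in> null_sets N"
      by (auto simp: N_def null_sets_def emeasure_distr vim)
  qed
  moreover have "sets N = sets lborel" by (simp add: N_def)
  ultimately obtain h where h [measurable]: "h \<in> borel_measurable borel" and hN: "density lborel h = N"
    using sigma_finite_measure.Radon_Nikodym[OF sigma_finite_lborel, of N] by auto
  have Nab: "emeasure N {a..b} = ennreal (m b - m a)" if "a \<le> b" for a b
  proof -
    have "m ` {a..b} = {m a..m b}"
    proof (intro equalityI subsetI)
      fix y assume y: "y \<in> {m a..m b}"
      then have "a \<le> g y" "g y \<le> b"
        using mono mg[of y] by (smt (verit) atLeastAtMost_iff strict_mono_less)+
      then show "y \<in> m ` {a..b}" using mg[of y] by (metis atLeastAtMost_iff imageI)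
    qed (use mono in \<open>auto simp: strict_mono_less_eq\<close>)
    moreover have "m a \<le> m b" using that mono by (simp add: strict_mono_less_eq)
    ultimately show ?thesis by (simp add: N_def emeasure_distr vim)
  qed
  have hab: "(\<integral>\<^sup>+x. h x * indicator {a..b} x \<partial>lborel) = ennreal (m b - m a)" if "a \<le> b" for a b
    using Nab[OF that] by (simp add: hN[symmetric] emeasure_density)
  \<comment> \<open>The integral of the density over each bounded interval is finite, so
    \<open>enn2real\<close> alters it only on a null set.\<close>
  have fin: "AE x in lborel. h x \<noteq> \<infinity>"
  proof -
    have "AE x in lborel. \<forall>n::nat. h x * indicator {-real n..real n} x \<noteq> \<infinity>"
      unfolding AE_all_countable
      by (intro allI nn_integral_PInf_AE) (auto simp: hab)
    then show ?thesis
    proof eventually_elim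
      case (elim x)
      obtain n :: nat where "\<bar>x\<bar> \<le> real n" using real_arch_simple by blast
      then have "indicator {-real n..real n} x = (1::ennreal)" by (auto simp: indicator_def)
      then show ?case using elim[rule_format, of n] by simp
    qed
  qed
  define H where "H x = enn2real (h x)" for x
  have "(H has_integral (m b - m a)) {a..b}" if ab: "a \<le> b" for a b
  proof -
    have "(\<integral>\<^sup>+x. ennreal (H x * indicator {a..b} x) \<partial>lborel) = (\<integral>\<^sup>+x. h x * indicator {a..b} x \<partial>lborel)"
      by (rule nn_integral_cong_AE)
         (use fin in \<open>eventually_elim, auto simp: H_def indicator_def top.not_eq_extremum\<close>)
    also have "\<dots> = ennreal (m b - m a)" by (rule hab[OF ab])
    finally have "((\<lambda>x. H x * indicator {a..b} x) has_integral (m b - m a)) UNIV"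
      using ab mono by (intro nn_integral_has_integral)
         (auto simp: H_def strict_mono_less_eq)
    also have "(\<lambda>x. H x * indicator {a..b} x) = (\<lambda>x. if x \<in> {a..b} then H x else 0)"
      by auto
    finally show ?thesis by (simp only: has_integral_restrict_UNIV)
  qed
  then show thesis by (rule that)
qed

text \<open>The Lebesgue differentiation theorem applied here averages over cubes with lower corner
  \<open>x\<close>, so on the real line it controls only increments to the right. The left side is
  recovered later by reflection.\<close>

lemma indefinite_integral_right_derivative_AE:
  fixes m H :: "real \<Rightarrow> real"
  assumes H: "\<And>a b. a \<le> b \<Longrightarrow> (H has_integral (m b - m a)) {a..b}"
  shows "AE x in lebesgue. ((\<lambda>h. (m (x + h) - m x) / h) \<longlongrightarrow> H x) (at_right 0)"
proof -
  have "H integrable_on cbox a b" for a b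
    using H[of a b] by (cases "a \<le> b") (auto simp: integrable_on_def intro: exI[of _ 0])
  from integrable_ccontinuous_explicit[OF this]
  obtain N where N: "negligible N" and
    lim: "\<And>x e. x \<notin> N \<Longrightarrow> 0 < e \<Longrightarrow> \<exists>d>0. \<forall>h. 0 < h \<and> h < d \<longrightarrow>
       norm (integral (cbox x (x + h *\<^sub>R One)) H /\<^sub>R h ^ DIM(real) - H x) < e"
    by metis
  have "((\<lambda>h. (m (x + h) - m x) / h) \<longlongrightarrow> H x) (at_right 0)" if "x \<notin> N" for x
  proof (rule tendstoI)
    fix e :: real assume "0 < e"
    from lim[OF that this] obtain d where "d > 0" and d: "\<And>h. 0 < h \<Longrightarrow> h < d \<Longrightarrow>
       norm (integral (cbox x (x + h *\<^sub>R One)) H /\<^sub>R h ^ DIM(real) - H x) < e" by blast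
    have "dist ((m (x + h) - m x) / h) (H x) < e" if "0 < h" "h < d" for h
      using d[OF that] integral_unique[OF H[of x "x + h"]] that
      by (simp add: dist_real_def field_simps)
    then show "\<forall>\<^sub>F h in at_right 0. dist ((m (x + h) - m x) / h) (H x) < e"
      using \<open>d > 0\<close> by (auto simp: eventually_at_right_field)
  qed
  then show ?thesis
    using N by (intro AE_I'[of N]) (auto simp: negligible_iff_null_sets)
qed

lemma AE_lborel_uminus:
  fixes P :: "'b::euclidean_space \<Rightarrow> bool"
  assumes "AE x in lborel. P x" shows "AE x in lborel. P (- x)"
proof -
  have "lborel = distr lborel borel (uminus :: 'b \<Rightarrow> 'b)"
    using lborel_affine[of "-1" "0::'b"] by (simp add: density_1)
  with assms have "AE x in distr lborel borel (uminus :: 'b \<Rightarrow> 'b). P x" by metis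
  then show ?thesis by (rule AE_distrD[rotated]) simp
qed

text \<open>Rademacher's theorem in one dimension. Adding \<open>(L + 1) * x\<close> gives a
  function \<open>m\<close> with slopes between 1 and 2L + 1, which has a density \<open>H\<close>.
  The reflected function -m(-x) has the density H(-x), so its right derivative yields the left
  derivative of \<open>m\<close>, and both one-sided derivatives equal \<open>H x\<close>.\<close>

lemma lipschitz_real_differentiable_AE:
  fixes G :: "real \<Rightarrow> real"
  assumes "L-lipschitz_on UNIV G"
  shows "AE x in lborel. \<exists>D. (G has_real_derivative D) (at x)"
proof -
  have L: "\<bar>G x - G y\<bar> \<le> L * \<bar>x - y\<bar>" for x y
    using lipschitz_onD[OF assms, of x y] by (simp add: dist_real_def)
  define m where "m x = G x + (L + 1) * x" for x
  have "\<bar>m x - m y\<bar> \<le> (2 * L + 1) * \<bar>x - y\<bar>" for x y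
  proof -
    have "m x - m y = (G x - G y) + (L + 1) * (x - y)" by (simp add: m_def algebra_simps)
    also have "\<bar>\<dots>\<bar> \<le> L * \<bar>x - y\<bar> + (L + 1) * \<bar>x - y\<bar>"
      using L[of x y] lipschitz_on_nonneg[OF assms] by (intro order.trans[OF abs_triangle_ineq]) (auto simp: abs_mult)
    finally show ?thesis by (simp add: algebra_simps)
  qed
  moreover have "y - x \<le> m y - m x" if "x \<le> y" for x y
    using L[of y x] that by (simp add: m_def algebra_simps abs_le_iff)
  ultimately obtain H where H: "\<And>a b. a \<le> b \<Longrightarrow> (H has_integral (m b - m a)) {a..b}"
    using bilipschitz_density[of m "2 * L + 1"] by metis
  have H': "((\<lambda>x. H (- x)) has_integral (- m (- b) - - m (- a))) {a..b}" if "a \<le> b" for a b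
    using H[of "-b" "-a"] that by (subst has_integral_reflect_real[symmetric]) simp
  have "AE x in lborel. ((\<lambda>h. (m (x + h) - m x) / h) \<longlongrightarrow> H x) (at_right 0)"
    using indefinite_integral_right_derivative_AE[OF H] by (simp add: AE_completion_iff)
  moreover have "AE x in lborel. ((\<lambda>h. (- m (- (- x + h)) - - m (- (- x))) / h) \<longlongrightarrow> H (- (- x))) (at_right 0)"
    using indefinite_integral_right_derivative_AE[OF H']
    by (intro AE_lborel_uminus[where P = "\<lambda>x. ((\<lambda>h. (- m (- (x + h)) - - m (- x)) / h) \<longlongrightarrow> H (- x)) (at_right 0)"]) (simp add: AE_completion_iff)
  ultimately show ?thesis
  proof eventually_elim
    case (elim x)
    have "((\<lambda>h. (m (x + h) - m x) / h) \<longlongrightarrow> H x) (at_left 0)"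
    proof -
      have "((\<lambda>h. (m (x + h) - m x) / h) \<longlongrightarrow> H x) (at_left 0) \<longleftrightarrow>
         ((\<lambda>h. (m (x + - h) - m x) / - h) \<longlongrightarrow> H x) (at_right 0)"
        by (subst filterlim_at_left_to_right) simp
      also have "(\<lambda>h. (m (x + - h) - m x) / - h) = (\<lambda>h. (- m (- (- x + h)) - - m (- (- x))) / h)"
        by (rule ext) (simp add: divide_simps)
      finally show ?thesis using elim(2) by simp
    qed
    with elim(1) have "((\<lambda>h. (m (x + h) - m x) / h) \<longlongrightarrow> H x) (at 0)"
      by (simp add: filterlim_split_at)
    then have "(m has_real_derivative H x) (at x)" by (simp add: DERIV_def)
    then have "((\<lambda>y. m y - (L + 1) * y) has_real_derivative H x - (L + 1) * 1) (at x)"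
      by (intro DERIV_diff DERIV_cmult DERIV_ident)
    then show ?case by (auto simp: m_def)
  qed
qed

lemma lipschitz_differentiable_AE:
  fixes G :: "real \<Rightarrow> 'b::euclidean_space"
  assumes "L-lipschitz_on UNIV G"
  shows "AE x in lborel. G differentiable (at x)"
proof -
  have "AE x in lborel. \<forall>b\<in>Basis. \<exists>D. ((\<lambda>y. G y \<bullet> b) has_real_derivative D) (at x)"
  proof (subst AE_finite_all)
    show "\<forall>b\<in>Basis. AE x in lborel. \<exists>D. ((\<lambda>y. G y \<bullet> b) has_real_derivative D) (at x)"
    proof
      fix b :: 'b assume b: "b \<in> Basis"
      have "L-lipschitz_on UNIV (\<lambda>y. G y \<bullet> b)"
      proof (rule lipschitz_onI)
        fix x y
        have "\<bar>(G x - G y) \<bullet> b\<bar> \<le> norm (G x - G y)" by (rule Basis_le_norm[OF b])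
        also have "\<dots> \<le> L * dist x y" using lipschitz_onD[OF assms, of x y] by (simp add: dist_norm)
        finally show "dist (G x \<bullet> b) (G y \<bullet> b) \<le> L * dist x y"
          by (simp add: dist_real_def inner_diff_left)
      qed (rule lipschitz_on_nonneg[OF assms])
      then show "AE x in lborel. \<exists>D. ((\<lambda>y. G y \<bullet> b) has_real_derivative D) (at x)"
        by (rule lipschitz_real_differentiable_AE)
    qed
  qed simp
  then show ?thesis
  proof eventually_elim
    case (elim x)
    then obtain D where D: "\<And>b. b \<in> Basis \<Longrightarrow> ((\<lambda>y. G y \<bullet> b) has_real_derivative D b) (at x)"
      by metis
    have "(G has_derivative (\<lambda>h. \<Sum>b\<in>Basis. (D b * h) *\<^sub>R b)) (at x)"
      by (subst has_derivative_componentwise_within)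
         (use D in \<open>auto simp: inner_sum_left inner_Basis if_distrib sum.delta has_field_derivative_def cong: if_cong\<close>)
    then show ?case by (rule differentiableI)
  qed
qed

lemma has_vector_derivative_LIMSEQ:
  fixes G :: "real \<Rightarrow> 'b::real_normed_vector"
  assumes D: "(G has_vector_derivative D) (at x)" and e: "e \<longlonglongrightarrow> 0" "\<And>n. e n \<noteq> 0"
  shows "(\<lambda>n. (G (x + e n) - G x) /\<^sub>R e n) \<longlonglongrightarrow> D"
proof -
  have "((\<lambda>h. norm (G (x + h) - G x - h *\<^sub>R D) / norm h) \<longlongrightarrow> 0) (at 0)"
    using D by (simp add: has_vector_derivative_def has_derivative_at)
  moreover have "filterlim e (at 0) sequentially"
    using e by (auto simp: filterlim_at)
  ultimately have "(\<lambda>n. norm (G (x + e n) - G x - e n *\<^sub>R D) / norm (e n)) \<longlonglongrightarrow> 0"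
    by (rule filterlim_compose)
  moreover have "norm (G (x + e n) - G x - e n *\<^sub>R D) / norm (e n) = norm ((G (x + e n) - G x) /\<^sub>R e n - D)" for n
  proof -
    have "(G (x + e n) - G x) /\<^sub>R e n - D = (G (x + e n) - G x - e n *\<^sub>R D) /\<^sub>R e n"
      using e(2)[of n] by (simp add: scaleR_diff_right)
    then show ?thesis by (simp add: divide_inverse)
  qed
  ultimately show ?thesis
    by (simp add: tendsto_norm_zero_iff LIM_zero_iff)
qed

text \<open>Countably many conditions on \<open>x\<close>, so that the set of points of differentiability is Borel.\<close>

lemma differentiable_real_iff_Cauchy:
  fixes G :: "real \<Rightarrow> 'b::banach"
  assumes cont: "continuous_on UNIV G"
  shows "G differentiable (at x) \<longleftrightarrow>
    (\<forall>k::nat. \<exists>n::nat. \<forall>r\<in>\<rat>. \<forall>s\<in>\<rat>. r \<noteq> 0 \<longrightarrow> s \<noteq> 0 \<longrightarrow> \<bar>r\<bar> < 1 / Suc n \<longrightarrow> \<bar>s\<bar> < 1 / Suc n \<longrightarrow>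
       norm ((G (x + r) - G x) /\<^sub>R r - (G (x + s) - G x) /\<^sub>R s) \<le> 1 / Suc k)"
proof -
  define Q where "Q r = (G (x + r) - G x) /\<^sub>R r" for r
  have tendsto_Q: "((\<lambda>h. Q h) \<longlongrightarrow> D) (at 0) \<longleftrightarrow> (G has_vector_derivative D) (at x)" for D
  proof -
    have "norm (G (x + h) - G x - h *\<^sub>R D) / norm h = norm (Q h - D)" if "h \<noteq> 0" for h
    proof -
      have "Q h - D = (G (x + h) - G x - h *\<^sub>R D) /\<^sub>R h"
        using that by (simp add: scaleR_diff_right Q_def)
      then show ?thesis by (simp add: divide_inverse)
    qed
    then have "((\<lambda>h. norm (G (x + h) - G x - h *\<^sub>R D) / norm h) \<longlongrightarrow> 0) (at 0) \<longleftrightarrow> ((\<lambda>h. norm (Q h - D)) \<longlongrightarrow> 0) (at 0)"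
      by (intro Lim_cong_within) auto
    then show ?thesis
      by (simp add: has_vector_derivative_def has_derivative_at bounded_linear_scaleR_left tendsto_norm_zero_iff LIM_zero_iff)
  qed
  have "G differentiable (at x) \<longleftrightarrow> (\<forall>k::nat. \<exists>n::nat. \<forall>r\<in>\<rat>. \<forall>s\<in>\<rat>. r \<noteq> 0 \<longrightarrow> s \<noteq> 0 \<longrightarrow> \<bar>r\<bar> < 1 / Suc n \<longrightarrow> \<bar>s\<bar> < 1 / Suc n \<longrightarrow>
       norm (Q r - Q s) \<le> 1 / Suc k)" (is "_ \<longleftrightarrow> ?C")
  proof
    assume "G differentiable (at x)"
    then obtain D where "(G has_vector_derivative D) (at x)"
      by (metis vector_derivative_works)
    then have D: "(Q \<longlongrightarrow> D) (at 0)" by (simp add: tendsto_Q)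
    show ?C
    proof
      fix k :: nat
      have "\<forall>\<^sub>F h in at 0. dist (Q h) D < 1 / (2 * Suc k)"
        by (intro tendstoD[OF D]) simp
      then obtain d where "d > 0" and d: "\<And>h. h \<noteq> 0 \<Longrightarrow> \<bar>h\<bar> < d \<Longrightarrow> dist (Q h) D < 1 / (2 * Suc k)"
        by (auto simp: eventually_at)
      obtain n :: nat where n: "1 / Suc n < d"
        using \<open>d > 0\<close> nat_approx_posE by blast
      have "norm (Q r - Q s) \<le> 1 / Suc k" if "r \<noteq> 0" "s \<noteq> 0" "\<bar>r\<bar> < 1 / Suc n" "\<bar>s\<bar> < 1 / Suc n" for r s
      proof -
        have "norm (Q r - Q s) \<le> dist (Q r) D + dist (Q s) D"
          by (metis dist_norm dist_triangle2)
        also have "\<dots> \<le> 1 / (2 * Suc k) + 1 / (2 * Suc k)"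
          using d[of r] d[of s] that n by (intro add_mono less_imp_le) auto
        also have "\<dots> = 1 / Suc k" by (simp add: field_simps)
        finally show ?thesis .
      qed
      then show "\<exists>n::nat. \<forall>r\<in>\<rat>. \<forall>s\<in>\<rat>. r \<noteq> 0 \<longrightarrow> s \<noteq> 0 \<longrightarrow> \<bar>r\<bar> < 1 / Suc n \<longrightarrow> \<bar>s\<bar> < 1 / Suc n \<longrightarrow>
          norm (Q r - Q s) \<le> 1 / Suc k" by blast
    qed
  next
    assume C: ?C
    have Qseq: "(\<lambda>i. Q (r i)) \<longlonglongrightarrow> Q r0" if "r \<longlonglongrightarrow> r0" "r0 \<noteq> 0" for r r0
    proof -
      have "isCont G (x + r0)" using cont by (simp add: continuous_on_eq_continuous_at)
      then have "(\<lambda>i. G (x + r i)) \<longlonglongrightarrow> G (x + r0)"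
        by (rule isCont_tendsto_compose) (intro tendsto_intros that)
      then show ?thesis unfolding Q_def by (intro tendsto_intros that)
    qed
    have rat: "\<exists>r. (\<forall>i. r i \<in> \<rat>) \<and> r \<longlonglongrightarrow> r0" for r0 :: real
      using closure_sequential[of r0 "\<rat>"] by (auto simp: Rats_closure_real)
    \<comment> \<open>By density of the rationals and continuity of \<open>G\<close>, the Cauchy
      bound extends to all real increments.\<close>
    have C': "\<exists>n::nat. \<forall>r s. r \<noteq> 0 \<longrightarrow> s \<noteq> 0 \<longrightarrow> \<bar>r\<bar> < 1 / Suc n \<longrightarrow> \<bar>s\<bar> < 1 / Suc n \<longrightarrow>
       norm (Q r - Q s) \<le> 1 / Suc k" for k :: nat
    proof -
      obtain n :: nat where n: "\<And>r s. r \<in> \<rat> \<Longrightarrow> s \<in> \<rat> \<Longrightarrow> r \<noteq> 0 \<Longrightarrow> s \<noteq> 0 \<Longrightarrow> \<bar>r\<bar> < 1 / Suc n \<Longrightarrow> \<bar>s\<bar> < 1 / Suc n \<Longrightarrow>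
          norm (Q r - Q s) \<le> 1 / Suc k" using C by metis
      have "norm (Q r - Q s) \<le> 1 / Suc k" if "r \<noteq> 0" "s \<noteq> 0" "\<bar>r\<bar> < 1 / Suc n" "\<bar>s\<bar> < 1 / Suc n" for r s
      proof -
        obtain r' s' where rs: "\<And>i. r' i \<in> \<rat>" "r' \<longlonglongrightarrow> r" "\<And>i. s' i \<in> \<rat>" "s' \<longlonglongrightarrow> s"
          using rat[of r] rat[of s] by metis
        have "(\<lambda>i. norm (Q (r' i) - Q (s' i))) \<longlonglongrightarrow> norm (Q r - Q s)"
          by (intro tendsto_intros Qseq rs that)
        moreover have "\<forall>\<^sub>F i in sequentially. norm (Q (r' i) - Q (s' i)) \<le> 1 / Suc k"
        proof -
          have "\<forall>\<^sub>F i in sequentially. r' i \<noteq> 0" "\<forall>\<^sub>F i in sequentially. s' i \<noteq> 0"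
            using tendsto_imp_eventually_ne rs that by blast+
          moreover have "\<forall>\<^sub>F i in sequentially. \<bar>r' i\<bar> < 1 / Suc n" "\<forall>\<^sub>F i in sequentially. \<bar>s' i\<bar> < 1 / Suc n"
            using order_tendstoD(2)[OF tendsto_rabs[OF rs(2)] that(3)] order_tendstoD(2)[OF tendsto_rabs[OF rs(4)] that(4)] by auto
          ultimately show ?thesis
            by eventually_elim (intro n rs)
        qed
        ultimately show ?thesis
          by (intro tendsto_upperbound) auto
      qed
      then show ?thesis by blast
    qed
    \<comment> \<open>One sequence of increments suffices to find the limit; the Cauchy bound then
      carries it over to all increments.\<close>
    define e :: "nat \<Rightarrow> real" where "e i = 1 / Suc i" for i
    have e: "e \<longlonglongrightarrow> 0" unfolding e_def using LIMSEQ_Suc[OF lim_inverse_n'] by simp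
    have ev: "\<forall>\<^sub>F i in sequentially. \<bar>e i\<bar> < 1 / Suc n" for n
      using order_tendstoD(2)[OF tendsto_rabs[OF e], of "1 / Suc n"] by simp
    have e0: "e i \<noteq> 0" for i by (simp add: e_def)
    have "Cauchy (\<lambda>i. Q (e i))"
    proof (rule metric_CauchyI)
      fix \<epsilon> :: real assume "\<epsilon> > 0"
      then obtain k :: nat where k: "1 / Suc k < \<epsilon>" using nat_approx_posE by blast
      obtain n :: nat where n: "\<And>r s. r \<noteq> 0 \<Longrightarrow> s \<noteq> 0 \<Longrightarrow> \<bar>r\<bar> < 1 / Suc n \<Longrightarrow> \<bar>s\<bar> < 1 / Suc n \<Longrightarrow>
          norm (Q r - Q s) \<le> 1 / Suc k" using C' by metis
      obtain N where "\<And>i. i \<ge> N \<Longrightarrow> \<bar>e i\<bar> < 1 / Suc n" using ev[of n] by (auto simp: eventually_sequentially)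
      then have "dist (Q (e i)) (Q (e j)) < \<epsilon>" if "i \<ge> N" "j \<ge> N" for i j
        using n[of "e i" "e j"] e0 that k by (simp add: dist_norm)
      then show "\<exists>M. \<forall>m\<ge>M. \<forall>n\<ge>M. dist (Q (e m)) (Q (e n)) < \<epsilon>" by blast
    qed
    then obtain D where D: "(\<lambda>i. Q (e i)) \<longlonglongrightarrow> D" using Cauchy_convergent convergent_def by blast
    have "(Q \<longlongrightarrow> D) (at 0)"
    proof (rule tendstoI)
      fix \<epsilon> :: real assume "\<epsilon> > 0"
      then obtain k :: nat where k: "1 / Suc k < \<epsilon>" using nat_approx_posE by blast
      obtain n :: nat where n: "\<And>r s. r \<noteq> 0 \<Longrightarrow> s \<noteq> 0 \<Longrightarrow> \<bar>r\<bar> < 1 / Suc n \<Longrightarrow> \<bar>s\<bar> < 1 / Suc n \<Longrightarrow>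
          norm (Q r - Q s) \<le> 1 / Suc k" using C' by metis
      have "dist (Q r) D < \<epsilon>" if r: "r \<noteq> 0" "\<bar>r\<bar> < 1 / Suc n" for r
      proof -
        have "norm (Q r - D) \<le> 1 / Suc k"
        proof (rule tendsto_upperbound)
          show "(\<lambda>i. norm (Q r - Q (e i))) \<longlonglongrightarrow> norm (Q r - D)" by (intro tendsto_intros D)
          show "\<forall>\<^sub>F i in sequentially. norm (Q r - Q (e i)) \<le> 1 / Suc k"
            using ev[of n] by eventually_elim (intro n r e0)
        qed simp
        then show ?thesis using k by (simp add: dist_norm)
      qed
      then show "\<forall>\<^sub>F h in at 0. dist (Q h) D < \<epsilon>"
        by (auto simp: eventually_at intro!: exI[of _ "1 / Suc n"])
    qed
    then show "G differentiable (at x)"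
      using tendsto_Q differentiableI_vector by blast
  qed
  then show ?thesis by (simp only: Q_def)
qed

lemma borel_measurable_vector_derivative [measurable]:
  fixes G :: "real \<Rightarrow> 'b::euclidean_space"
  assumes cont: "continuous_on UNIV G"
  shows "(\<lambda>x. vector_derivative G (at x)) \<in> borel_measurable borel"
proof -
  have [measurable]: "G \<in> borel_measurable borel" using cont by (rule borel_measurable_continuous_onI)
  have [simp]: "countable (\<rat> :: real set)" by (rule countable_rat)
  have [measurable]: "Measurable.pred borel (\<lambda>x. G differentiable (at x))"
    unfolding differentiable_real_iff_Cauchy[OF cont] by measurable
  \<comment> \<open>Where \<open>G\<close> is not differentiable, \<open>vector_derivative\<close>
    chooses from a predicate that is nowhere true, so its value is the same constant at all such
    points.\<close>
  define c where "c = (SOME D :: 'b. False)"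
  have eq: "vector_derivative G (at x) = (if G differentiable (at x) then
     lim (\<lambda>n. (G (x + 1 / Suc n) - G x) /\<^sub>R (1 / Suc n)) else c)" for x
  proof (cases "G differentiable (at x)")
    case True
    then have "(G has_vector_derivative vector_derivative G (at x)) (at x)"
      by (simp add: vector_derivative_works)
    from has_vector_derivative_LIMSEQ[OF this LIMSEQ_Suc[OF lim_inverse_n']]
    show ?thesis using True by (simp add: limI)
  next
    case False
    then show ?thesis
      unfolding vector_derivative_def c_def by (auto intro: differentiableI_vector)
        (metis differentiableI_vector)
  qed
  show ?thesis unfolding eq by measurable
qed

text \<open>The difference quotients of \<open>G\<close> are bounded by \<open>L\<close> and tend to
  the derivative almost everywhere. Their integrals are difference quotients, at \<open>b\<close>
  and at \<open>a\<close>, of an antiderivative of the continuous function \<open>G\<close>, so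
  dominated convergence gives G b - G a.\<close>

lemma lipschitz_FTC:
  fixes G :: "real \<Rightarrow> 'b::euclidean_space"
  assumes lip: "L-lipschitz_on UNIV G" and ab: "a \<le> b"
  shows "set_integrable lborel {a..b} (\<lambda>x. vector_derivative G (at x))"
    and "(LINT x:{a..b}|lborel. vector_derivative G (at x)) = G b - G a"
proof -
  have cont: "continuous_on UNIV G" using lip by (rule lipschitz_on_continuous_on)
  then have [measurable]: "G \<in> borel_measurable borel" by (rule borel_measurable_continuous_onI)
  note [measurable] = borel_measurable_vector_derivative[OF cont]
  obtain A where A: "\<And>x. (A has_vector_derivative G x) (at x)"
    using einterval_antiderivative[of "-\<infinity>" "\<infinity>" G] cont by (auto simp: continuous_on_eq_continuous_at)
  define e :: "nat \<Rightarrow> real" where "e i = 1 / Suc i" for i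
  have e: "e \<longlonglongrightarrow> 0" unfolding e_def using LIMSEQ_Suc[OF lim_inverse_n'] by simp
  have e0: "e i \<noteq> 0" for i by (simp add: e_def)
  define d where "d n x = indicator {a..b} x *\<^sub>R ((G (x + e n) - G x) /\<^sub>R e n)" for n x
  have meas: "(\<lambda>x. indicator {a..b} x *\<^sub>R vector_derivative G (at x)) \<in> borel_measurable lborel" "d n \<in> borel_measurable lborel" for n
    unfolding d_def by measurable
  have bound: "AE x in lborel. norm (d n x) \<le> L * indicator {a..b} x" for n
  proof (rule AE_I2)
    fix x
    have "norm (G (x + e n) - G x) \<le> L * \<bar>e n\<bar>"
      using lipschitz_onD[OF lip, of "x + e n" x] by (simp add: dist_norm)
    then have "norm (G (x + e n) - G x) / \<bar>e n\<bar> \<le> L"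
      using e0[of n] by (simp add: divide_le_eq)
    then have "norm ((G (x + e n) - G x) /\<^sub>R e n) \<le> L"
      by (simp add: divide_inverse mult.commute)
    then show "norm (d n x) \<le> L * indicator {a..b} x" by (simp add: d_def indicator_def)
  qed
  have lim: "AE x in lborel. (\<lambda>n. d n x) \<longlonglongrightarrow> indicator {a..b} x *\<^sub>R vector_derivative G (at x)"
    using lipschitz_differentiable_AE[OF lip]
  proof eventually_elim
    case (elim x)
    then have "(G has_vector_derivative vector_derivative G (at x)) (at x)"
      by (simp add: vector_derivative_works)
    from has_vector_derivative_LIMSEQ[OF this e e0] show ?case
      unfolding d_def by (intro tendsto_intros)
  qed
  have intL: "integrable lborel (\<lambda>x. L * indicator {a..b} x)"
    by (intro integrable_mult_right integrable_real_indicator) (auto simp: emeasure_lborel_Icc_eq)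
  note dct = integrable_dominated_convergence[OF meas intL lim bound] integral_dominated_convergence[OF meas intL lim bound]
  show "set_integrable lborel {a..b} (\<lambda>x. vector_derivative G (at x))"
    unfolding set_integrable_def by (rule dct(1))
  have "(\<integral>x. d n x \<partial>lborel) = (A (b + e n) - A b) /\<^sub>R e n - (A (a + e n) - A a) /\<^sub>R e n" for n
  proof -
    have "(\<integral>x. d n x \<partial>lborel) = (A (b + e n) - A b) /\<^sub>R e n - (A (a + e n) - A a) /\<^sub>R e n"
      unfolding d_def
    proof (rule integral_FTC_atLeastAtMost[OF ab])
      show "continuous_on {a..b} (\<lambda>x. (G (x + e n) - G x) /\<^sub>R e n)"
        by (intro continuous_intros continuous_on_compose2[OF cont]) auto
      fix x
      have "((\<lambda>x. x + e n) has_vector_derivative 1) (at x)"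
        by (auto intro!: derivative_eq_intros)
      from vector_diff_chain_at[OF this A]
      have "((\<lambda>x. A (x + e n)) has_vector_derivative G (x + e n)) (at x)"
        by (simp add: o_def)
      then have "((\<lambda>x. (A (x + e n) - A x) /\<^sub>R e n) has_vector_derivative (G (x + e n) - G x) /\<^sub>R e n) (at x)"
        by (intro has_vector_derivative_diff A bounded_linear.has_vector_derivative[OF bounded_linear_scaleR_right])
      then show "((\<lambda>x. (A (x + e n) - A x) /\<^sub>R e n) has_vector_derivative (G (x + e n) - G x) /\<^sub>R e n) (at x within {a..b})"
        by (rule has_vector_derivative_at_within)
    qed
    then show ?thesis .
  qed
  moreover have "(\<lambda>n. (A (b + e n) - A b) /\<^sub>R e n - (A (a + e n) - A a) /\<^sub>R e n) \<longlonglongrightarrow> G b - G a"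
    by (intro tendsto_diff has_vector_derivative_LIMSEQ A e e0)
  ultimately show "(LINT x:{a..b}|lborel. vector_derivative G (at x)) = G b - G a"
    using dct(2) LIMSEQ_unique unfolding set_lebesgue_integral_def by fastforce
qed

lemma emeasure_lborel_compact_finite: "compact K \<Longrightarrow> emeasure lborel K < top"
  using emeasure_bounded_finite[OF compact_imp_bounded] by auto

subsection \<open>Translations\<close>

lemma borel_measurable_fst_borel [measurable (raw)]:
  fixes f :: "'x \<Rightarrow> 'a::second_countable_topology \<times> 'b::second_countable_topology"
  assumes "f \<in> borel_measurable M" shows "(\<lambda>x. fst (f x)) \<in> borel_measurable M"
  using assms unfolding borel_prod[symmetric] by measurable
lemma borel_measurable_snd_borel [measurable (raw)]:
  fixes f :: "'x \<Rightarrow> 'a::second_countable_topology \<times> 'b::second_countable_topology"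
  assumes "f \<in> borel_measurable M" shows "(\<lambda>x. snd (f x)) \<in> borel_measurable M"
  using assms unfolding borel_prod[symmetric] by measurable

lemma sets_borel_cball [measurable]: "cball a r \<in> sets borel"
  by (intro borel_closed closed_cball)

lemma sets_borel_cball_Times [measurable]:
  fixes a :: "'a::euclidean_space" and b :: "'b::euclidean_space"
  shows "cball a r \<times> cball b s \<in> sets borel"
  by (intro borel_closed closed_Times closed_cball)

text \<open>\<open>measurable_on\<close> supplies continuous functions that converge off a
  negligible set. Truncation at -C and C makes them uniformly bounded without disturbing the limit,
  as dominated convergence requires.\<close>

lemma bounded_borel_continuous_approx:
  fixes h :: "'e::euclidean_space \<Rightarrow> real"
  assumes [measurable]: "h \<in> borel_measurable borel" and C: "\<And>x. \<bar>h x\<bar> \<le> C"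
  obtains g where "\<And>n::nat. continuous_on UNIV (g n)" "\<And>n x. \<bar>g n x\<bar> \<le> C"
    "AE x in lborel. (\<lambda>n. g n x) \<longlonglongrightarrow> h x"
proof -
  have "h measurable_on UNIV"
    by (rule lebesgue_measurable_imp_measurable_on) (auto intro!: measurable_completion)
  then obtain N g where N: "negligible N" and g: "\<And>n. continuous_on UNIV (g n)"
    and lim: "\<And>x. x \<notin> N \<Longrightarrow> (\<lambda>n. g n x) \<longlonglongrightarrow> h x"
    unfolding measurable_on_def by auto
  define g' where "g' n x = max (- C) (min C (g n x))" for n x
  have C0: "0 \<le> C" using C[of 0] by simp
  have "AE x in lebesgue. (\<lambda>n. g n x) \<longlonglongrightarrow> h x"
    by (rule AE_I'[of N]) (use N lim in \<open>auto simp: negligible_iff_null_sets\<close>)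
  then have ae: "AE x in lborel. (\<lambda>n. g n x) \<longlonglongrightarrow> h x" by (simp add: AE_completion_iff)
  show thesis
  proof (rule that[of g'])
    show "continuous_on UNIV (g' n)" for n
      unfolding g'_def by (intro continuous_intros g)
    show "\<bar>g' n x\<bar> \<le> C" for n x using C0 by (auto simp: g'_def)
    show "AE x in lborel. (\<lambda>n. g' n x) \<longlonglongrightarrow> h x"
      using ae
    proof eventually_elim
      case (elim x)
      then have "(\<lambda>n. g' n x) \<longlonglongrightarrow> max (- C) (min C (h x))"
        unfolding g'_def by (intro tendsto_intros)
      then show ?case using C[of x] by (simp add: abs_le_iff)
    qed
  qed
qed

lemma nn_integral_lborel_translate:
  fixes f :: "'e::euclidean_space \<Rightarrow> ennreal"
  assumes [measurable]: "f \<in> borel_measurable borel"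
  shows "(\<integral>\<^sup>+x. f (x + a) \<partial>lborel) = (\<integral>\<^sup>+x. f x \<partial>lborel)"
proof -
  have "(\<integral>\<^sup>+x. f x \<partial>lborel) = (\<integral>\<^sup>+x. f x \<partial>distr lborel borel ((+) a))"
    by (simp only: lborel_distr_plus)
  also have "\<dots> = (\<integral>\<^sup>+x. f (a + x) \<partial>lborel)" by (subst nn_integral_distr) auto
  finally show ?thesis by (simp add: add.commute)
qed

text \<open>For fixed second component the shift is a translation, and it maps the ball of radius
  \<open>N\<close> into the ball of radius \<open>2 * N\<close>. The bound does not depend on
  \<open>e\<close>, which makes errors of approximation uniform along a sequence of shifts.\<close>

lemma nn_integral_shear_le:
  fixes d :: "'e::euclidean_space \<Rightarrow> ennreal"
  assumes [measurable]: "d \<in> borel_measurable borel" and e: "\<bar>e\<bar> \<le> 1"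
  shows "(\<integral>\<^sup>+z. indicator (cball 0 N \<times> cball 0 N) z * d (fst z + e *\<^sub>R snd z) \<partial>(lborel :: ('e \<times> 'e) measure))
    \<le> emeasure lborel (cball 0 N :: 'e set) * (\<integral>\<^sup>+x. indicator (cball 0 (2 * N)) x * d x \<partial>lborel)"
proof -
  have "(\<integral>\<^sup>+z. indicator (cball 0 N \<times> cball 0 N) z * d (fst z + e *\<^sub>R snd z) \<partial>(lborel :: ('e \<times> 'e) measure))
    = (\<integral>\<^sup>+w. \<integral>\<^sup>+q. indicator (cball 0 N \<times> cball 0 N) (q, w) * d (q + e *\<^sub>R w) \<partial>lborel \<partial>lborel)"
    unfolding lborel_prod[symmetric]
    by (subst lborel_pair.nn_integral_snd[symmetric]) (simp_all add: lborel_prod, measurable)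
  also have "\<dots> \<le> (\<integral>\<^sup>+w. indicator (cball 0 N) w * (\<integral>\<^sup>+q. indicator (cball 0 (2 * N)) (q + e *\<^sub>R w) * d (q + e *\<^sub>R w) \<partial>lborel) \<partial>lborel)"
  proof (rule nn_integral_mono)
    fix w :: 'e
    show "(\<integral>\<^sup>+q. indicator (cball 0 N \<times> cball 0 N) (q, w) * d (q + e *\<^sub>R w) \<partial>lborel) \<le>
      indicator (cball 0 N) w * (\<integral>\<^sup>+q. indicator (cball 0 (2 * N)) (q + e *\<^sub>R w) * d (q + e *\<^sub>R w) \<partial>lborel)"
    proof (cases "norm w \<le> N")
      case True
      have "norm (q + e *\<^sub>R w) \<le> 2 * N" if "norm q \<le> N" for q
      proof -
        have "norm (e *\<^sub>R w) \<le> 1 * norm w" unfolding norm_scaleR using e by (intro mult_right_mono) auto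
        then show ?thesis using that True norm_triangle_ineq[of q "e *\<^sub>R w"] by simp
      qed
      then show ?thesis using True by (auto intro!: nn_integral_mono simp: indicator_def)
    qed (auto simp: indicator_def)
  qed
  also have "\<dots> = (\<integral>\<^sup>+w. indicator (cball 0 N) (w::'e) * (\<integral>\<^sup>+x. indicator (cball 0 (2 * N)) x * d x \<partial>lborel) \<partial>lborel)"
    by (subst nn_integral_lborel_translate) auto
  also have "\<dots> = emeasure lborel (cball 0 N :: 'e set) * (\<integral>\<^sup>+x. indicator (cball 0 (2 * N)) x * d x \<partial>lborel)"
    by (subst nn_integral_multc) auto
  finally show ?thesis .
qed

text \<open>Continuity of translations in the mean, jointly over the base point and the direction of
  the shift. For continuous bounded functions dominated convergence suffices; the shear bound
  controls the error of the approximation uniformly in the shift.\<close>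

lemma translation_L1_tendsto:
  fixes h :: "'e::euclidean_space \<Rightarrow> real"
  assumes [measurable]: "h \<in> borel_measurable borel" and C: "\<And>x. \<bar>h x\<bar> \<le> C"
    and e: "e \<longlonglongrightarrow> (0::real)"
  shows "(\<lambda>n. \<integral>\<^sup>+z. indicator (cball 0 N \<times> cball 0 N) z * ennreal \<bar>h (fst z + e n *\<^sub>R snd z) - h (fst z)\<bar> \<partial>(lborel :: ('e \<times> 'e) measure))
    \<longlonglongrightarrow> 0"
proof -
  define K where "K = (cball 0 N \<times> cball 0 N :: ('e \<times> 'e) set)"
  have K: "compact K" "K \<in> sets borel" unfolding K_def
    by (auto intro!: compact_Times borel_closed closed_Times)
  note [measurable] = K(2)
  define A where "A n g = (\<integral>\<^sup>+z. indicator K z * ennreal \<bar>g (fst z + e n *\<^sub>R snd z) - g (fst z)\<bar> \<partial>(lborel :: ('e \<times> 'e) measure))" for n and g :: "'e \<Rightarrow> real"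
  define D where "D g = (\<integral>\<^sup>+x. indicator (cball 0 (2 * N)) x * ennreal \<bar>h x - g x\<bar> \<partial>lborel)" for g
  define B where "B = emeasure lborel (cball 0 N :: 'e set)"
  have B: "B < \<infinity>" unfolding B_def by (rule emeasure_lborel_cball_finite)
  obtain g where g: "\<And>n::nat. continuous_on UNIV (g n)" "\<And>n x. \<bar>g n x\<bar> \<le> C"
    "AE x in lborel. (\<lambda>n. g n x) \<longlonglongrightarrow> h x"
    using bounded_borel_continuous_approx[OF assms(1) C] by blast
  have [measurable]: "g k \<in> borel_measurable borel" for k
    using g(1) by (rule borel_measurable_continuous_onI)
  have bd: "\<bar>a - b\<bar> \<le> 2 * C" if "\<bar>a\<bar> \<le> C" "\<bar>b\<bar> \<le> C" for a b
    using that by simp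
  have D0: "(\<lambda>k. D (g k)) \<longlonglongrightarrow> 0"
  proof -
    have "(\<lambda>k. D (g k)) \<longlonglongrightarrow> (\<integral>\<^sup>+x. 0 \<partial>(lborel :: 'e measure))"
      unfolding D_def
    proof (rule nn_integral_dominated_convergence)
      show "(\<integral>\<^sup>+x. indicator (cball 0 (2 * N)) (x::'e) * ennreal (2 * C) \<partial>lborel) < \<infinity>"
        by (subst nn_integral_multc) (auto simp: ennreal_mult_less_top intro!: emeasure_lborel_compact_finite)
      fix k
      show "AE x in lborel. indicator (cball 0 (2 * N)) x * ennreal \<bar>h x - g k x\<bar> \<le> indicator (cball 0 (2 * N)) x * ennreal (2 * C)"
        by (intro AE_I2 mult_left_mono ennreal_leI bd C g(2)) auto
    next
      show "AE x in lborel. (\<lambda>k. indicator (cball 0 (2 * N)) x * ennreal \<bar>h x - g k x\<bar>) \<longlonglongrightarrow> 0"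
        using g(3)
      proof eventually_elim
        case (elim x)
        have "(\<lambda>k. ennreal \<bar>h x - g k x\<bar>) \<longlonglongrightarrow> ennreal \<bar>h x - h x\<bar>"
          by (intro tendsto_intros elim)
        then show ?case by (cases "x \<in> cball 0 (2 * N)") auto
      qed
    qed auto
    then show ?thesis by simp
  qed
  have Ag: "(\<lambda>n. A n (g k)) \<longlonglongrightarrow> 0" for k
  proof -
    have "(\<lambda>n. A n (g k)) \<longlonglongrightarrow> (\<integral>\<^sup>+x. 0 \<partial>(lborel :: ('e \<times> 'e) measure))"
      unfolding A_def
    proof (rule nn_integral_dominated_convergence)
      show "(\<integral>\<^sup>+z. indicator K z * ennreal (2 * C) \<partial>lborel) < \<infinity>"
        using K by (subst nn_integral_multc) (auto simp: ennreal_mult_less_top intro!: emeasure_lborel_compact_finite)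
      fix n
      show "AE z in lborel. indicator K z * ennreal \<bar>g k (fst z + e n *\<^sub>R snd z) - g k (fst z)\<bar> \<le> indicator K z * ennreal (2 * C)"
        by (intro AE_I2 mult_left_mono ennreal_leI bd g(2)) auto
    next
      show "AE z in lborel. (\<lambda>n. indicator K z * ennreal \<bar>g k (fst z + e n *\<^sub>R snd z) - g k (fst z)\<bar>) \<longlonglongrightarrow> 0"
      proof (rule AE_I2)
        fix z :: "'e \<times> 'e"
        have "(\<lambda>n. g k (fst z + e n *\<^sub>R snd z)) \<longlonglongrightarrow> g k (fst z + 0 *\<^sub>R snd z)"
          using g(1)[of k] by (intro isCont_tendsto_compose[of _ "g k"] tendsto_intros e) (auto simp: continuous_on_eq_continuous_at)
        then have "(\<lambda>n. ennreal \<bar>g k (fst z + e n *\<^sub>R snd z) - g k (fst z)\<bar>) \<longlonglongrightarrow> ennreal \<bar>g k (fst z + 0 *\<^sub>R snd z) - g k (fst z)\<bar>"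
          by (intro tendsto_intros)
        then show "(\<lambda>n. indicator K z * ennreal \<bar>g k (fst z + e n *\<^sub>R snd z) - g k (fst z)\<bar>) \<longlonglongrightarrow> 0"
          by (cases "z \<in> K") auto
      qed
    qed (use K in auto)
    then show ?thesis by simp
  qed
  have le: "A n h \<le> A n (g k) + 2 * (B * D (g k))" if "\<bar>e n\<bar> \<le> 1" for n k
  proof -
    let ?d = "\<lambda>x. ennreal \<bar>h x - g k x\<bar>"
    \<comment> \<open>The unshifted error is written with the shift
      \<open>0 *\<^sub>R snd z\<close>, so that the shear bound covers it too.\<close>
    have "A n h \<le> (\<integral>\<^sup>+z. indicator K z * ennreal \<bar>g k (fst z + e n *\<^sub>R snd z) - g k (fst z)\<bar> +
        (indicator K z * ?d (fst z + e n *\<^sub>R snd z) + indicator K z * ?d (fst z + 0 *\<^sub>R snd z)) \<partial>lborel)"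
      unfolding A_def
      by (intro nn_integral_mono) (auto simp: indicator_def simp flip: ennreal_plus intro!: ennreal_leI)
    also have "\<dots> = A n (g k) + ((\<integral>\<^sup>+z. indicator K z * ?d (fst z + e n *\<^sub>R snd z) \<partial>lborel)
         + (\<integral>\<^sup>+z. indicator K z * ?d (fst z + 0 *\<^sub>R snd z) \<partial>lborel))"
      unfolding A_def by (simp add: nn_integral_add)
    also have "\<dots> \<le> A n (g k) + (B * D (g k) + B * D (g k))"
      unfolding K_def B_def D_def
      by (intro add_mono order_refl nn_integral_shear_le[where d = ?d]) (use that in auto)
    finally show ?thesis by (simp add: mult_2)
  qed
  have "(\<lambda>n. A n h) \<longlonglongrightarrow> 0"
  proof (rule tendsto_zero_ennreal)
    fix r :: real assume r: "0 < r"
    have "(\<lambda>k. 2 * (B * D (g k))) \<longlonglongrightarrow> 2 * (B * 0)"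
      using B by (intro ennreal_tendsto_cmult D0) auto
    then have "\<forall>\<^sub>F k in sequentially. 2 * (B * D (g k)) < ennreal (r / 2)"
      using r by (intro order_tendstoD(2)) auto
    then obtain k where k: "2 * (B * D (g k)) < ennreal (r / 2)"
      by (auto simp: eventually_sequentially)
    have "\<forall>\<^sub>F n in sequentially. A n (g k) < ennreal (r / 2)"
      using r by (intro order_tendstoD(2)[OF Ag]) auto
    moreover have "\<forall>\<^sub>F n in sequentially. \<bar>e n\<bar> < 1"
      using order_tendstoD(2)[OF tendsto_rabs[OF e], of 1] by simp
    ultimately show "\<forall>\<^sub>F n in sequentially. A n h < ennreal r"
    proof eventually_elim
      case (elim n)
      have "A n h \<le> A n (g k) + 2 * (B * D (g k))" using elim by (intro le) simp
      also have "\<dots> < ennreal (r / 2) + ennreal (r / 2)"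
        by (rule add_strict_mono[OF elim(1) k])
      also have "\<dots> = ennreal r" using r by (simp flip: ennreal_plus)
      finally show ?case .
    qed
  qed
  then show ?thesis unfolding A_def K_def .
qed

text \<open>The doubled integrand depends on the states nonlinearly, through \<open>f\<close> and
  its derivatives, so its limit requires pointwise convergence. A subsequence of the mean-convergent
  translates provides it for almost every pair of base point and direction.\<close>

lemma translation_AE_subseq:
  fixes h :: "'e::euclidean_space \<Rightarrow> real"
  assumes [measurable]: "h \<in> borel_measurable borel" and C: "\<And>x. \<bar>h x\<bar> \<le> C"
    and e: "e \<longlonglongrightarrow> (0::real)"
  obtains r :: "nat \<Rightarrow> nat" where "strict_mono r"
    "AE z in (lborel :: ('e \<times> 'e) measure). z \<in> cball 0 N \<times> cball 0 N \<longrightarrow>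
      (\<lambda>n. h (fst z + e (r n) *\<^sub>R snd z)) \<longlonglongrightarrow> h (fst z)"
proof -
  define K where "K = (cball 0 N \<times> cball 0 N :: ('e \<times> 'e) set)"
  have K: "compact K" "K \<in> sets borel" unfolding K_def
    by (auto intro!: compact_Times borel_closed closed_Times)
  define u where "u n z = indicator K z * (h (fst z + e n *\<^sub>R snd z) - h (fst z))" for n and z :: "'e \<times> 'e"
  have int: "integrable lborel (u n)" for n
  proof (rule Bochner_Integration.integrable_bound)
    show "integrable lborel (\<lambda>z. 2 * C * indicator K z)"
      using K by (intro integrable_mult_right integrable_real_indicator) (auto intro: emeasure_lborel_compact_finite)
    show "u n \<in> borel_measurable lborel" unfolding u_def using K by measurable
    have "\<bar>h x - h y\<bar> \<le> 2 * C" for x y using C[of x] C[of y] by simp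
    then show "AE z in lborel. norm (u n z) \<le> norm (2 * C * indicator K z)"
      by (intro AE_I2) (auto simp: u_def indicator_def intro: order.trans[OF _ abs_ge_self])
  qed
  have "(\<lambda>n. \<integral>z. norm (u n z) \<partial>lborel) \<longlonglongrightarrow> enn2real 0"
  proof -
    have "(\<integral>z. norm (u n z) \<partial>lborel) = enn2real (\<integral>\<^sup>+z. indicator K z * ennreal \<bar>h (fst z + e n *\<^sub>R snd z) - h (fst z)\<bar> \<partial>(lborel :: ('e \<times> 'e) measure))" for n
    proof (subst integral_eq_nn_integral)
      show "enn2real (\<integral>\<^sup>+ z. ennreal (norm (u n z)) \<partial>lborel) = enn2real (\<integral>\<^sup>+z. indicator K z * ennreal \<bar>h (fst z + e n *\<^sub>R snd z) - h (fst z)\<bar> \<partial>lborel)"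
        by (intro arg_cong[where f = enn2real] nn_integral_cong) (auto simp: u_def indicator_def)
    qed (use int in \<open>auto intro: borel_measurable_integrable\<close>)
    moreover have "(\<lambda>n. enn2real (\<integral>\<^sup>+z. indicator K z * ennreal \<bar>h (fst z + e n *\<^sub>R snd z) - h (fst z)\<bar> \<partial>(lborel :: ('e \<times> 'e) measure))) \<longlonglongrightarrow> enn2real 0"
      unfolding K_def using translation_L1_tendsto[OF assms(1) C e] by (intro tendsto_enn2real) auto
    ultimately show ?thesis by simp
  qed
  then obtain r where r: "strict_mono r" "AE z in lborel. (\<lambda>n. u (r n) z) \<longlonglongrightarrow> 0"
    using tendsto_L1_AE_subseq[of lborel u] int by auto
  from r(2) have "AE z in (lborel :: ('e \<times> 'e) measure). z \<in> cball 0 N \<times> cball 0 N \<longrightarrow>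
      (\<lambda>n. h (fst z + e (r n) *\<^sub>R snd z)) \<longlonglongrightarrow> h (fst z)"
    by eventually_elim (auto simp: u_def K_def LIM_zero_iff)
  then show thesis by (rule that[OF r(1)])
qed

subsection \<open>Flux functions\<close>

text \<open>\<open>D x k b\<close> is the derivative of \<open>f (\<cdot>, k)\<close> at \<open>x\<close> in direction \<open>b\<close>, replaced by \<open>0\<close> on the Borel null
  set \<open>B\<close>, so that it is jointly Borel measurable in \<open>(x, k)\<close>.\<close>

locale flux =
  fixes f :: "'a::euclidean_space \<times> real \<Rightarrow> 'a" and B :: "'a set" and D :: "'a \<Rightarrow> real \<Rightarrow> 'a \<Rightarrow> 'a"
  assumes lip_compact: "\<And>C. compact C \<Longrightarrow> \<exists>L. L-lipschitz_on C f"
    and B_null: "B \<in> null_sets lborel"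
    and D_measurable: "\<And>b. (\<lambda>p. D (fst p) (snd p) b) \<in> borel_measurable borel"
    and D_deriv: "\<And>x k. x \<notin> B \<Longrightarrow> ((\<lambda>y. f (y, k)) has_derivative (\<lambda>h. \<Sum>b\<in>Basis. (h \<bullet> b) *\<^sub>R D x k b)) (at x)"
    and D_null: "\<And>x k b. x \<in> B \<Longrightarrow> D x k b = 0"
    and D_cont: "\<And>x b. continuous_on UNIV (\<lambda>k. D x k b)"
    and D_unif: "\<And>x K e. x \<notin> B \<Longrightarrow> compact K \<Longrightarrow> 0 < e \<Longrightarrow>
       \<exists>d>0. \<forall>y k. norm (y - x) < d \<longrightarrow> k \<in> K \<longrightarrow>
         norm (f (y, k) - f (x, k) - (\<Sum>b\<in>Basis. ((y - x) \<bullet> b) *\<^sub>R D x k b)) \<le> e * norm (y - x)"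

text \<open>The hypothesis is read as \<open>local_lipschitz\<close> with a one-point parameter set,
  for which compactness yields a single constant.\<close>

lemma lipschitz_on_compact:
  fixes f :: "'b::metric_space \<Rightarrow> 'c::metric_space"
  assumes loc: "\<forall>p. \<exists>e>0. \<exists>L. L-lipschitz_on (ball p e) f" and C: "compact C"
  shows "\<exists>L. L-lipschitz_on C f"
proof -
  have "local_lipschitz {0::real} UNIV (\<lambda>_. f)"
  proof (rule local_lipschitzI)
    fix t :: real and p
    obtain e L where "e > 0" "L-lipschitz_on (ball p e) f" using loc by blast
    then have "L-lipschitz_on (cball p (e/2) \<inter> UNIV) f"
      by (auto intro: lipschitz_on_subset)
    then show "\<exists>u>0. \<exists>L. \<forall>t\<in>cball t u \<inter> {0::real}. L-lipschitz_on (cball p u \<inter> UNIV) f"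
      using \<open>e > 0\<close> by (intro exI[of _ "e/2"]) auto
  qed
  then have "local_lipschitz {0::real} C (\<lambda>_. f)" by (rule local_lipschitz_subset) auto
  from local_lipschitz_compact_implies_lipschitz[OF this C] show ?thesis
    by (metis continuous_on_const compact_sing singletonI)
qed

lemma sum_Basis_scaleR:
  fixes g :: "'b::euclidean_space \<Rightarrow> 'c::real_vector"
  assumes "b \<in> Basis"
  shows "(\<Sum>i\<in>Basis. (b \<bullet> i) *\<^sub>R g i) = g b"
proof -
  have "(\<Sum>i\<in>Basis. (b \<bullet> i) *\<^sub>R g i) = (\<Sum>i\<in>Basis. if i = b then g i else 0)"
    using assms by (intro sum.cong refl) (auto simp: inner_Basis)
  then show ?thesis using assms by simp
qed

text \<open>The exceptional set is enlarged to a Borel null set. Off this set the derivative is the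
  limit of difference quotients along the fixed steps \<open>1 / Suc n\<close>, and such a limit is
  a Borel function of (x, k) jointly.\<close>

lemma flux_assumption_imp_flux:
  fixes f :: "'a::euclidean_space \<times> real \<Rightarrow> 'a"
  assumes "flux_assumption f"
  obtains B D where "flux f B D"
proof -
  have loc: "\<forall>p. \<exists>e>0. \<exists>L. L-lipschitz_on (ball p e) f"
    using assms by (simp add: flux_assumption_def)
  obtain \<Theta> where \<Theta>: "\<Theta> \<in> null_sets lebesgue"
    and diff: "\<forall>k x. x \<notin> \<Theta> \<longrightarrow> (\<lambda>y. f (y, k)) differentiable (at x)"
    and cont: "\<forall>x. x \<notin> \<Theta> \<longrightarrow> continuous_on UNIV (\<lambda>k. Blinfun (frechet_derivative (\<lambda>y. f (y, k)) (at x)))"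
    and unif: "\<forall>x. x \<notin> \<Theta> \<longrightarrow> (\<forall>K. compact K \<longrightarrow> ((\<lambda>y. SUP k\<in>K. ennreal
               (norm (f (y, k) - f (x, k) - frechet_derivative (\<lambda>z. f (z, k)) (at x) (y - x))
                 / norm (y - x))) \<longlongrightarrow> 0) (at x))"
    using assms unfolding flux_assumption_def
    by (elim conjE bexE) (erule that[rotated -1]; assumption)
  obtain B where B: "B \<in> null_sets lborel" "\<Theta> \<subseteq> B"
    using \<Theta> by (auto simp: null_sets_completion_iff2)
  then have [measurable]: "B \<in> sets borel" by auto
  have contf: "continuous_on UNIV f"
  proof (rule continuous_at_imp_continuous_on, rule ballI)
    fix p
    obtain e L where "e > 0" "L-lipschitz_on (ball p e) f" using loc by blast
    then show "isCont f p"
      by (meson centre_in_ball continuous_on_eq_continuous_at lipschitz_on_continuous_on open_ball)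
  qed
  then have [measurable]: "f \<in> borel_measurable borel" by (rule borel_measurable_continuous_onI)
  define D where "D x k b = (if x \<in> B then 0 else lim (\<lambda>n. (f (x + (1 / Suc n) *\<^sub>R b, k) - f (x, k)) /\<^sub>R (1 / Suc n)))" for x k b
  let ?F = "\<lambda>x k. frechet_derivative (\<lambda>y. f (y, k)) (at x)"
  have F: "((\<lambda>y. f (y, k)) has_derivative ?F x k) (at x)" if "x \<notin> B" for x k
    using diff that B(2) frechet_derivative_works by blast
  have bl: "bounded_linear (?F x k)" if "x \<notin> B" for x k
    using F[OF that] by (rule has_derivative_bounded_linear)
  have DF: "D x k b = ?F x k b" if x: "x \<notin> B" for x k b
  proof -
    interpret bounded_linear "?F x k" by (rule bl[OF x])
    have "((\<lambda>s. x + s *\<^sub>R b) has_derivative (\<lambda>s. s *\<^sub>R b)) (at 0)"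
      by (auto intro!: derivative_eq_intros)
    then have "((\<lambda>s. f (x + s *\<^sub>R b, k)) has_derivative (\<lambda>s. ?F x k (s *\<^sub>R b))) (at 0)"
      using has_derivative_compose[of "\<lambda>s. x + s *\<^sub>R b" "\<lambda>s. s *\<^sub>R b" 0 UNIV "\<lambda>y. f (y, k)" "?F x k"] F[OF x] by simp
    then have "((\<lambda>s. f (x + s *\<^sub>R b, k)) has_vector_derivative ?F x k b) (at 0)"
      by (simp add: has_vector_derivative_def scaleR)
    from has_vector_derivative_LIMSEQ[OF this LIMSEQ_Suc[OF lim_inverse_n']]
    show ?thesis using x by (simp add: D_def limI)
  qed
  have Fsum: "?F x k h = (\<Sum>b\<in>Basis. (h \<bullet> b) *\<^sub>R D x k b)" if x: "x \<notin> B" for x k h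
  proof -
    interpret bounded_linear "?F x k" by (rule bl[OF x])
    have "?F x k h = ?F x k (\<Sum>b\<in>Basis. (h \<bullet> b) *\<^sub>R b)" by (simp add: euclidean_representation)
    also have "\<dots> = (\<Sum>b\<in>Basis. (h \<bullet> b) *\<^sub>R D x k b)" using x by (simp add: sum scaleR DF)
    finally show ?thesis .
  qed
  have "flux f B D"
  proof
    show "\<exists>L. L-lipschitz_on C f" if "compact C" for C using loc that by (rule lipschitz_on_compact)
    show "B \<in> null_sets lborel" by fact
    show "(\<lambda>p. D (fst p) (snd p) b) \<in> borel_measurable borel" for b
      unfolding D_def by measurable
    show "((\<lambda>y. f (y, k)) has_derivative (\<lambda>h. \<Sum>b\<in>Basis. (h \<bullet> b) *\<^sub>R D x k b)) (at x)" if "x \<notin> B" for x k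
      using F[OF that, of k] by (simp add: Fsum[OF that, abs_def])
    show "D x k b = 0" if "x \<in> B" for x k b using that by (simp add: D_def)
    show "continuous_on UNIV (\<lambda>k. D x k b)" for x b
    proof (cases "x \<in> B")
      case False
      have "continuous_on UNIV (\<lambda>k. blinfun_apply (Blinfun (?F x k)) b)"
        using cont False B(2) by (intro continuous_intros) auto
      then show ?thesis using False by (simp add: bounded_linear_Blinfun_apply bl DF)
    qed (simp add: D_def)
    fix x and K :: "real set" and e :: real assume x: "x \<notin> B" and K: "compact K" and e: "0 < e"
    have "\<forall>\<^sub>F y in at x. (SUP k\<in>K. ennreal (norm (f (y, k) - f (x, k) - ?F x k (y - x)) / norm (y - x))) < ennreal e"
      using x B(2) K e by (intro order_tendstoD(2)[OF unif[rule_format]]) auto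
    then obtain d where "d > 0" and d: "\<And>y. y \<noteq> x \<Longrightarrow> norm (y - x) < d \<Longrightarrow>
       (SUP k\<in>K. ennreal (norm (f (y, k) - f (x, k) - ?F x k (y - x)) / norm (y - x))) < ennreal e"
      by (auto simp: eventually_at dist_norm)
    have "norm (f (y, k) - f (x, k) - (\<Sum>b\<in>Basis. ((y - x) \<bullet> b) *\<^sub>R D x k b)) \<le> e * norm (y - x)"
      if "norm (y - x) < d" "k \<in> K" for y k
    proof (cases "y = x")
      case False
      have "ennreal (norm (f (y, k) - f (x, k) - ?F x k (y - x)) / norm (y - x)) \<le>
         (SUP k\<in>K. ennreal (norm (f (y, k) - f (x, k) - ?F x k (y - x)) / norm (y - x)))"
        using that(2) by (rule SUP_upper)
      also have "\<dots> < ennreal e" using False that by (intro d) auto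
      finally have "norm (f (y, k) - f (x, k) - ?F x k (y - x)) / norm (y - x) < e"
        using e by (simp add: ennreal_less_iff)
      then show ?thesis using False by (simp add: Fsum[OF x] divide_less_eq)
    qed simp
    then show "\<exists>d>0. \<forall>y k. norm (y - x) < d \<longrightarrow> k \<in> K \<longrightarrow>
         norm (f (y, k) - f (x, k) - (\<Sum>b\<in>Basis. ((y - x) \<bullet> b) *\<^sub>R D x k b)) \<le> e * norm (y - x)"
      using \<open>d > 0\<close> by blast
  qed
  then show thesis by (rule that)
qed

context flux begin

text \<open>For \<open>x\<close> outside \<open>B\<close> this is the divergence in the explicit
  \<open>x\<close>-variable; on \<open>B\<close> it is 0.\<close>

definition flux_div :: "'a \<Rightarrow> real \<Rightarrow> real" where
  "flux_div x k = (\<Sum>b\<in>Basis. D x k b \<bullet> b)"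

text \<open>Kruzhkov's flux, the one that belongs to the entropy \<bar>c - k\<bar>.\<close>

definition kflux :: "'a \<Rightarrow> real \<Rightarrow> real \<Rightarrow> 'a" where
  "kflux x c k = sgn (c - k) *\<^sub>R (f (x, c) - f (x, k))"

lemma B_sets [measurable]: "B \<in> sets borel"
  using B_null by auto

lemma continuous_f: "continuous_on UNIV f"
proof (rule continuous_at_imp_continuous_on, rule ballI)
  fix p :: "'a \<times> real"
  obtain L where "L-lipschitz_on (cball p 1) f" using lip_compact[of "cball p 1"] by auto
  then have "continuous_on (ball p 1) f"
    by (intro continuous_on_subset[OF lipschitz_on_continuous_on ball_subset_cball])
  then show "isCont f p"
    by (simp add: continuous_on_eq_continuous_at)
qed

lemma f_measurable [measurable]: "f \<in> borel_measurable borel"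
  using continuous_f by (rule borel_measurable_continuous_onI)

lemma D_measurable' [measurable (raw)]:
  assumes [measurable]: "g \<in> borel_measurable N" "h \<in> borel_measurable N"
  shows "(\<lambda>p. D (g p) (h p) b) \<in> borel_measurable N"
proof -
  have "(\<lambda>p. (\<lambda>p. D (fst p) (snd p) b) (g p, h p)) \<in> borel_measurable N"
    by (rule measurable_compose[OF _ D_measurable]) measurable
  then show ?thesis by simp
qed

lemma flux_div_measurable [measurable (raw)]:
  assumes [measurable]: "g \<in> borel_measurable N" "h \<in> borel_measurable N"
  shows "(\<lambda>p. flux_div (g p) (h p)) \<in> borel_measurable N"
  unfolding flux_div_def by measurable

lemma kflux_measurable [measurable (raw)]:
  assumes [measurable]: "g \<in> borel_measurable N" "h \<in> borel_measurable N" "j \<in> borel_measurable N"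
  shows "(\<lambda>p. kflux (g p) (h p) (j p)) \<in> borel_measurable N"
  unfolding kflux_def by measurable

text \<open>The sign and the difference both change sign. The symmetry allows the inequalities for
  \<open>U\<close> and for \<open>V\<close> to be added, since each uses the value of the other as
  its constant.\<close>

lemma kflux_sym: "kflux x c k = kflux x k c"
proof -
  have "sgn (k - c) = - sgn (c - k)" using sgn_minus[of "c - k"] by simp
  then show ?thesis unfolding kflux_def by (simp add: scaleR_diff_right)
qed

lemma flux_div_cont: "continuous_on UNIV (\<lambda>k. flux_div x k)"
  unfolding flux_div_def by (intro continuous_intros D_cont)

lemma divergence_f: "x \<notin> B \<Longrightarrow> divergence (\<lambda>y. f (y, k)) x = flux_div x k"
  unfolding divergence_def flux_div_def frechet_derivative_at[OF D_deriv, symmetric]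
  by (intro sum.cong refl) (simp add: sum_Basis_scaleR)

text \<open>A single constant for all local estimates. Those for \<open>D\<close> follow from the
  Lipschitz bound, as a derivative is a limit of difference quotients.\<close>

lemma local_bounds:
  obtains L where "0 \<le> L"
    "\<And>x k. norm x \<le> R \<Longrightarrow> \<bar>k\<bar> \<le> A \<Longrightarrow> norm (f (x, k)) \<le> L"
    "\<And>x y k. norm x \<le> R \<Longrightarrow> norm y \<le> R \<Longrightarrow> \<bar>k\<bar> \<le> A \<Longrightarrow> norm (f (x, k) - f (y, k)) \<le> L * norm (x - y)"
    "\<And>x k l. norm x \<le> R \<Longrightarrow> \<bar>k\<bar> \<le> A \<Longrightarrow> \<bar>l\<bar> \<le> A \<Longrightarrow> norm (f (x, k) - f (x, l)) \<le> L * \<bar>k - l\<bar>"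
    "\<And>x k b. norm x \<le> R \<Longrightarrow> \<bar>k\<bar> \<le> A \<Longrightarrow> b \<in> Basis \<Longrightarrow> norm (D x k b) \<le> L"
    "\<And>x k. norm x \<le> R \<Longrightarrow> \<bar>k\<bar> \<le> A \<Longrightarrow> \<bar>flux_div x k\<bar> \<le> L"
    "\<And>x c k. norm x \<le> R \<Longrightarrow> \<bar>c\<bar> \<le> A \<Longrightarrow> \<bar>k\<bar> \<le> A \<Longrightarrow> norm (kflux x c k) \<le> L"
proof -
  \<comment> \<open>The margin 1 leaves room for difference quotients at points of norm up to
    \<open>R\<close>.\<close>
  define C where "C = cball (0::'a) (R + 1) \<times> {-A..A}"
  have C: "compact C" unfolding C_def by (intro compact_Times) auto
  obtain L where L: "L-lipschitz_on C f" using lip_compact[OF C] by blast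
  have L0: "0 \<le> L" using L by (rule lipschitz_on_nonneg)
  have "compact (f ` C)" using C continuous_f by (intro compact_continuous_image continuous_on_subset[OF continuous_f]) auto
  then obtain L' where L': "\<And>p. p \<in> C \<Longrightarrow> norm (f p) \<le> L'"
    using compact_imp_bounded bounded_iff by (metis imageI)
  have inC: "(x, k) \<in> C" if "norm x \<le> R + 1" "\<bar>k\<bar> \<le> A" for x k
    using that by (auto simp: C_def)
  have 1: "norm (f (x, k) - f (y, k)) \<le> L * norm (x - y)" if "norm x \<le> R + 1" "norm y \<le> R + 1" "\<bar>k\<bar> \<le> A" for x y k
    using lipschitz_onD[OF L inC inC, of x k y k] that by (simp add: dist_norm)
  have 2: "norm (f (x, k) - f (x, l)) \<le> L * \<bar>k - l\<bar>" if "norm x \<le> R" "\<bar>k\<bar> \<le> A" "\<bar>l\<bar> \<le> A" for x k l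
    using lipschitz_onD[OF L inC inC, of x k x l] that by (simp add: dist_norm)
  have 3: "norm (D x k b) \<le> L" if x: "norm x \<le> R" and k: "\<bar>k\<bar> \<le> A" and b: "b \<in> Basis" for x k b
  proof (cases "x \<in> B")
    case False
    have "norm (D x k b) \<le> L + e" if e: "0 < e" for e
    proof -
      obtain d where "d > 0" and d: "\<And>y l. norm (y - x) < d \<Longrightarrow> l \<in> {k} \<Longrightarrow>
         norm (f (y, l) - f (x, l) - (\<Sum>b\<in>Basis. ((y - x) \<bullet> b) *\<^sub>R D x l b)) \<le> e * norm (y - x)"
        using D_unif[OF False compact_sing e, of k] by metis
      define s where "s = min (d / 2) 1"
      have s: "0 < s" "s < d" "s \<le> 1" using \<open>d > 0\<close> by (auto simp: s_def)
      have ns: "norm (s *\<^sub>R b) = s" using s b by simp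
      have "norm (f (x + s *\<^sub>R b, k) - f (x, k) - s *\<^sub>R D x k b) \<le> e * s"
        using d[of "x + s *\<^sub>R b" k] s(2) ns sum_Basis_scaleR[OF b, of "D x k"]
        by (simp add: scaleR_scaleR[symmetric] scaleR_sum_right[symmetric] del: scaleR_scaleR)
      moreover have "norm (f (x + s *\<^sub>R b, k) - f (x, k)) \<le> L * s"
        using 1[of "x + s *\<^sub>R b" x k] x k norm_triangle_ineq[of x "s *\<^sub>R b"] ns s by simp
      ultimately have "norm (s *\<^sub>R D x k b) \<le> L * s + e * s"
        by (smt (verit) norm_triangle_sub norm_minus_commute)
      then have "s * norm (D x k b) \<le> s * (L + e)" using s by (simp add: algebra_simps)
      then show ?thesis using s by simp
    qed
    then show ?thesis by (rule field_le_epsilon)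
  qed (use D_null L0 in auto)
  have 4: "\<bar>flux_div x k\<bar> \<le> DIM('a) * L" if x: "norm x \<le> R" and k: "\<bar>k\<bar> \<le> A" for x k
  proof -
    have "\<bar>flux_div x k\<bar> \<le> (\<Sum>b\<in>(Basis::'a set). L)"
      unfolding flux_div_def
      by (rule order.trans[OF sum_abs sum_mono]) (meson 3 Basis_le_norm order.trans x k)
    then show ?thesis by simp
  qed
  have 5: "norm (kflux x c k) \<le> 2 * L'" if "norm x \<le> R" "\<bar>c\<bar> \<le> A" "\<bar>k\<bar> \<le> A" for x c k
  proof -
    have "norm (kflux x c k) \<le> norm (f (x, c) - f (x, k))"
      by (auto simp: kflux_def sgn_real_def)
    also have "\<dots> \<le> norm (f (x, c)) + norm (f (x, k))" by (rule norm_triangle_ineq4)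
    also have "\<dots> \<le> L' + L'" using that by (intro add_mono L' inC) auto
    finally show ?thesis by simp
  qed
  define LL where "LL = L + DIM('a) * L + 2 * \<bar>L'\<bar>"
  have LL: "L \<le> LL" "DIM('a) * L \<le> LL" "2 * L' \<le> LL" "L' \<le> LL" "0 \<le> LL"
    using L0 mult_nonneg_nonneg[OF of_nat_0_le_iff L0, of "DIM('a)"] unfolding LL_def by linarith+
  show thesis
  proof (rule that[of LL])
    show "norm (f (x, k)) \<le> LL" if "norm x \<le> R" "\<bar>k\<bar> \<le> A" for x k
      using L'[OF inC, of x k] that LL by simp
    show "norm (f (x, k) - f (y, k)) \<le> LL * norm (x - y)" if "norm x \<le> R" "norm y \<le> R" "\<bar>k\<bar> \<le> A" for x y k
      using 1[of x y k] that LL(1) by (smt (verit) mult_right_mono norm_ge_zero)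
    show "norm (f (x, k) - f (x, l)) \<le> LL * \<bar>k - l\<bar>" if "norm x \<le> R" "\<bar>k\<bar> \<le> A" "\<bar>l\<bar> \<le> A" for x k l
      using 2[of x k l] that LL(1) by (smt (verit) mult_right_mono)
    show "norm (D x k b) \<le> LL" if "norm x \<le> R" "\<bar>k\<bar> \<le> A" "b \<in> Basis" for x k b
      using 3[OF that] LL(1) by linarith
    show "\<bar>flux_div x k\<bar> \<le> LL" if "norm x \<le> R" "\<bar>k\<bar> \<le> A" for x k
      using 4[OF that] LL(2) by linarith
    show "norm (kflux x c k) \<le> LL" if "norm x \<le> R" "\<bar>c\<bar> \<le> A" "\<bar>k\<bar> \<le> A" for x c k
      using 5[OF that] LL(3) by linarith
  qed (rule LL(5))
qed

end

subsection \<open>Regularized Kruzhkov entropies\<close>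

definition eta :: "real \<Rightarrow> real \<Rightarrow> real \<Rightarrow> real" where
  "eta \<delta> k s = sqrt ((s - k)\<^sup>2 + \<delta>\<^sup>2)"

definition eta1 :: "real \<Rightarrow> real \<Rightarrow> real \<Rightarrow> real" where
  "eta1 \<delta> k s = (s - k) / sqrt ((s - k)\<^sup>2 + \<delta>\<^sup>2)"

definition eta2 :: "real \<Rightarrow> real \<Rightarrow> real \<Rightarrow> real" where
  "eta2 \<delta> k s = \<delta>\<^sup>2 / sqrt ((s - k)\<^sup>2 + \<delta>\<^sup>2) ^ 3"

lemma eta_pos: "\<delta> \<noteq> 0 \<Longrightarrow> 0 < (s - k)\<^sup>2 + (\<delta>::real)\<^sup>2"
  by (simp add: add_nonneg_pos)

lemma eta_deriv: "\<delta> \<noteq> 0 \<Longrightarrow> (eta \<delta> k has_real_derivative eta1 \<delta> k s) (at s)"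
  unfolding eta_def[abs_def] eta1_def using eta_pos[of \<delta> s k]
  by (auto intro!: derivative_eq_intros simp: field_simps)

lemma eta1_deriv:
  assumes "\<delta> \<noteq> 0" shows "(eta1 \<delta> k has_real_derivative eta2 \<delta> k s) (at s)"
proof -
  let ?q = "sqrt ((s - k)\<^sup>2 + \<delta>\<^sup>2)"
  have q: "0 < ?q" "?q\<^sup>2 = (s - k)\<^sup>2 + \<delta>\<^sup>2" using eta_pos[OF assms, of s k] by auto
  have "(eta1 \<delta> k has_real_derivative (1 * ?q - (s - k) * ((s - k) / ?q)) / (?q * ?q)) (at s)"
    unfolding eta1_def[abs_def]
    by (rule DERIV_divide)
       (use q eta_deriv[OF assms, of k s] in \<open>auto intro!: derivative_eq_intros simp: eta_def[abs_def] eta1_def\<close>)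
  also have "(1 * ?q - (s - k) * ((s - k) / ?q)) / (?q * ?q) = (?q\<^sup>2 - (s - k)\<^sup>2) / ?q ^ 3"
    using q(1) by (simp add: field_simps power2_eq_square power3_eq_cube)
  also have "\<dots> = eta2 \<delta> k s" unfolding q(2) eta2_def by simp
  finally show ?thesis .
qed

lemma eta2_nonneg: "0 \<le> eta2 \<delta> k s"
  by (simp add: eta2_def)

lemma eta2_le: "\<delta> \<noteq> 0 \<Longrightarrow> eta2 \<delta> k s \<le> 1 / \<bar>\<delta>\<bar>"
proof -
  assume d: "\<delta> \<noteq> 0"
  have "\<bar>\<delta>\<bar> ^ 3 \<le> sqrt ((s - k)\<^sup>2 + \<delta>\<^sup>2) ^ 3"
    by (intro power_mono real_le_rsqrt) auto
  then have "\<delta>\<^sup>2 / sqrt ((s - k)\<^sup>2 + \<delta>\<^sup>2) ^ 3 \<le> \<delta>\<^sup>2 / \<bar>\<delta>\<bar> ^ 3"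
    using d eta_pos[of \<delta> s k] by (intro divide_left_mono mult_pos_pos) auto
  also have "\<dots> = 1 / \<bar>\<delta>\<bar>" by (subst power2_abs[symmetric]) (use d in \<open>simp add: power2_eq_square power3_eq_cube\<close>)
  finally show ?thesis by (simp add: eta2_def)
qed

lemma eta2_cont: "\<delta> \<noteq> 0 \<Longrightarrow> continuous_on A (eta2 \<delta> k)"
  unfolding eta2_def[abs_def] using eta_pos[of \<delta> _ k]
  by (intro continuous_intros) (auto simp: less_imp_neq[symmetric])

lemma abs_eta1_le: "\<bar>eta1 \<delta> k s\<bar> \<le> 1"
proof -
  define q where "q = sqrt ((s - k)\<^sup>2 + \<delta>\<^sup>2)"
  have "\<bar>s - k\<bar> \<le> q" unfolding q_def by (intro real_le_rsqrt) auto
  then have "\<bar>s - k\<bar> / \<bar>q\<bar> \<le> 1" by (cases "q = 0") auto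
  then show ?thesis by (simp add: eta1_def q_def[symmetric])
qed

lemma eta_entropy:
  assumes "\<delta> \<noteq> 0"
  shows "convex_on UNIV (eta \<delta> k)" "eta \<delta> k C1_differentiable_on UNIV" "deriv (eta \<delta> k) C1_differentiable_on UNIV"
    "deriv (eta \<delta> k) = eta1 \<delta> k"
proof -
  show d: "deriv (eta \<delta> k) = eta1 \<delta> k"
    using eta_deriv[OF assms] by (auto intro!: DERIV_imp_deriv)
  show "convex_on UNIV (eta \<delta> k)"
    by (rule f''_ge0_imp_convex[OF convex_UNIV eta_deriv[OF assms] eta1_deriv[OF assms] eta2_nonneg])
  have c1: "continuous_on UNIV (eta1 \<delta> k)"
    by (rule DERIV_continuous_on[OF has_field_derivative_at_within[OF eta1_deriv[OF assms]]])
  show "eta \<delta> k C1_differentiable_on UNIV"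
    unfolding C1_differentiable_on_def using eta_deriv[OF assms] c1
    by (auto simp: has_real_derivative_iff_has_vector_derivative[symmetric])
  show "deriv (eta \<delta> k) C1_differentiable_on UNIV"
    unfolding C1_differentiable_on_def d using eta1_deriv[OF assms] eta2_cont[OF assms]
    by (intro exI[of _ "eta2 \<delta> k"]) (auto simp: has_real_derivative_iff_has_vector_derivative[symmetric])
qed

text \<open>The density of \<open>eta2\<close> in the parameter \<theta> of the segment s = k +
  \<theta> * r with r = c - k. It depends on the endpoints only through \<open>r\<close>, and its
  sign carries the orientation.\<close>

definition eta_weight :: "real \<Rightarrow> real \<Rightarrow> real \<Rightarrow> real" where
  "eta_weight \<delta> r \<theta> = r * \<delta>\<^sup>2 / sqrt ((\<theta> * r)\<^sup>2 + \<delta>\<^sup>2) ^ 3"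

text \<open>\<open>eta_integral \<delta> k c g\<close> is the oriented integral of \<open>eta2 \<delta> k s *\<^sub>R g s\<close> over \<open>s\<close> from \<open>k\<close> to \<open>c\<close>, parametrized
  over \<open>{0..1}\<close> so that it is measurable in \<open>c\<close> and needs no distinction of the orientation.\<close>

definition eta_integral :: "real \<Rightarrow> real \<Rightarrow> real \<Rightarrow> (real \<Rightarrow> 'b) \<Rightarrow> 'b::euclidean_space" where
  "eta_integral \<delta> k c g = (LINT \<theta>:{0..1}|lborel. eta_weight \<delta> (c - k) \<theta> *\<^sub>R g (k + \<theta> * (c - k)))"

lemma eta_weight_eta2: "eta_weight \<delta> (c - k) \<theta> = (c - k) * eta2 \<delta> k (k + \<theta> * (c - k))"
  by (simp add: eta_weight_def eta2_def)

lemma eta_weight_cont: "\<delta> \<noteq> 0 \<Longrightarrow> continuous_on A (eta_weight \<delta> r)"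
proof -
  assume "\<delta> \<noteq> 0"
  then have "0 < (\<theta> * r)\<^sup>2 + \<delta>\<^sup>2" for \<theta> by (simp add: add_nonneg_pos)
  then show ?thesis unfolding eta_weight_def[abs_def]
    by (intro continuous_intros) (auto simp: less_imp_neq[symmetric])
qed

lemma eta_weight_integral:
  assumes "\<delta> \<noteq> 0"
  shows "(LINT \<theta>:{0..1}|lborel. eta_weight \<delta> r \<theta>) = eta1 \<delta> 0 r"
proof -
  have "(LINT \<theta>:{0..1}|lborel. eta_weight \<delta> r \<theta>) = eta1 \<delta> 0 (1 * r) - eta1 \<delta> 0 (0 * r)"
    unfolding set_lebesgue_integral_def
  proof (rule integral_FTC_atLeastAtMost)
    fix \<theta> :: real
    have "((\<lambda>\<theta>. eta1 \<delta> 0 (\<theta> * r)) has_real_derivative eta2 \<delta> 0 (\<theta> * r) * r) (at \<theta>)"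
      by (rule DERIV_chain2[OF eta1_deriv[OF assms]]) (auto intro!: derivative_eq_intros)
    then have "((\<lambda>\<theta>. eta1 \<delta> 0 (\<theta> * r)) has_vector_derivative eta_weight \<delta> r \<theta>) (at \<theta>)"
      using eta_weight_eta2[of \<delta> r 0 \<theta>] by (simp add: has_real_derivative_iff_has_vector_derivative mult.commute)
    then show "((\<lambda>\<theta>. eta1 \<delta> 0 (\<theta> * r)) has_vector_derivative eta_weight \<delta> r \<theta>) (at \<theta> within {0..1})"
      by (rule has_vector_derivative_at_within)
  qed (use eta_weight_cont[OF assms] in auto)
  then show ?thesis by (simp add: eta1_def)
qed

lemma eta_weight_abs: "\<bar>eta_weight \<delta> r \<theta>\<bar> = sgn r * eta_weight \<delta> r \<theta>"
  by (auto simp: eta_weight_def abs_mult sgn_real_def)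

text \<open>The weight has one sign, so its total mass is the absolute value of
  \<open>eta1 \<delta> 0 r\<close>. This bound is uniform in \<delta>; both the norm estimate for
  \<open>eta_integral\<close> and its convergence rest on it.\<close>

lemma eta_weight_abs_integral:
  assumes "\<delta> \<noteq> 0"
  shows "(LINT \<theta>:{0..1}|lborel. \<bar>eta_weight \<delta> r \<theta>\<bar>) \<le> 1"
proof -
  have "(LINT \<theta>:{0..1}|lborel. \<bar>eta_weight \<delta> r \<theta>\<bar>) = sgn r * eta1 \<delta> 0 r"
    unfolding eta_weight_abs by (simp add: eta_weight_integral[OF assms])
  also have "\<dots> \<le> 1"
    using abs_eta1_le[of \<delta> 0 r] by (auto simp: sgn_real_def)
  finally show ?thesis .
qed

lemma eta_weight_integrable:
  fixes G :: "real \<Rightarrow> 'b::euclidean_space"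
  assumes "\<delta> \<noteq> 0" "continuous_on {0..1} G"
  shows "set_integrable lborel {0..1} (\<lambda>\<theta>. eta_weight \<delta> r \<theta> *\<^sub>R G \<theta>)"
  by (intro borel_integrable_atLeastAtMost' continuous_intros eta_weight_cont assms)

lemma eta_integral_norm_le:
  fixes g :: "real \<Rightarrow> 'b::euclidean_space"
  assumes d: "\<delta> \<noteq> 0" and g: "continuous_on UNIV g"
    and C: "\<And>\<theta>. 0 \<le> \<theta> \<Longrightarrow> \<theta> \<le> 1 \<Longrightarrow> norm (g (k + \<theta> * (c - k))) \<le> C"
  shows "norm (eta_integral \<delta> k c g) \<le> C"
proof -
  have C0: "0 \<le> C" using order.trans[OF norm_ge_zero C[of 0]] by simp
  have cg: "continuous_on {0..1} (\<lambda>\<theta>. g (k + \<theta> * (c - k)))"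
    by (intro continuous_on_compose2[OF g] continuous_intros) auto
  have "norm (eta_integral \<delta> k c g) \<le> (LINT \<theta>:{0..1}|lborel. norm (eta_weight \<delta> (c - k) \<theta> *\<^sub>R g (k + \<theta> * (c - k))))"
    unfolding eta_integral_def by (rule set_integral_norm_bound[OF eta_weight_integrable[OF d cg]])
  also have "\<dots> \<le> (LINT \<theta>:{0..1}|lborel. C * \<bar>eta_weight \<delta> (c - k) \<theta>\<bar>)"
  proof (rule set_integral_mono)
    show "set_integrable lborel {0..1} (\<lambda>\<theta>. norm (eta_weight \<delta> (c - k) \<theta> *\<^sub>R g (k + \<theta> * (c - k))))"
      by (rule set_integrable_norm[OF eta_weight_integrable[OF d cg]])
    show "set_integrable lborel {0..1} (\<lambda>\<theta>. C * \<bar>eta_weight \<delta> (c - k) \<theta>\<bar>)"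
      by (intro borel_integrable_atLeastAtMost' continuous_intros eta_weight_cont d)
    show "norm (eta_weight \<delta> (c - k) \<theta> *\<^sub>R g (k + \<theta> * (c - k))) \<le> C * \<bar>eta_weight \<delta> (c - k) \<theta>\<bar>" if "\<theta> \<in> {0..1}" for \<theta>
      using C[of \<theta>] that by (simp add: mult.commute[of C] mult_left_mono)
  qed
  also have "\<dots> \<le> C * 1"
    using eta_weight_abs_integral[OF d, of "c - k"] C0 by (simp add: mult_left_mono mult_left_le)
  finally show ?thesis by simp
qed

lemma eta1_tendsto:
  assumes d: "d \<longlonglongrightarrow> (0::real)"
  shows "(\<lambda>n. eta1 (d n) k s) \<longlonglongrightarrow> sgn (s - k)"
proof (cases "s = k")
  case False
  have "(\<lambda>n. (s - k) / sqrt ((s - k)\<^sup>2 + (d n)\<^sup>2)) \<longlonglongrightarrow> (s - k) / sqrt ((s - k)\<^sup>2 + 0\<^sup>2)"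
    by (intro tendsto_intros d) (use False in auto)
  also have "(s - k) / sqrt ((s - k)\<^sup>2 + 0\<^sup>2) = sgn (s - k)"
    by (simp add: real_sgn_eq)
  finally show ?thesis by (simp add: eta1_def)
qed (simp add: eta1_def)

lemma eta_tendsto:
  assumes d: "d \<longlonglongrightarrow> (0::real)"
  shows "(\<lambda>n. eta (d n) k s) \<longlonglongrightarrow> \<bar>s - k\<bar>"
proof -
  have "(\<lambda>n. sqrt ((s - k)\<^sup>2 + (d n)\<^sup>2)) \<longlonglongrightarrow> sqrt ((s - k)\<^sup>2 + 0\<^sup>2)"
    by (intro tendsto_intros d)
  then show ?thesis by (simp add: eta_def)
qed

text \<open>Away from \<theta> = 0 the weight is of order \<delta>^2, so its mass concentrates at
  the endpoint \<open>k\<close> of the segment.\<close>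

lemma eta_weight_le:
  assumes r: "r \<noteq> 0" and g: "0 < \<gamma>" "\<gamma> \<le> \<theta>"
  shows "\<bar>eta_weight \<delta> r \<theta>\<bar> \<le> \<bar>r\<bar> * \<delta>\<^sup>2 / (\<gamma> * \<bar>r\<bar>) ^ 3"
proof -
  have "\<gamma> * \<bar>r\<bar> \<le> \<bar>\<theta> * r\<bar>" using g by (simp add: abs_mult mult_right_mono)
  also have "\<dots> \<le> sqrt ((\<theta> * r)\<^sup>2 + \<delta>\<^sup>2)" by (intro real_le_rsqrt) auto
  finally have le: "\<gamma> * \<bar>r\<bar> \<le> sqrt ((\<theta> * r)\<^sup>2 + \<delta>\<^sup>2)" .
  have "\<bar>eta_weight \<delta> r \<theta>\<bar> = \<bar>r\<bar> * \<delta>\<^sup>2 / sqrt ((\<theta> * r)\<^sup>2 + \<delta>\<^sup>2) ^ 3"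
    by (simp add: eta_weight_def abs_mult)
  also have "\<dots> \<le> \<bar>r\<bar> * \<delta>\<^sup>2 / (\<gamma> * \<bar>r\<bar>) ^ 3"
    using g r le less_le_trans[OF mult_pos_pos[OF g(1), of "\<bar>r\<bar>"] le]
    by (intro divide_left_mono power_mono mult_pos_pos zero_less_power) auto
  finally show ?thesis .
qed

text \<open>The weights form an approximate identity at \<theta> = 0 whose signed mass tends to
  \<open>sgn r\<close>. The oscillation of \<open>G\<close> is split at \<gamma>: below \<gamma>
  continuity and the mass bound suffice, and beyond \<gamma> the weight tends to 0
  uniformly.\<close>

lemma eta_weight_tendsto:
  fixes G :: "real \<Rightarrow> 'b::euclidean_space"
  assumes d: "d \<longlonglongrightarrow> (0::real)" "\<And>n. d n \<noteq> 0" and G: "continuous_on {0..1} G" and r: "r \<noteq> 0"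
  shows "(\<lambda>n. LINT \<theta>:{0..1}|lborel. eta_weight (d n) r \<theta> *\<^sub>R G \<theta>) \<longlonglongrightarrow> sgn r *\<^sub>R G 0"
proof -
  have "compact (G ` {0..1})" by (intro compact_continuous_image G) auto
  then obtain C where C: "\<And>\<theta>. \<theta> \<in> {0..1} \<Longrightarrow> norm (G \<theta>) \<le> C"
    using compact_imp_bounded bounded_iff by (metis imageI)
  have C0: "0 \<le> C" using order.trans[OF norm_ge_zero C[of 0]] by simp
  have G': "continuous_on {0..1} (\<lambda>\<theta>. G \<theta> - G 0)" by (intro continuous_intros G)
  have "(\<lambda>n. LINT \<theta>:{0..1}|lborel. eta_weight (d n) r \<theta> *\<^sub>R (G \<theta> - G 0)) \<longlonglongrightarrow> 0"
  proof (rule tendstoI)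
    fix e :: real assume e: "0 < e"
    obtain \<gamma> where g: "0 < \<gamma>" and \<gamma>: "\<And>\<theta>. \<theta> \<in> {0..1} \<Longrightarrow> \<theta> < \<gamma> \<Longrightarrow> norm (G \<theta> - G 0) < e / 2"
      using G[unfolded continuous_on_iff, rule_format, of 0 "e / 2"] e by (auto simp: dist_norm)
    have "(\<lambda>n. \<bar>r\<bar> * (d n)\<^sup>2 / (\<gamma> * \<bar>r\<bar>) ^ 3 * (2 * C)) \<longlonglongrightarrow> \<bar>r\<bar> * 0\<^sup>2 / (\<gamma> * \<bar>r\<bar>) ^ 3 * (2 * C)"
      using g r by (intro tendsto_intros d) auto
    then have "\<forall>\<^sub>F n in sequentially. \<bar>r\<bar> * (d n)\<^sup>2 / (\<gamma> * \<bar>r\<bar>) ^ 3 * (2 * C) < e / 2"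
      using e by (intro order_tendstoD(2)) auto
    then show "\<forall>\<^sub>F n in sequentially. dist (LINT \<theta>:{0..1}|lborel. eta_weight (d n) r \<theta> *\<^sub>R (G \<theta> - G 0)) 0 < e"
    proof eventually_elim
      case (elim n)
      let ?k = "\<bar>r\<bar> * (d n)\<^sup>2 / (\<gamma> * \<bar>r\<bar>) ^ 3"
      have "norm (LINT \<theta>:{0..1}|lborel. eta_weight (d n) r \<theta> *\<^sub>R (G \<theta> - G 0)) \<le>
         (LINT \<theta>:{0..1}|lborel. norm (eta_weight (d n) r \<theta> *\<^sub>R (G \<theta> - G 0)))"
        by (rule set_integral_norm_bound[OF eta_weight_integrable[OF d(2) G']])
      also have "\<dots> \<le> (LINT \<theta>:{0..1}|lborel. e / 2 * \<bar>eta_weight (d n) r \<theta>\<bar> + ?k * (2 * C))"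
      proof (rule set_integral_mono)
        show "set_integrable lborel {0..1} (\<lambda>\<theta>. norm (eta_weight (d n) r \<theta> *\<^sub>R (G \<theta> - G 0)))"
          by (rule set_integrable_norm[OF eta_weight_integrable[OF d(2) G']])
        show "set_integrable lborel {0..1} (\<lambda>\<theta>. e / 2 * \<bar>eta_weight (d n) r \<theta>\<bar> + ?k * (2 * C))"
          by (intro borel_integrable_atLeastAtMost' continuous_intros eta_weight_cont d)
        fix \<theta> :: real assume t: "\<theta> \<in> {0..1}"
        show "norm (eta_weight (d n) r \<theta> *\<^sub>R (G \<theta> - G 0)) \<le> e / 2 * \<bar>eta_weight (d n) r \<theta>\<bar> + ?k * (2 * C)"
        proof (cases "\<theta> < \<gamma>")
          case True
          have "\<bar>eta_weight (d n) r \<theta>\<bar> * norm (G \<theta> - G 0) \<le> \<bar>eta_weight (d n) r \<theta>\<bar> * (e / 2)"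
            using \<gamma>[OF t True] by (intro mult_left_mono) auto
          moreover have "0 \<le> ?k * (2 * C)" using C0 g by simp
          ultimately show ?thesis by (simp add: mult.commute)
        next
          case False
          have "norm (G \<theta> - G 0) \<le> 2 * C" using C[OF t] C[of 0] norm_triangle_ineq4[of "G \<theta>" "G 0"] by simp
          then have "\<bar>eta_weight (d n) r \<theta>\<bar> * norm (G \<theta> - G 0) \<le> ?k * (2 * C)"
            using False g C0 by (intro mult_mono eta_weight_le r) auto
          moreover have "0 \<le> e / 2 * \<bar>eta_weight (d n) r \<theta>\<bar>" using e by simp
          ultimately show ?thesis by simp
        qed
      qed
      also have "\<dots> = e / 2 * (LINT \<theta>:{0..1}|lborel. \<bar>eta_weight (d n) r \<theta>\<bar>) + ?k * (2 * C)"
      proof -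
        have "set_integrable lborel {0..1} (\<lambda>\<theta>. e / 2 * \<bar>eta_weight (d n) r \<theta>\<bar>)"
          by (intro borel_integrable_atLeastAtMost' continuous_intros eta_weight_cont d)
        moreover have "set_integrable lborel {0..1::real} (\<lambda>\<theta>. ?k * (2 * C))"
          by (intro borel_integrable_atLeastAtMost' continuous_intros)
        ultimately have "(LINT \<theta>:{0..1}|lborel. e / 2 * \<bar>eta_weight (d n) r \<theta>\<bar> + ?k * (2 * C)) =
          (LINT \<theta>:{0..1}|lborel. e / 2 * \<bar>eta_weight (d n) r \<theta>\<bar>) + (LINT \<theta>:{0..1::real}|lborel. ?k * (2 * C))"
          by (rule set_integral_add(2))
        moreover have "(LINT \<theta>:{0..1::real}|lborel. ?k * (2 * C)) = ?k * (2 * C)"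
          unfolding set_lebesgue_integral_def by simp
        ultimately show ?thesis by simp
      qed
      also have "\<dots> < e / 2 * 1 + e / 2"
        using e eta_weight_abs_integral[OF d(2)[of n], of r] elim by (intro add_le_less_mono mult_left_mono) auto
      finally show ?case by simp
    qed
  qed
  moreover have "(\<lambda>n. eta1 (d n) 0 r *\<^sub>R G 0) \<longlonglongrightarrow> sgn (r - 0) *\<^sub>R G 0"
    by (intro tendsto_intros eta1_tendsto d)
  ultimately have "(\<lambda>n. (LINT \<theta>:{0..1}|lborel. eta_weight (d n) r \<theta> *\<^sub>R (G \<theta> - G 0)) + eta1 (d n) 0 r *\<^sub>R G 0) \<longlonglongrightarrow> 0 + sgn (r - 0) *\<^sub>R G 0"
    by (rule tendsto_add)
  moreover have "(LINT \<theta>:{0..1}|lborel. eta_weight (d n) r \<theta> *\<^sub>R (G \<theta> - G 0)) + eta1 (d n) 0 r *\<^sub>R G 0 = (LINT \<theta>:{0..1}|lborel. eta_weight (d n) r \<theta> *\<^sub>R G \<theta>)" for n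
  proof -
    have "(LINT \<theta>:{0..1}|lborel. eta_weight (d n) r \<theta> *\<^sub>R G \<theta> - eta_weight (d n) r \<theta> *\<^sub>R G 0) =
       (LINT \<theta>:{0..1}|lborel. eta_weight (d n) r \<theta> *\<^sub>R G \<theta>) - (LINT \<theta>:{0..1}|lborel. eta_weight (d n) r \<theta> *\<^sub>R G 0)"
      by (intro set_integral_diff eta_weight_integrable d G continuous_intros)
    moreover have "(LINT \<theta>:{0..1}|lborel. eta_weight (d n) r \<theta> *\<^sub>R G 0) = eta1 (d n) 0 r *\<^sub>R G 0"
    proof -
      have "set_integrable lborel {0..1} (eta_weight (d n) r)" by (intro borel_integrable_atLeastAtMost' eta_weight_cont d)
      then show ?thesis
        unfolding eta_weight_integral[OF d(2), symmetric] set_lebesgue_integral_def set_integrable_def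
        by (subst integral_scaleR_left[symmetric]) simp_all
    qed
    ultimately show ?thesis by (simp add: scaleR_diff_right)
  qed
  ultimately show ?thesis by simp
qed

lemma eta_integral_tendsto:
  fixes g :: "real \<Rightarrow> 'b::euclidean_space"
  assumes d: "d \<longlonglongrightarrow> (0::real)" "\<And>n. d n \<noteq> 0" and g: "continuous_on UNIV g"
  shows "(\<lambda>n. eta_integral (d n) k c g) \<longlonglongrightarrow> sgn (c - k) *\<^sub>R g k"
proof (cases "c = k")
  case True
  then show ?thesis by (simp add: eta_integral_def eta_weight_def set_lebesgue_integral_def)
next
  case False
  have "continuous_on {0..1} (\<lambda>\<theta>. g (k + \<theta> * (c - k)))"
    by (intro continuous_on_compose2[OF g] continuous_intros) auto
  from eta_weight_tendsto[OF d this, of "c - k"] False show ?thesis by (simp add: eta_integral_def)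
qed

text \<open>Both sides are the increment of one antiderivative, on the right after the substitution
  s = k + \<theta> * (c - k). The argument is the same for either order of \<open>k\<close> and
  \<open>c\<close>.\<close>

lemma eta_integral_eq_interval_integral:
  fixes g :: "real \<Rightarrow> 'b::euclidean_space"
  assumes d: "\<delta> \<noteq> 0" and g: "continuous_on UNIV g"
  shows "(LBINT s=ereal k..ereal c. eta2 \<delta> k s *\<^sub>R g s) = eta_integral \<delta> k c g"
proof -
  let ?W = "\<lambda>s. eta2 \<delta> k s *\<^sub>R g s"
  have cW: "continuous_on UNIV ?W" by (intro continuous_intros g eta2_cont d)
  then obtain A where A: "\<And>x. (A has_vector_derivative ?W x) (at x)"
    using einterval_antiderivative[of "-\<infinity>" "\<infinity>" ?W] by (auto simp: continuous_on_eq_continuous_at)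
  have "(LBINT s=ereal k..ereal c. ?W s) = A c - A k"
    by (rule interval_integral_FTC_finite[OF continuous_on_subset[OF cW subset_UNIV] has_vector_derivative_at_within[OF A]])
  moreover have "eta_integral \<delta> k c g = A (k + 1 * (c - k)) - A (k + 0 * (c - k))"
    unfolding eta_integral_def set_lebesgue_integral_def
  proof (rule integral_FTC_atLeastAtMost)
    show "continuous_on {0..1} (\<lambda>\<theta>. eta_weight \<delta> (c - k) \<theta> *\<^sub>R g (k + \<theta> * (c - k)))"
      by (intro continuous_intros eta_weight_cont d continuous_on_compose2[OF g]) auto
    fix \<theta> :: real
    have "((\<lambda>\<theta>. k + \<theta> * (c - k)) has_vector_derivative (c - k)) (at \<theta>)"
      by (auto intro!: derivative_eq_intros simp flip: has_real_derivative_iff_has_vector_derivative)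
    from vector_diff_chain_at[OF this A]
    have "((\<lambda>\<theta>. A (k + \<theta> * (c - k))) has_vector_derivative eta_weight \<delta> (c - k) \<theta> *\<^sub>R g (k + \<theta> * (c - k))) (at \<theta>)"
      by (simp add: o_def eta_weight_eta2)
    then show "((\<lambda>\<theta>. A (k + \<theta> * (c - k))) has_vector_derivative eta_weight \<delta> (c - k) \<theta> *\<^sub>R g (k + \<theta> * (c - k))) (at \<theta> within {0..1})"
      by (rule has_vector_derivative_at_within)
  qed simp
  ultimately show ?thesis by simp
qed

lemma eta_integral_diff:
  fixes g h :: "real \<Rightarrow> 'b::euclidean_space"
  assumes "\<delta> \<noteq> 0" "continuous_on UNIV g" "continuous_on UNIV h"
  shows "eta_integral \<delta> k c (\<lambda>s. g s - h s) = eta_integral \<delta> k c g - eta_integral \<delta> k c h"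
proof -
  have "continuous_on {0..1} (\<lambda>\<theta>. g (k + \<theta> * (c - k)))" "continuous_on {0..1} (\<lambda>\<theta>. h (k + \<theta> * (c - k)))"
    by (intro continuous_on_compose2[OF assms(2)] continuous_on_compose2[OF assms(3)] continuous_intros; simp)+
  from set_integral_diff(2)[OF eta_weight_integrable[OF assms(1) this(1)] eta_weight_integrable[OF assms(1) this(2)]]
  show ?thesis by (simp add: eta_integral_def scaleR_diff_right)
qed

lemma eta_integral_linear:
  fixes g :: "real \<Rightarrow> 'b::euclidean_space" and F :: "'b \<Rightarrow> 'c::euclidean_space"
  assumes "\<delta> \<noteq> 0" "continuous_on UNIV g" "bounded_linear F"
  shows "eta_integral \<delta> k c (\<lambda>s. F (g s)) = F (eta_integral \<delta> k c g)"
proof -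
  interpret F: bounded_linear F by fact
  have "continuous_on {0..1} (\<lambda>\<theta>. g (k + \<theta> * (c - k)))"
    by (intro continuous_on_compose2[OF assms(2)] continuous_intros) simp
  from eta_weight_integrable[OF assms(1) this] show ?thesis
    unfolding eta_integral_def set_lebesgue_integral_def set_integrable_def
    by (subst integral_bounded_linear[OF assms(3), symmetric]) (simp_all add: F.scaleR)
qed

lemma eta_integral_sum:
  fixes g :: "'i \<Rightarrow> real \<Rightarrow> 'b::euclidean_space"
  assumes d: "\<delta> \<noteq> 0" and g: "\<And>i. i \<in> J \<Longrightarrow> continuous_on UNIV (g i)"
  shows "eta_integral \<delta> k c (\<lambda>s. \<Sum>i\<in>J. g i s) = (\<Sum>i\<in>J. eta_integral \<delta> k c (g i))"
proof -
  have "set_integrable lborel {0..1} (\<lambda>\<theta>. eta_weight \<delta> (c - k) \<theta> *\<^sub>R g i (k + \<theta> * (c - k)))" if "i \<in> J" for i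
    by (rule eta_weight_integrable[OF d]) (intro continuous_on_compose2[OF g[OF that]] continuous_intros; simp)
  then show ?thesis
    unfolding eta_integral_def set_lebesgue_integral_def set_integrable_def
    by (simp add: scaleR_sum_right integral_sum)
qed

section \<open>Entropy fluxes of the regularized entropies and their divergence in x\<close>

context flux begin

text \<open>The integral starts at \<open>k\<close>, the minimum of the entropy. There the
  derivative of the entropy vanishes, so integration by parts leaves no boundary term at the
  starting point.\<close>

definition entropy_flux :: "real \<Rightarrow> real \<Rightarrow> 'a \<times> real \<Rightarrow> 'a" where
  "entropy_flux \<delta> k = (\<lambda>(x, c). LBINT s=ereal k..ereal c. deriv (eta \<delta> k) s *\<^sub>R vector_derivative (\<lambda>r. f (x, r)) (at s))"

lemma entropy_pair_entropy_flux: "\<delta> \<noteq> 0 \<Longrightarrow> entropy_pair f (eta \<delta> k) (entropy_flux \<delta> k)"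
  unfolding entropy_pair_def using eta_entropy by (auto simp: entropy_flux_def)

lemma continuous_f_snd: "continuous_on S (\<lambda>k. f (x, k))"
  by (rule continuous_on_compose2[OF continuous_f]) (auto intro!: continuous_intros)

text \<open>One factor is differentiable only almost everywhere, but the product of
  \<open>eta1\<close> and \<open>f\<close> is Lipschitz near the interval, so the fundamental
  theorem for Lipschitz functions applies to it.\<close>

lemma entropy_flux_by_parts_le:
  assumes d: "\<delta> \<noteq> 0" and ab: "a \<le> b"
  shows "(LBINT s=ereal a..ereal b. eta1 \<delta> k s *\<^sub>R vector_derivative (\<lambda>r. f (x, r)) (at s)) =
    eta1 \<delta> k b *\<^sub>R f (x, b) - eta1 \<delta> k a *\<^sub>R f (x, a) - (LBINT s=ereal a..ereal b. eta2 \<delta> k s *\<^sub>R f (x, s))"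
proof -
  define A where "A = max \<bar>a - 1\<bar> \<bar>b + 1\<bar>"
  obtain L where L0: "0 \<le> L" and
    L1: "\<And>k. \<bar>k\<bar> \<le> A \<Longrightarrow> norm (f (x, k)) \<le> L" and
    L2: "\<And>k l. \<bar>k\<bar> \<le> A \<Longrightarrow> \<bar>l\<bar> \<le> A \<Longrightarrow> norm (f (x, k) - f (x, l)) \<le> L * \<bar>k - l\<bar>"
    by (rule local_bounds[of "norm x" A]) (metis order_refl)
  \<comment> \<open>Clamping turns locally Lipschitz functions into globally Lipschitz ones. The
    margin 1 leaves them unchanged in a neighbourhood of \<open>{a..b}\<close>, so derivatives at
    the endpoints are preserved as well.\<close>
  define cl where "cl s = max (a - 1) (min (b + 1) s)" for s
  have cl: "\<bar>cl s\<bar> \<le> A" "\<bar>cl s - cl t\<bar> \<le> \<bar>s - t\<bar>" for s t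
    using ab by (auto simp: cl_def A_def)
  have cl_in: "cl s = s" if "a - 1 < s" "s < b + 1" for s using that by (simp add: cl_def)
  define G where "G s = f (x, cl s)" for s
  define P where "P s = eta1 \<delta> k (cl s) *\<^sub>R f (x, cl s)" for s
  have Glip: "norm (G s - G t) \<le> L * \<bar>s - t\<bar>" for s t
    unfolding G_def using L2[OF cl(1) cl(1), of s t] mult_left_mono[OF cl(2) L0, of s t] by linarith
  then have Glip': "L-lipschitz_on UNIV G" using L0 by (auto simp: lipschitz_on_def dist_norm)
  have e1lip: "\<bar>eta1 \<delta> k s - eta1 \<delta> k t\<bar> \<le> 1 / \<bar>\<delta>\<bar> * \<bar>s - t\<bar>" for s t
  proof -
    have "norm (eta1 \<delta> k s - eta1 \<delta> k t) \<le> 1 / \<bar>\<delta>\<bar> * norm (s - t)"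
      by (rule field_differentiable_bound[OF convex_UNIV has_field_derivative_at_within[OF eta1_deriv[OF d]]])
         (use eta2_nonneg eta2_le[OF d] in auto)
    then show ?thesis by simp
  qed
  have "norm (P s - P t) \<le> (L + L / \<bar>\<delta>\<bar>) * \<bar>s - t\<bar>" for s t
  proof -
    have "P s - P t = eta1 \<delta> k (cl s) *\<^sub>R (G s - G t) + (eta1 \<delta> k (cl s) - eta1 \<delta> k (cl t)) *\<^sub>R G t"
      by (simp add: P_def G_def algebra_simps)
    also have "norm \<dots> \<le> \<bar>eta1 \<delta> k (cl s)\<bar> * norm (G s - G t) + \<bar>eta1 \<delta> k (cl s) - eta1 \<delta> k (cl t)\<bar> * norm (G t)"
      by (rule order.trans[OF norm_triangle_ineq]) simp
    also have "\<dots> \<le> 1 * (L * \<bar>s - t\<bar>) + (1 / \<bar>\<delta>\<bar> * \<bar>s - t\<bar>) * L"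
    proof (intro add_mono mult_mono abs_eta1_le Glip)
      show "\<bar>eta1 \<delta> k (cl s) - eta1 \<delta> k (cl t)\<bar> \<le> 1 / \<bar>\<delta>\<bar> * \<bar>s - t\<bar>"
        by (rule order.trans[OF e1lip mult_left_mono[OF cl(2)]]) simp
      show "norm (G t) \<le> L" unfolding G_def by (rule L1[OF cl(1)])
    qed (use L0 in auto)
    finally show ?thesis by (simp add: algebra_simps)
  qed
  then have Plip: "(L + L / \<bar>\<delta>\<bar>)-lipschitz_on UNIV P"
    using L0 by (auto simp: lipschitz_on_def dist_norm)
  let ?v = "\<lambda>s. vector_derivative (\<lambda>r. f (x, r)) (at s)"
  have "AE s in lborel. s \<in> {a..b} \<longrightarrow> vector_derivative P (at s) = eta1 \<delta> k s *\<^sub>R ?v s + eta2 \<delta> k s *\<^sub>R f (x, s)"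
    using lipschitz_differentiable_AE[OF Glip']
  proof eventually_elim
    case (elim s)
    show ?case
    proof
      assume s: "s \<in> {a..b}"
      let ?S = "{a - 1<..<b + 1}"
      have "(G has_vector_derivative vector_derivative G (at s)) (at s)"
        using elim by (simp add: vector_derivative_works)
      then have fd: "((\<lambda>r. f (x, r)) has_vector_derivative vector_derivative G (at s)) (at s)"
        by (rule has_vector_derivative_transform_within_open[of _ _ _ ?S]) (use s cl_in in \<open>auto simp: G_def\<close>)
      then have v: "?v s = vector_derivative G (at s)" by (rule vector_derivative_at)
      have "((\<lambda>r. eta1 \<delta> k r *\<^sub>R f (x, r)) has_vector_derivative (eta1 \<delta> k s *\<^sub>R ?v s + eta2 \<delta> k s *\<^sub>R f (x, s))) (at s)"
        unfolding v by (rule has_vector_derivative_scaleR[OF eta1_deriv[OF d] fd])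
      then have "(P has_vector_derivative (eta1 \<delta> k s *\<^sub>R ?v s + eta2 \<delta> k s *\<^sub>R f (x, s))) (at s)"
        by (rule has_vector_derivative_transform_within_open[of _ _ _ ?S]) (use s cl_in in \<open>auto simp: P_def\<close>)
      then show "vector_derivative P (at s) = eta1 \<delta> k s *\<^sub>R ?v s + eta2 \<delta> k s *\<^sub>R f (x, s)"
        by (rule vector_derivative_at)
    qed
  qed
  note ae = this
  have [measurable]: "?v \<in> borel_measurable borel"
    by (rule borel_measurable_vector_derivative[OF continuous_f_snd])
  have [measurable]: "(\<lambda>s. vector_derivative P (at s)) \<in> borel_measurable borel"
    by (rule borel_measurable_vector_derivative[OF lipschitz_on_continuous_on[OF Plip]])
  have [measurable]: "eta1 \<delta> k \<in> borel_measurable borel" "eta2 \<delta> k \<in> borel_measurable borel"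
    unfolding eta1_def[abs_def] eta2_def[abs_def] by measurable
  have int: "set_integrable lborel {a..b} (\<lambda>s. eta2 \<delta> k s *\<^sub>R f (x, s))"
    by (intro borel_integrable_atLeastAtMost' continuous_intros eta2_cont d continuous_f_snd)
  have "(LINT s:{a..b}|lborel. eta1 \<delta> k s *\<^sub>R ?v s) = (LINT s:{a..b}|lborel. vector_derivative P (at s) - eta2 \<delta> k s *\<^sub>R f (x, s))"
    unfolding set_lebesgue_integral_def
  proof (rule integral_cong_AE)
    show "AE s in lborel. indicat_real {a..b} s *\<^sub>R (eta1 \<delta> k s *\<^sub>R ?v s) =
       indicat_real {a..b} s *\<^sub>R (vector_derivative P (at s) - eta2 \<delta> k s *\<^sub>R f (x, s))"
      using ae by eventually_elim (auto simp: indicator_def)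
  qed measurable
  also have "\<dots> = P b - P a - (LINT s:{a..b}|lborel. eta2 \<delta> k s *\<^sub>R f (x, s))"
    using set_integral_diff(2)[OF lipschitz_FTC(1)[OF Plip ab] int] lipschitz_FTC(2)[OF Plip ab] by simp
  finally have "(LINT s:{a..b}|lborel. eta1 \<delta> k s *\<^sub>R ?v s) = P b - P a - (LINT s:{a..b}|lborel. eta2 \<delta> k s *\<^sub>R f (x, s))" .
  moreover have "P b = eta1 \<delta> k b *\<^sub>R f (x, b)" "P a = eta1 \<delta> k a *\<^sub>R f (x, a)"
    using ab cl_in[of a] cl_in[of b] by (auto simp: P_def)
  ultimately show ?thesis using ab by (simp add: interval_integral_Icc)
qed

text \<open>This form contains \<open>f\<close> but not its derivative in \<open>k\<close>. That
  derivative exists only almost everywhere and offers no way to differentiate in \<open>x\<close>,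
  whereas the right-hand side does.\<close>

lemma entropy_flux_eq:
  assumes d: "\<delta> \<noteq> 0"
  shows "entropy_flux \<delta> k (x, c) = eta1 \<delta> k c *\<^sub>R f (x, c) - eta_integral \<delta> k c (\<lambda>s. f (x, s))"
proof -
  let ?v = "\<lambda>s. vector_derivative (\<lambda>r. f (x, r)) (at s)"
  have k0: "eta1 \<delta> k k = 0" by (simp add: eta1_def)
  have "entropy_flux \<delta> k (x, c) = (LBINT s=ereal k..ereal c. eta1 \<delta> k s *\<^sub>R ?v s)"
    by (simp add: entropy_flux_def eta_entropy(4)[OF d])
  also have "\<dots> = eta1 \<delta> k c *\<^sub>R f (x, c) - (LBINT s=ereal k..ereal c. eta2 \<delta> k s *\<^sub>R f (x, s))"
  proof (cases "k \<le> c")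
    case True
    show ?thesis unfolding entropy_flux_by_parts_le[OF d True] by (simp add: k0)
  next
    case False
    then have "c \<le> k" by simp
    show ?thesis
      unfolding interval_integral_endpoints_reverse[of "ereal k" "ereal c"] entropy_flux_by_parts_le[OF d \<open>c \<le> k\<close>]
      by (simp add: k0)
  qed
  also have "(LBINT s=ereal k..ereal c. eta2 \<delta> k s *\<^sub>R f (x, s)) = eta_integral \<delta> k c (\<lambda>s. f (x, s))"
    by (rule eta_integral_eq_interval_integral[OF d continuous_f_snd])
  finally show ?thesis .
qed

text \<open>Differentiation under the integral. The remainder of the expansion of \<open>f\<close>
  in \<open>x\<close> is small uniformly for states on the compact segment from \<open>k\<close> to
  \<open>c\<close>, and integration against a weight of mass at most 1 preserves the bound.\<close>

lemma eta_integral_f_deriv: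
  assumes d: "\<delta> \<noteq> 0" and x: "x \<notin> B"
  shows "((\<lambda>y. eta_integral \<delta> k c (\<lambda>s. f (y, s))) has_derivative (\<lambda>h. \<Sum>b\<in>Basis. (h \<bullet> b) *\<^sub>R eta_integral \<delta> k c (\<lambda>s. D x s b))) (at x)"
  unfolding has_derivative_at_alt
proof (intro conjI allI impI)
  show "bounded_linear (\<lambda>h. \<Sum>b\<in>Basis. (h \<bullet> b) *\<^sub>R eta_integral \<delta> k c (\<lambda>s. D x s b))"
    by (intro bounded_linear_sum bounded_linear_scaleR_const bounded_linear_inner_left)
  fix e :: real assume e: "0 < e"
  have "compact (closed_segment k c)" by (rule compact_segment)
  from D_unif[OF x this e] obtain r where "r > 0" and r: "\<And>y s. norm (y - x) < r \<Longrightarrow> s \<in> closed_segment k c \<Longrightarrow>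
      norm (f (y, s) - f (x, s) - (\<Sum>b\<in>Basis. ((y - x) \<bullet> b) *\<^sub>R D x s b)) \<le> e * norm (y - x)" by metis
  have "norm (eta_integral \<delta> k c (\<lambda>s. f (y, s)) - eta_integral \<delta> k c (\<lambda>s. f (x, s)) - (\<Sum>b\<in>Basis. ((y - x) \<bullet> b) *\<^sub>R eta_integral \<delta> k c (\<lambda>s. D x s b)))
     \<le> e * norm (y - x)" if y: "norm (y - x) < r" for y
  proof -
    have cD: "continuous_on UNIV (\<lambda>s. (z \<bullet> b) *\<^sub>R D x s b)" for b z by (intro continuous_intros D_cont)
    have "eta_integral \<delta> k c (\<lambda>s. f (y, s) - f (x, s) - (\<Sum>b\<in>Basis. ((y - x) \<bullet> b) *\<^sub>R D x s b)) =
      eta_integral \<delta> k c (\<lambda>s. f (y, s)) - eta_integral \<delta> k c (\<lambda>s. f (x, s)) - (\<Sum>b\<in>Basis. eta_integral \<delta> k c (\<lambda>s. ((y - x) \<bullet> b) *\<^sub>R D x s b))"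
      by (simp add: eta_integral_diff eta_integral_sum d continuous_f_snd continuous_on_diff continuous_on_sum cD)
    also have "(\<Sum>b\<in>Basis. eta_integral \<delta> k c (\<lambda>s. ((y - x) \<bullet> b) *\<^sub>R D x s b)) = (\<Sum>b\<in>Basis. ((y - x) \<bullet> b) *\<^sub>R eta_integral \<delta> k c (\<lambda>s. D x s b))"
      by (intro sum.cong refl eta_integral_linear[OF d D_cont] bounded_linear_scaleR_right)
    finally have "eta_integral \<delta> k c (\<lambda>s. f (y, s)) - eta_integral \<delta> k c (\<lambda>s. f (x, s)) - (\<Sum>b\<in>Basis. ((y - x) \<bullet> b) *\<^sub>R eta_integral \<delta> k c (\<lambda>s. D x s b))
       = eta_integral \<delta> k c (\<lambda>s. f (y, s) - f (x, s) - (\<Sum>b\<in>Basis. ((y - x) \<bullet> b) *\<^sub>R D x s b))" by simp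
    also have "norm \<dots> \<le> e * norm (y - x)"
    proof (rule eta_integral_norm_le[OF d])
      show "continuous_on UNIV (\<lambda>s. f (y, s) - f (x, s) - (\<Sum>b\<in>Basis. ((y - x) \<bullet> b) *\<^sub>R D x s b))"
        by (intro continuous_intros continuous_f_snd D_cont)
      show "norm (f (y, k + \<theta> * (c - k)) - f (x, k + \<theta> * (c - k)) - (\<Sum>b\<in>Basis. ((y - x) \<bullet> b) *\<^sub>R D x (k + \<theta> * (c - k)) b)) \<le> e * norm (y - x)"
        if "0 \<le> \<theta>" "\<theta> \<le> 1" for \<theta>
        using that by (intro r[OF y]) (auto simp: in_segment algebra_simps intro!: exI[of _ \<theta>])
    qed
    finally show ?thesis .
  qed
  then show "\<exists>d>0. \<forall>y. norm (y - x) < d \<longrightarrow> norm (eta_integral \<delta> k c (\<lambda>s. f (y, s)) - eta_integral \<delta> k c (\<lambda>s. f (x, s)) -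
      (\<Sum>b\<in>Basis. ((y - x) \<bullet> b) *\<^sub>R eta_integral \<delta> k c (\<lambda>s. D x s b))) \<le> e * norm (y - x)"
    using \<open>r > 0\<close> by blast
qed

text \<open>The first term on the right is the one subtracted in the entropy condition. After the
  cancellation only \<open>eta_integral\<close> of the divergence is left, and it has a limit as
  \<delta> tends to 0.\<close>

lemma divergence_entropy_flux:
  assumes d: "\<delta> \<noteq> 0" and x: "x \<notin> B"
  shows "divergence (\<lambda>y. entropy_flux \<delta> k (y, c)) x = eta1 \<delta> k c * flux_div x c - eta_integral \<delta> k c (flux_div x)"
proof -
  have "((\<lambda>y. entropy_flux \<delta> k (y, c)) has_derivative (\<lambda>h. eta1 \<delta> k c *\<^sub>R (\<Sum>b\<in>Basis. (h \<bullet> b) *\<^sub>R D x c b) - (\<Sum>b\<in>Basis. (h \<bullet> b) *\<^sub>R eta_integral \<delta> k c (\<lambda>s. D x s b)))) (at x)"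
    unfolding entropy_flux_eq[OF d]
    by (intro has_derivative_diff eta_integral_f_deriv[OF d x] has_derivative_scaleR_right D_deriv[OF x])
  note fd = frechet_derivative_at[OF this, symmetric]
  have "divergence (\<lambda>y. entropy_flux \<delta> k (y, c)) x = (\<Sum>b\<in>Basis. eta1 \<delta> k c * (D x c b \<bullet> b) - eta_integral \<delta> k c (\<lambda>s. D x s b) \<bullet> b)"
    unfolding divergence_def fd by (intro sum.cong refl) (simp add: sum_Basis_scaleR inner_diff_left)
  also have "\<dots> = eta1 \<delta> k c * flux_div x c - (\<Sum>b\<in>Basis. eta_integral \<delta> k c (\<lambda>s. D x s b) \<bullet> b)"
    by (simp add: sum_subtractf flux_div_def sum_distrib_left)
  also have "(\<Sum>b\<in>Basis. eta_integral \<delta> k c (\<lambda>s. D x s b) \<bullet> b) = (\<Sum>b\<in>Basis. eta_integral \<delta> k c (\<lambda>s. D x s b \<bullet> b))"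
    by (intro sum.cong refl eta_integral_linear[OF d D_cont, symmetric] bounded_linear_inner_left)
  also have "\<dots> = eta_integral \<delta> k c (flux_div x)"
    unfolding flux_div_def by (rule eta_integral_sum[OF d, symmetric]) (intro continuous_intros D_cont)
  finally show ?thesis .
qed

end

subsection \<open>Kruzhkov's inequality\<close>

text \<open>Test functions carry their gradient \<open>X\<close> and time derivative \<open>T\<close> explicitly.\<close>

definition C1c :: "('a::euclidean_space \<times> real \<Rightarrow> real) \<Rightarrow> ('a \<times> real \<Rightarrow> 'a) \<Rightarrow> ('a \<times> real \<Rightarrow> real) \<Rightarrow> ('a \<times> real) set \<Rightarrow> bool" where
  "C1c \<phi> X T K \<longleftrightarrow> compact K \<and> continuous_on UNIV X \<and> continuous_on UNIV T \<and>
     (\<forall>p. (\<phi> has_derivative (\<lambda>h. X p \<bullet> fst h + T p * snd h)) (at p)) \<and>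
     (\<forall>p. p \<notin> K \<longrightarrow> \<phi> p = 0 \<and> X p = 0 \<and> T p = 0)"

lemma norm_fst_le_norm: "norm (fst p) \<le> norm p" and norm_snd_le_norm: "norm (snd p) \<le> norm p"
  by (cases p; simp add: norm_fst_le norm_snd_le)+

lemma C1cD:
  assumes "C1c \<phi> X T K"
  shows "compact K" "(\<phi> has_derivative (\<lambda>h. X p \<bullet> fst h + T p * snd h)) (at p)"
    "p \<notin> K \<Longrightarrow> \<phi> p = 0" "p \<notin> K \<Longrightarrow> X p = 0" "p \<notin> K \<Longrightarrow> T p = 0"
  using assms unfolding C1c_def by blast+

lemma C1c_cont:
  assumes "C1c \<phi> X T K"
  shows "continuous_on UNIV \<phi>" "continuous_on UNIV X" "continuous_on UNIV T"
proof -
  show "continuous_on UNIV \<phi>"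
    using has_derivative_continuous[OF C1cD(2)[OF assms]] by (simp add: continuous_at_imp_continuous_on)
qed (use assms in \<open>simp_all only: C1c_def\<close>)

lemma C1c_measurable:
  assumes "C1c \<phi> X T K"
  shows "\<phi> \<in> borel_measurable borel" "X \<in> borel_measurable borel" "T \<in> borel_measurable borel" "K \<in> sets borel"
  using C1c_cont[OF assms] C1cD(1)[OF assms]
  by (auto intro: borel_measurable_continuous_onI borel_compact)

lemma C1c_bound:
  assumes "C1c \<phi> X T K"
  obtains C where "0 \<le> C" "\<And>p. \<bar>\<phi> p\<bar> \<le> C" "\<And>p. norm (X p) \<le> C" "\<And>p. \<bar>T p\<bar> \<le> C"
proof -
  have K: "compact K" and out: "\<And>p. p \<notin> K \<Longrightarrow> \<phi> p = 0 \<and> X p = 0 \<and> T p = 0"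
    using C1cD[OF assms] by blast+
  have "bounded (\<phi> ` K)" "bounded (X ` K)" "bounded (T ` K)"
    using C1c_cont[OF assms] K continuous_on_subset subset_UNIV
    by (metis compact_continuous_image compact_imp_bounded)+
  then obtain a b c where abc: "\<And>p. p \<in> K \<Longrightarrow> norm (\<phi> p) \<le> a" "\<And>p. p \<in> K \<Longrightarrow> norm (X p) \<le> b" "\<And>p. p \<in> K \<Longrightarrow> norm (T p) \<le> c"
    unfolding bounded_iff by (metis imageI)
  define C where "C = \<bar>a\<bar> + \<bar>b\<bar> + \<bar>c\<bar>"
  have C: "0 \<le> C" "a \<le> C" "b \<le> C" "c \<le> C" by (auto simp: C_def)
  show thesis
  proof (rule that[OF C(1)])
    fix p
    show "\<bar>\<phi> p\<bar> \<le> C" using abc(1)[of p] C out[of p] by (cases "p \<in> K") auto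
    show "norm (X p) \<le> C" using abc(2)[of p] C out[of p] by (cases "p \<in> K") auto
    show "\<bar>T p\<bar> \<le> C" using abc(3)[of p] C out[of p] by (cases "p \<in> K") auto
  qed
qed

lemma C1c_Lip_c:
  assumes C: "C1c \<phi> X T K" and K: "K \<subseteq> S"
  shows "\<phi> \<in> Lip_c S"
proof -
  obtain C where C0: "0 \<le> C" and b: "\<And>p. norm (X p) \<le> C" "\<And>p. \<bar>T p\<bar> \<le> C"
    using C1c_bound[OF C] by metis
  have der: "\<And>p. (\<phi> has_derivative (\<lambda>h. X p \<bullet> fst h + T p * snd h)) (at p)" and cK: "compact K"
    and out: "\<And>p. p \<notin> K \<Longrightarrow> \<phi> p = 0"
    using C1cD[OF C] by blast+
  have "norm (\<phi> p - \<phi> q) \<le> (2 * C) * norm (p - q)" for p q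
  proof (rule differentiable_bound[OF convex_UNIV])
    fix p :: "'a \<times> real"
    show "(\<phi> has_derivative (\<lambda>h. X p \<bullet> fst h + T p * snd h)) (at p within UNIV)" using der by simp
    show "onorm (\<lambda>h. X p \<bullet> fst h + T p * snd h) \<le> 2 * C"
    proof (rule onorm_le)
      fix h :: "'a \<times> real"
      have "\<bar>X p \<bullet> fst h\<bar> \<le> norm (X p) * norm (fst h)" by (rule Cauchy_Schwarz_ineq2)
      also have "\<dots> \<le> C * norm h" using b C0 by (intro mult_mono norm_fst_le_norm) auto
      finally have 1: "\<bar>X p \<bullet> fst h\<bar> \<le> C * norm h" .
      have "\<bar>T p * snd h\<bar> = \<bar>T p\<bar> * norm (snd h)" by (simp add: abs_mult)
      also have "\<dots> \<le> C * norm h" using b C0 by (intro mult_mono norm_snd_le_norm) (auto simp del: real_norm_def)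
      finally show "norm (X p \<bullet> fst h + T p * snd h) \<le> 2 * C * norm h" using 1 by simp
    qed
  qed auto
  then have "(2 * C)-lipschitz_on S \<phi>" using C0 by (auto simp: lipschitz_on_def dist_norm)
  moreover have "closure {p. \<phi> p \<noteq> 0} \<subseteq> K"
    using out compact_imp_closed[OF cK] by (intro closure_minimal) auto
  moreover from this have "compact (closure {p. \<phi> p \<noteq> 0})"
    using cK by (metis closed_closure compact_Int_closed inf.absorb_iff2)
  ultimately show ?thesis using K by (auto simp: Lip_c_def)
qed

lemma C1c_deriv:
  assumes C: "C1c \<phi> X T K"
  shows "deriv (\<lambda>s. \<phi> (x, s)) t = T (x, t)" "grad (\<lambda>y. \<phi> (y, t)) x = X (x, t)"
proof -
  have der: "(\<phi> has_derivative (\<lambda>h. X (x, t) \<bullet> fst h + T (x, t) * snd h)) (at (x, t))"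
    by (rule C1cD(2)[OF C])
  have "((\<lambda>s. (x, s)) has_derivative (\<lambda>h. (0, h))) (at t)"
    by (intro derivative_intros)
  from has_derivative_compose[OF this der]
  have "((\<lambda>s. \<phi> (x, s)) has_field_derivative T (x, t)) (at t)" by (simp add: has_field_derivative_def)
  then show "deriv (\<lambda>s. \<phi> (x, s)) t = T (x, t)" by (rule DERIV_imp_deriv)
  have "((\<lambda>y. (y, t)) has_derivative (\<lambda>h. (h, 0))) (at x)"
    by (intro derivative_intros)
  from has_derivative_compose[OF this der]
  have "((\<lambda>y. \<phi> (y, t)) has_derivative (\<lambda>h. X (x, t) \<bullet> h)) (at x)" by simp
  from frechet_derivative_at[OF this, symmetric] show "grad (\<lambda>y. \<phi> (y, t)) x = X (x, t)"
    by (simp add: grad_def euclidean_representation)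
qed

text \<open>Exchanging the two quantifiers requires a measurable predicate, so the property is first
  replaced by lying outside a measurable null set.\<close>

lemma AE_lborel_swap:
  fixes P :: "'a::euclidean_space \<times> 'b::euclidean_space \<Rightarrow> bool"
  assumes "AE p in lborel. P p"
  shows "AE t in lborel. AE x in lborel. P (x, t)"
proof -
  obtain N where N: "{p \<in> space lborel. \<not> P p} \<subseteq> N" "emeasure lborel N = 0" "N \<in> sets lborel"
    by (rule AE_E[OF assms])
  then have [measurable]: "N \<in> sets (borel \<Otimes>\<^sub>M borel)" by (simp only: borel_prod sets_lborel)
  have "AE p in (lborel :: ('a \<times> 'b) measure). p \<notin> N"
    using N by (intro AE_not_in) (auto simp: null_sets_def)
  then have "AE p in lborel \<Otimes>\<^sub>M lborel. (p :: 'a \<times> 'b) \<notin> N" unfolding lborel_prod .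
  then have "AE x in lborel. AE t in lborel. (x :: 'a, t :: 'b) \<notin> N" by (rule lborel_pair.AE_pair)
  then have "AE t in lborel. AE x in lborel. (x :: 'a, t :: 'b) \<notin> N"
    by (subst (asm) lborel_pair.AE_commute) measurable
  then show ?thesis
  proof eventually_elim
    case (elim t)
    then show ?case by (rule eventually_mono) (use N(1) in auto)
  qed
qed

lemma integrable_lborel_bounded_compact:
  fixes g :: "'e::euclidean_space \<Rightarrow> 'b::euclidean_space"
  assumes "g \<in> borel_measurable borel" "compact K" "\<And>p. p \<in> K \<Longrightarrow> norm (g p) \<le> C" "\<And>p. p \<notin> K \<Longrightarrow> g p = 0"
  shows "integrable lborel g"
proof (rule Bochner_Integration.integrable_bound)
  show "integrable lborel (\<lambda>p. C * indicator K p)"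
    using assms(2) by (intro integrable_mult_right integrable_real_indicator) (auto intro: emeasure_lborel_compact_finite borel_compact)
  show "AE p in lborel. norm (g p) \<le> norm (C * indicator K p)"
    using assms(3,4) by (intro AE_I2) (force simp: indicator_def)
qed (use assms(1) in simp)

context flux begin

lemma eta_integral_measurable:
  assumes [measurable]: "U \<in> borel_measurable borel"
  shows "(\<lambda>p::'a \<times> real. eta_integral \<delta> k (U p) (flux_div (fst p))) \<in> borel_measurable borel"
    "(\<lambda>p::'a \<times> real. eta_integral \<delta> k (U p) (\<lambda>s. f (fst p, s))) \<in> borel_measurable borel"
  unfolding eta_integral_def set_lebesgue_integral_def eta_weight_def by measurable

lemma entropy_flux_measurable:
  assumes d: "\<delta> \<noteq> 0" and [measurable]: "U \<in> borel_measurable borel"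
  shows "(\<lambda>p::'a \<times> real. entropy_flux \<delta> k (fst p, U p)) \<in> borel_measurable borel"
proof -
  note [measurable] = eta_integral_measurable[OF assms(2)]
  show ?thesis unfolding entropy_flux_eq[OF d] eta1_def by measurable
qed

text \<open>The bound is independent of \<delta>, so it provides the dominating function for the
  limit of vanishing \<delta>.\<close>

lemma smooth_entropy_bound:
  assumes C: "C1c \<phi> X T K" and UM: "\<And>p. \<bar>U p\<bar> \<le> M"
  obtains C where "\<And>\<delta> p. \<delta> \<noteq> 0 \<Longrightarrow> \<bar>\<delta>\<bar> \<le> 1 \<Longrightarrow> p \<in> K \<Longrightarrow>
    \<bar>T p * eta \<delta> k (U p) - \<phi> p * eta_integral \<delta> k (U p) (flux_div (fst p)) + X p \<bullet> entropy_flux \<delta> k (fst p, U p)\<bar> \<le> C"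
proof -
  have "compact K" using C by (rule C1cD(1))
  then obtain R where R: "\<And>p. p \<in> K \<Longrightarrow> norm p \<le> R"
    using compact_imp_bounded bounded_iff by metis
  \<comment> \<open>Every state on the segment from \<open>k\<close> to \<open>U p\<close> is a
    convex combination of the two, hence lies in [-A, A].\<close>
  define A where "A = max \<bar>k\<bar> M"
  have seg: "\<bar>k + \<theta> * (U p - k)\<bar> \<le> A" if "0 \<le> \<theta>" "\<theta> \<le> 1" for \<theta> p
  proof -
    have "\<bar>k + \<theta> * (U p - k)\<bar> = \<bar>(1 - \<theta>) * k + \<theta> * U p\<bar>" by (simp add: algebra_simps)
    also have "\<dots> \<le> (1 - \<theta>) * \<bar>k\<bar> + \<theta> * \<bar>U p\<bar>"
      by (rule order.trans[OF abs_triangle_ineq]) (use that in \<open>simp add: abs_mult\<close>)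
    also have "\<dots> \<le> (1 - \<theta>) * A + \<theta> * A"
      using that UM[of p] by (intro add_mono mult_left_mono) (auto simp: A_def)
    finally show ?thesis by (simp add: algebra_simps)
  qed
  obtain L where L: "0 \<le> L"
    "\<And>x k. norm x \<le> R \<Longrightarrow> \<bar>k\<bar> \<le> A \<Longrightarrow> norm (f (x, k)) \<le> L"
    "\<And>x k. norm x \<le> R \<Longrightarrow> \<bar>k\<bar> \<le> A \<Longrightarrow> \<bar>flux_div x k\<bar> \<le> L"
    using local_bounds[of R A] by metis
  obtain C' where C': "0 \<le> C'" "\<And>p. \<bar>\<phi> p\<bar> \<le> C'" "\<And>p. norm (X p) \<le> C'" "\<And>p. \<bar>T p\<bar> \<le> C'"
    using C1c_bound[OF C] by metis
  show thesis
  proof (rule that)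
    fix \<delta> :: real and p assume d: "\<delta> \<noteq> 0" "\<bar>\<delta>\<bar> \<le> 1" and p: "p \<in> K"
    have x: "norm (fst p) \<le> R" using R[OF p] norm_fst_le_norm[of p] by simp
    have "\<bar>eta \<delta> k (U p)\<bar> \<le> \<bar>U p - k\<bar> + \<bar>\<delta>\<bar>"
      unfolding eta_def using sqrt_sum_squares_le_sum_abs[of "U p - k" \<delta>] by simp
    also have "\<dots> \<le> 2 * A + 1" using UM[of p] d by (auto simp: A_def)
    finally have 1: "\<bar>T p * eta \<delta> k (U p)\<bar> \<le> C' * (2 * A + 1)"
      unfolding abs_mult using C' by (intro mult_mono) auto
    have "norm (eta_integral \<delta> k (U p) (flux_div (fst p))) \<le> L"
      by (rule eta_integral_norm_le[OF d(1) flux_div_cont]) (auto intro: L(3)[OF x] seg)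
    then have 2: "\<bar>\<phi> p * eta_integral \<delta> k (U p) (flux_div (fst p))\<bar> \<le> C' * L"
      unfolding abs_mult using C' by (intro mult_mono) auto
    have "norm (eta_integral \<delta> k (U p) (\<lambda>s. f (fst p, s))) \<le> L"
      by (rule eta_integral_norm_le[OF d(1) continuous_f_snd]) (auto intro: L(2)[OF x] seg)
    moreover have "norm (eta1 \<delta> k (U p) *\<^sub>R f (fst p, U p)) \<le> 1 * L"
      unfolding norm_scaleR using abs_eta1_le UM[of p] by (intro mult_mono L(2)[OF x]) (auto simp: A_def)
    ultimately have "norm (entropy_flux \<delta> k (fst p, U p)) \<le> L + L"
      unfolding entropy_flux_eq[OF d(1)] using norm_triangle_ineq4 by (metis (no_types, lifting) add_mono mult_1 order.trans)
    then have 3: "\<bar>X p \<bullet> entropy_flux \<delta> k (fst p, U p)\<bar> \<le> C' * (L + L)"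
      using C' by (intro order.trans[OF Cauchy_Schwarz_ineq2] mult_mono) auto
    show "\<bar>T p * eta \<delta> k (U p) - \<phi> p * eta_integral \<delta> k (U p) (flux_div (fst p)) + X p \<bullet> entropy_flux \<delta> k (fst p, U p)\<bar> \<le> C' * (2 * A + 1) + C' * L + C' * (L + L)"
      using 1 2 3 by linarith
  qed
qed

text \<open>The entropy condition is an iterated integral over \<open>lebesgue\<close> of a function
  that involves \<open>u\<close>, which is only Lebesgue measurable. Its integrand agrees with a
  Borel function \<open>H\<close> for almost every \<open>x\<close> at almost every time; as
  \<open>K\<close> lies in positive times, the restriction to \<open>{0<..}\<close> disappears, and
  Fubini's theorem gives one integral over space-time.\<close>

lemma smooth_entropy_inequality:
  assumes sol: "entropy_solution {0<..} f u0 u"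
    and [measurable]: "U \<in> borel_measurable borel" and UM: "\<And>p. \<bar>U p\<bar> \<le> M"
    and ae: "AE p in lborel. 0 < snd p \<longrightarrow> U p = u p"
    and C: "C1c \<phi> X T K" and K: "K \<subseteq> UNIV \<times> {0<..}" and pos: "\<And>p. 0 \<le> \<phi> p"
    and d: "\<delta> \<noteq> 0" "\<bar>\<delta>\<bar> \<le> 1"
  shows "0 \<le> (\<integral>p. T p * eta \<delta> k (U p) - \<phi> p * eta_integral \<delta> k (U p) (flux_div (fst p)) + X p \<bullet> entropy_flux \<delta> k (fst p, U p) \<partial>lborel)"
proof -
  define G where "G x t = deriv (\<lambda>s. \<phi> (x, s)) t * eta \<delta> k (u (x, t))
               + \<phi> (x, t) * (divergence (\<lambda>y. entropy_flux \<delta> k (y, u (x, t))) x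
                             - deriv (eta \<delta> k) (u (x, t)) * divergence (\<lambda>y. f (y, u (x, t))) x)
               + grad (\<lambda>y. \<phi> (y, t)) x \<bullet> entropy_flux \<delta> k (x, u (x, t))" for x t
  define H where "H p = T p * eta \<delta> k (U p) - \<phi> p * eta_integral \<delta> k (U p) (flux_div (fst p)) + X p \<bullet> entropy_flux \<delta> k (fst p, U p)" for p
  note [measurable] = C1c_measurable[OF C] eta_integral_measurable[OF assms(2)] entropy_flux_measurable[OF d(1) assms(2)]
  have H_meas [measurable]: "H \<in> borel_measurable borel" unfolding H_def[abs_def] eta_def by measurable
  have H0: "H p = 0" if "p \<notin> K" for p using that by (simp add: H_def C1cD[OF C])
  obtain CH where CH: "\<And>p. p \<in> K \<Longrightarrow> \<bar>H p\<bar> \<le> CH"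
    using smooth_entropy_bound[where U = U and k = k, OF C UM] d unfolding H_def by metis
  have H_int: "integrable lborel H"
    by (rule integrable_lborel_bounded_compact[OF H_meas C1cD(1)[OF C]]) (use CH H0 in auto)
  have "0 \<le> (\<integral>t\<in>{0<..}. (\<integral>x. G x t \<partial>lebesgue) \<partial>lebesgue)"
    unfolding G_def
    using sol entropy_pair_entropy_flux[OF d(1), of k] C1c_Lip_c[OF C K] pos
    unfolding entropy_solution_def by blast
  also have "\<dots> = (\<integral>t. (\<integral>x. H (x, t) \<partial>lborel) \<partial>lborel)"
  proof -
    have eq: "G x t = H (x, t)" if "0 < t" "x \<notin> B" "U (x, t) = u (x, t)" for x t
      unfolding G_def H_def C1c_deriv[OF C] eta_entropy(4)[OF d(1)]
      using that by (simp add: divergence_entropy_flux[OF d(1)] divergence_f algebra_simps)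
    have aeB: "AE x in lborel. x \<notin> B" using B_null by (rule AE_not_in)
    have "AE t in lborel. indicator {0<..} t *\<^sub>R (\<integral>x. G x t \<partial>lebesgue) = (\<integral>x. H (x, t) \<partial>lborel)"
      using AE_lborel_swap[OF ae]
    proof eventually_elim
      case (elim t)
      show ?case
      proof (cases "0 < t")
        case True
        from elim aeB have "AE x in lborel. H (x, t) = G x t"
          by eventually_elim (use eq True in auto)
        \<comment> \<open>Completeness of \<open>lebesgue\<close> makes the slice of
          \<open>G\<close> measurable, as it equals a Borel slice of \<open>H\<close> almost
          everywhere.\<close>
        then have ae': "AE x in lebesgue. H (x, t) = G x t" by (rule AE_completion)
        have Hm: "(\<lambda>x. H (x, t)) \<in> borel_measurable lebesgue" by (rule measurable_completion) measurable
        have "(\<integral>x. G x t \<partial>lebesgue) = (\<integral>x. H (x, t) \<partial>lebesgue)"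
          using ae' by (intro integral_cong_AE borel_measurable_AE[OF Hm ae'] Hm) auto
        also have "\<dots> = (\<integral>x. H (x, t) \<partial>lborel)" by (rule integral_completion) measurable
        finally show ?thesis using True by simp
      next
        case False
        then have "(x, t) \<notin> K" for x using K by auto
        then show ?thesis using False H0 by simp
      qed
    qed
    then have ae': "AE t in lebesgue. (\<integral>x. H (x, t) \<partial>lborel) = indicator {0<..} t *\<^sub>R (\<integral>x. G x t \<partial>lebesgue)"
      by (intro AE_completion) auto
    have Hm: "(\<lambda>t. \<integral>x. H (x, t) \<partial>lborel) \<in> borel_measurable lborel" by measurable
    have "(\<integral>t\<in>{0<..}. (\<integral>x. G x t \<partial>lebesgue) \<partial>lebesgue) = (\<integral>t. (\<integral>x. H (x, t) \<partial>lborel) \<partial>lebesgue)"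
      unfolding set_lebesgue_integral_def using ae'
      by (intro integral_cong_AE borel_measurable_AE[OF measurable_completion[OF Hm] ae'] measurable_completion[OF Hm]) auto
    also have "\<dots> = (\<integral>t. (\<integral>x. H (x, t) \<partial>lborel) \<partial>lborel)" by (rule integral_completion[OF Hm])
    finally show ?thesis .
  qed
  also have "\<dots> = (\<integral>p. H p \<partial>lborel)"
    using H_int lborel_pair.integral_snd[of "\<lambda>x t. H (x, t)"] by (simp add: lborel_prod)
  finally show ?thesis unfolding H_def .
qed

text \<open>Since the weight in \<open>eta_integral\<close> concentrates at \<open>k\<close>, the
  limit contains the divergence of \<open>f\<close> at the constant state \<open>k\<close> and not
  at \<open>U p\<close>.\<close>

lemma kruzhkov_inequality:
  assumes sol: "entropy_solution {0<..} f u0 u"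
    and [measurable]: "U \<in> borel_measurable borel" and UM: "\<And>p. \<bar>U p\<bar> \<le> M"
    and ae: "AE p in lborel. 0 < snd p \<longrightarrow> U p = u p"
    and C: "C1c \<phi> X T K" and K: "K \<subseteq> UNIV \<times> {0<..}" and pos: "\<And>p. 0 \<le> \<phi> p"
  shows "0 \<le> (\<integral>p. T p * \<bar>U p - k\<bar> - \<phi> p * (sgn (U p - k) * flux_div (fst p) k) + X p \<bullet> kflux (fst p) (U p) k \<partial>lborel)"
proof -
  define d where "d n = 1 / real (Suc n)" for n
  have d: "d \<longlonglongrightarrow> 0" "\<And>n. d n \<noteq> 0" "\<And>n. \<bar>d n\<bar> \<le> 1"
    unfolding d_def using LIMSEQ_Suc[OF lim_inverse_n'] by auto
  note [measurable] = C1c_measurable[OF C] eta_integral_measurable[OF assms(2)] entropy_flux_measurable[OF d(2) assms(2)]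
  obtain CH where CH: "\<And>\<delta> p. \<delta> \<noteq> 0 \<Longrightarrow> \<bar>\<delta>\<bar> \<le> 1 \<Longrightarrow> p \<in> K \<Longrightarrow>
    \<bar>T p * eta \<delta> k (U p) - \<phi> p * eta_integral \<delta> k (U p) (flux_div (fst p)) + X p \<bullet> entropy_flux \<delta> k (fst p, U p)\<bar> \<le> CH"
    using smooth_entropy_bound[where U = U and k = k, OF C UM] by metis
  have "compact K" using C by (rule C1cD(1))
  have "(\<lambda>n. \<integral>p. T p * eta (d n) k (U p) - \<phi> p * eta_integral (d n) k (U p) (flux_div (fst p)) + X p \<bullet> entropy_flux (d n) k (fst p, U p) \<partial>lborel) \<longlonglongrightarrow>
    (\<integral>p. T p * \<bar>U p - k\<bar> - \<phi> p * (sgn (U p - k) * flux_div (fst p) k) + X p \<bullet> kflux (fst p) (U p) k \<partial>lborel)"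
  proof (rule integral_dominated_convergence)
    show "integrable lborel (\<lambda>p. CH * indicator K p)"
      using \<open>compact K\<close> by (intro integrable_mult_right integrable_real_indicator) (auto intro: emeasure_lborel_compact_finite borel_compact)
    show "(\<lambda>p. T p * \<bar>U p - k\<bar> - \<phi> p * (sgn (U p - k) * flux_div (fst p) k) + X p \<bullet> kflux (fst p) (U p) k) \<in> borel_measurable lborel"
      by measurable
    fix n
    show "(\<lambda>p. T p * eta (d n) k (U p) - \<phi> p * eta_integral (d n) k (U p) (flux_div (fst p)) + X p \<bullet> entropy_flux (d n) k (fst p, U p)) \<in> borel_measurable lborel"
      unfolding eta_def by measurable
    show "AE p in lborel. norm (T p * eta (d n) k (U p) - \<phi> p * eta_integral (d n) k (U p) (flux_div (fst p)) + X p \<bullet> entropy_flux (d n) k (fst p, U p)) \<le> CH * indicator K p"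
    proof (rule AE_I2)
      fix p
      show "norm (T p * eta (d n) k (U p) - \<phi> p * eta_integral (d n) k (U p) (flux_div (fst p)) + X p \<bullet> entropy_flux (d n) k (fst p, U p)) \<le> CH * indicator K p"
        using CH[OF d(2,3), of p n] by (cases "p \<in> K") (auto simp: C1cD[OF C])
    qed
  next
    show "AE p in lborel. (\<lambda>n. T p * eta (d n) k (U p) - \<phi> p * eta_integral (d n) k (U p) (flux_div (fst p)) + X p \<bullet> entropy_flux (d n) k (fst p, U p)) \<longlonglongrightarrow>
      T p * \<bar>U p - k\<bar> - \<phi> p * (sgn (U p - k) * flux_div (fst p) k) + X p \<bullet> kflux (fst p) (U p) k"
    proof (rule AE_I2)
      fix p
      have 1: "(\<lambda>n. eta_integral (d n) k (U p) (flux_div (fst p))) \<longlonglongrightarrow> sgn (U p - k) * flux_div (fst p) k"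
        using eta_integral_tendsto[OF d(1,2) flux_div_cont] by simp
      have 2: "(\<lambda>n. entropy_flux (d n) k (fst p, U p)) \<longlonglongrightarrow> kflux (fst p) (U p) k"
        unfolding entropy_flux_eq[OF d(2)] kflux_def scaleR_diff_right
        by (intro tendsto_diff tendsto_scaleR tendsto_const eta1_tendsto[OF d(1)] eta_integral_tendsto[OF d(1,2) continuous_f_snd])
      show "(\<lambda>n. T p * eta (d n) k (U p) - \<phi> p * eta_integral (d n) k (U p) (flux_div (fst p)) + X p \<bullet> entropy_flux (d n) k (fst p, U p)) \<longlonglongrightarrow>
        T p * \<bar>U p - k\<bar> - \<phi> p * (sgn (U p - k) * flux_div (fst p) k) + X p \<bullet> kflux (fst p) (U p) k"
        by (intro tendsto_intros 1 2 eta_tendsto[OF d(1)])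
    qed
  qed
  then show ?thesis
    by (rule LIMSEQ_le_const) (use smooth_entropy_inequality[OF sol assms(2) UM ae C K pos d(2,3)] in auto)
qed

end

subsection \<open>Doubling of variables\<close>

text \<open>The square of the positive part is continuously differentiable. The bump and the cone
  weight are built as such squares, so the cutoff at 0 keeps them C1.\<close>

lemma max0_square_deriv: "((\<lambda>s::real. (max 0 s)\<^sup>2) has_real_derivative 2 * max 0 s) (at s)"
proof -
  consider "s > 0" | "s < 0" | "s = 0" by linarith
  then show ?thesis
  proof cases
    case 1
    have "((\<lambda>s::real. s\<^sup>2) has_real_derivative 2 * max 0 s) (at s)"
      using 1 by (auto intro!: derivative_eq_intros)
    then show ?thesis
      by (rule has_field_derivative_transform_within_open[of _ _ _ "{0<..}"]) (use 1 in auto)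
  next
    case 2
    have "((\<lambda>s::real. 0) has_real_derivative 2 * max 0 s) (at s)"
      using 2 by (auto intro!: derivative_eq_intros)
    then show ?thesis
      by (rule has_field_derivative_transform_within_open[of _ _ _ "{..<0}"]) (use 2 in auto)
  next
    case 3
    have "((\<lambda>h. (max 0 h)\<^sup>2 / h) \<longlongrightarrow> (0::real)) (at 0)"
    proof (rule Lim_null_comparison)
      show "\<forall>\<^sub>F h in at 0. norm ((max 0 h)\<^sup>2 / h) \<le> \<bar>h::real\<bar>"
        by (rule always_eventually) (auto simp: max_def power2_eq_square)
      show "((\<lambda>h. \<bar>h::real\<bar>) \<longlongrightarrow> 0) (at 0)" by (rule tendsto_rabs_zero) (rule tendsto_ident_at)
    qed
    then show ?thesis using 3 by (simp add: DERIV_def)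
  qed
qed

text \<open>An even C1 profile, supported in the unit ball of space-time. Its integral is carried
  along as a positive factor and divided out at the end.\<close>

definition bump :: "'a::euclidean_space \<times> real \<Rightarrow> real" where
  "bump w = (max 0 (1 - w \<bullet> w))\<^sup>2"

definition bumpx :: "'a::euclidean_space \<times> real \<Rightarrow> 'a" where
  "bumpx w = (- 4 * max 0 (1 - w \<bullet> w)) *\<^sub>R fst w"

definition bumpt :: "'a::euclidean_space \<times> real \<Rightarrow> real" where
  "bumpt w = - 4 * max 0 (1 - w \<bullet> w) * snd w"

lemma bump_nonneg: "0 \<le> bump w"
  by (simp add: bump_def)

lemma bump_C1c: "C1c bump bumpx bumpt (cball 0 1)"
  unfolding C1c_def
proof (intro conjI allI impI)
  show "continuous_on UNIV bumpx" "continuous_on UNIV bumpt"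
    unfolding bumpx_def[abs_def] bumpt_def[abs_def] by (intro continuous_intros)+
  fix p :: "'a \<times> real"
  have "((\<lambda>w::'a \<times> real. 1 - w \<bullet> w) has_derivative (\<lambda>h. - 2 * (p \<bullet> h))) (at p)"
    by (auto intro!: derivative_eq_intros simp: inner_commute)
  from has_derivative_compose[OF this max0_square_deriv[unfolded has_field_derivative_def]]
  have "(bump has_derivative (\<lambda>h. 2 * max 0 (1 - p \<bullet> p) * (- 2 * (p \<bullet> h)))) (at p)"
    unfolding bump_def[abs_def] .
  also have "(\<lambda>h. 2 * max 0 (1 - p \<bullet> p) * (- 2 * (p \<bullet> h))) = (\<lambda>h. bumpx p \<bullet> fst h + bumpt p * snd h)"
    by (rule ext) (simp add: bumpx_def bumpt_def inner_prod_def[of p] algebra_simps)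
  finally show "(bump has_derivative (\<lambda>h. bumpx p \<bullet> fst h + bumpt p * snd h)) (at p)" .
  assume "p \<notin> cball 0 1"
  then have "1 < (norm p)\<^sup>2" using one_less_power[of "norm p" 2] by simp
  then have "1 < p \<bullet> p" by (simp add: power2_norm_eq_inner)
  then show "bump p = 0" "bumpx p = 0" "bumpt p = 0" by (auto simp: bump_def bumpx_def bumpt_def)
qed auto

lemma C1c_times_bump:
  assumes \<psi>: "C1c \<psi> X T K" and e: "e \<noteq> 0"
  shows "C1c (\<lambda>p. \<psi> p * bump ((p - q) /\<^sub>R e))
    (\<lambda>p. bump ((p - q) /\<^sub>R e) *\<^sub>R X p + (\<psi> p / e) *\<^sub>R bumpx ((p - q) /\<^sub>R e))
    (\<lambda>p. bump ((p - q) /\<^sub>R e) * T p + (\<psi> p / e) * bumpt ((p - q) /\<^sub>R e)) K"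
  unfolding C1c_def
proof (intro conjI allI impI)
  note b = C1c_cont[OF bump_C1c]
  have c: "continuous_on UNIV (\<lambda>p. (p - q) /\<^sub>R e)" by (intro continuous_intros)
  note c1 = continuous_on_compose2[OF b(1) c] continuous_on_compose2[OF b(2) c] continuous_on_compose2[OF b(3) c]
  show "continuous_on UNIV (\<lambda>p. bump ((p - q) /\<^sub>R e) *\<^sub>R X p + (\<psi> p / e) *\<^sub>R bumpx ((p - q) /\<^sub>R e))"
    "continuous_on UNIV (\<lambda>p. bump ((p - q) /\<^sub>R e) * T p + (\<psi> p / e) * bumpt ((p - q) /\<^sub>R e))"
    by (intro continuous_intros c1 C1c_cont[OF \<psi>]; simp add: e)+
  fix p
  have "((\<lambda>p. (p - q) /\<^sub>R e) has_derivative (\<lambda>h. h /\<^sub>R e)) (at p)"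
    by (auto intro!: derivative_eq_intros)
  from has_derivative_compose[OF this C1cD(2)[OF bump_C1c]]
  have "((\<lambda>p. bump ((p - q) /\<^sub>R e)) has_derivative (\<lambda>h. bumpx ((p - q) /\<^sub>R e) \<bullet> fst (h /\<^sub>R e) + bumpt ((p - q) /\<^sub>R e) * snd (h /\<^sub>R e))) (at p)" .
  from has_derivative_mult[OF C1cD(2)[OF \<psi>] this]
  show "((\<lambda>p. \<psi> p * bump ((p - q) /\<^sub>R e)) has_derivative
     (\<lambda>h. (bump ((p - q) /\<^sub>R e) *\<^sub>R X p + (\<psi> p / e) *\<^sub>R bumpx ((p - q) /\<^sub>R e)) \<bullet> fst h +
          (bump ((p - q) /\<^sub>R e) * T p + (\<psi> p / e) * bumpt ((p - q) /\<^sub>R e)) * snd h)) (at p)"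
    by (rule has_derivative_eq_rhs) (rule ext, simp add: algebra_simps inner_add_left divide_inverse)
qed (use C1cD[OF \<psi>] in auto)

text \<open>The test function in the second variable. With \<open>p\<close> fixed, the factor \<psi>
  is a constant, so all derivatives fall on the bump, with the sign opposite to the derivatives in
  \<open>p\<close>.\<close>

lemma C1c_bump_reflect:
  assumes e: "0 < e" and c: "0 \<le> (c::real)"
  shows "C1c (\<lambda>q. c * bump ((p - q) /\<^sub>R e))
    (\<lambda>q. (- c / e) *\<^sub>R bumpx ((p - q) /\<^sub>R e))
    (\<lambda>q. (- c / e) * bumpt ((p - q) /\<^sub>R e)) (cball p e)"
  unfolding C1c_def
proof (intro conjI allI impI)
  note b = C1c_cont[OF bump_C1c]
  have c: "continuous_on UNIV (\<lambda>q. (p - q) /\<^sub>R e)" by (intro continuous_intros)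
  note c1 = continuous_on_compose2[OF b(1) c] continuous_on_compose2[OF b(2) c] continuous_on_compose2[OF b(3) c]
  show "continuous_on UNIV (\<lambda>q. (- c / e) *\<^sub>R bumpx ((p - q) /\<^sub>R e))"
    "continuous_on UNIV (\<lambda>q. (- c / e) * bumpt ((p - q) /\<^sub>R e))"
    by (intro continuous_intros c1; use e in simp)+
  fix q
  have "((\<lambda>q. (p - q) /\<^sub>R e) has_derivative (\<lambda>h. - h /\<^sub>R e)) (at q)"
    by (auto intro!: derivative_eq_intros)
  from has_derivative_compose[OF this C1cD(2)[OF bump_C1c]]
  have "((\<lambda>q. bump ((p - q) /\<^sub>R e)) has_derivative (\<lambda>h. bumpx ((p - q) /\<^sub>R e) \<bullet> fst (- h /\<^sub>R e) + bumpt ((p - q) /\<^sub>R e) * snd (- h /\<^sub>R e))) (at q)" .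
  from has_derivative_mult_right[OF this, of c]
  show "((\<lambda>q. c * bump ((p - q) /\<^sub>R e)) has_derivative
     (\<lambda>h. ((- c / e) *\<^sub>R bumpx ((p - q) /\<^sub>R e)) \<bullet> fst h + ((- c / e) * bumpt ((p - q) /\<^sub>R e)) * snd h)) (at q)"
    by (rule has_derivative_eq_rhs) (rule ext, simp add: algebra_simps divide_inverse)
  assume "q \<notin> cball p e"
  then have "1 < norm (p - q) / e" using e by (simp add: dist_norm less_divide_eq)
  also have "norm (p - q) / e = norm ((p - q) /\<^sub>R e)" using e by (simp add: divide_inverse mult.commute)
  finally have "(p - q) /\<^sub>R e \<notin> cball 0 1" by (simp only: mem_cball_0 not_le)
  note bb = C1cD(3-5)[OF bump_C1c this]
  show "c * bump ((p - q) /\<^sub>R e) = 0" "(- c / e) *\<^sub>R bumpx ((p - q) /\<^sub>R e) = 0" "(- c / e) * bumpt ((p - q) /\<^sub>R e) = 0"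
    by (simp_all only: bb mult_zero_right scaleR_zero_right)
qed auto

lemma integral_lborel_affine:
  fixes g :: "'e::euclidean_space \<Rightarrow> real"
  assumes [measurable]: "g \<in> borel_measurable borel" and c: "c \<noteq> 0"
  shows "(\<integral>p. g p \<partial>lborel) = \<bar>c\<bar> ^ DIM('e) * (\<integral>w. g (t + c *\<^sub>R w) \<partial>lborel)"
proof -
  have "(\<integral>p. g p \<partial>lborel) = (\<integral>p. g p \<partial>density (distr lborel borel (\<lambda>x. t + c *\<^sub>R x)) (\<lambda>_. ennreal (\<bar>c\<bar> ^ DIM('e))))"
    using lborel_affine[OF c, of t] by (simp add: ennreal_power)
  also have "\<dots> = (\<integral>p. \<bar>c\<bar> ^ DIM('e) *\<^sub>R g p \<partial>distr lborel borel (\<lambda>x. t + c *\<^sub>R x))"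
    by (subst integral_density) auto
  also have "\<dots> = (\<integral>w. \<bar>c\<bar> ^ DIM('e) *\<^sub>R g (t + c *\<^sub>R w) \<partial>lborel)"
    by (subst integral_distr) auto
  finally show ?thesis by simp
qed

section \<open>The doubled integrand and its integral\<close>

context flux begin

definition kruzhkov :: "('a \<times> real \<Rightarrow> real) \<Rightarrow> bool" where
  "kruzhkov U \<longleftrightarrow> (\<forall>\<phi> X T K k. C1c \<phi> X T K \<longrightarrow> K \<subseteq> UNIV \<times> {0<..} \<longrightarrow> (\<forall>p. 0 \<le> \<phi> p) \<longrightarrow>
     0 \<le> (\<integral>p. T p * \<bar>U p - k\<bar> - \<phi> p * (sgn (U p - k) * flux_div (fst p) k) + X p \<bullet> kflux (fst p) (U p) k \<partial>lborel))"

text \<open>The sum of the integrands of the two Kruzhkov inequalities. The time derivatives of the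
  bump cancel, while its gradients leave the difference of the fluxes at \<open>fst p\<close> and
  \<open>fst q\<close>, divided by \<open>e\<close>.\<close>

definition doubled where
  "doubled U V \<psi> X T e q p =
     (\<bar>U p - V q\<bar> * T p + X p \<bullet> kflux (fst p) (U p) (V q)) * bump ((p - q) /\<^sub>R e)
     + \<psi> p * ((kflux (fst p) (U p) (V q) - kflux (fst q) (U p) (V q)) \<bullet> bumpx ((p - q) /\<^sub>R e) / e
       + sgn (U p - V q) * (flux_div (fst q) (U p) - flux_div (fst p) (V q)) * bump ((p - q) /\<^sub>R e))"

text \<open>On the support of the bump the Lipschitz condition in \<open>x\<close> makes the flux
  difference O(e), which compensates the division by \<open>e\<close>; hence the bound is uniform in
  \<open>e\<close>. The support is described through the factors because it is applied to the two
  parts of \<open>doubled\<close> separately as well.\<close>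

lemma doubled_bound:
  assumes \<psi>: "C1c \<psi> X T K" and UM: "\<And>p. \<bar>U p\<bar> \<le> M" and VM: "\<And>p. \<bar>V p\<bar> \<le> M"
  obtains C R where "\<And>e q w. 0 < e \<Longrightarrow> e \<le> 1 \<Longrightarrow> \<bar>doubled U V \<psi> X T e q (q + e *\<^sub>R w)\<bar> \<le> C"
    "\<And>e q w. 0 < e \<Longrightarrow> e \<le> 1 \<Longrightarrow> (q, w) \<notin> cball 0 R \<times> cball 0 1 \<Longrightarrow>
        bump w = 0 \<and> bumpx w = 0 \<or> \<psi> (q + e *\<^sub>R w) = 0 \<and> X (q + e *\<^sub>R w) = 0 \<and> T (q + e *\<^sub>R w) = 0"
    "\<And>p. p \<in> K \<Longrightarrow> norm p + 1 \<le> R" "1 \<le> R"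
proof -
  obtain R0 where R0: "\<And>p. p \<in> K \<Longrightarrow> norm p \<le> R0"
    using C1cD(1)[OF \<psi>] compact_imp_bounded bounded_iff by metis
  define R where "R = \<bar>R0\<bar> + 1"
  have R: "\<And>p. p \<in> K \<Longrightarrow> norm p + 1 \<le> R" "1 \<le> R"
    using R0 by (force simp: R_def)+
  obtain C1 where C1: "0 \<le> C1" "\<And>p. \<bar>\<psi> p\<bar> \<le> C1" "\<And>p. norm (X p) \<le> C1" "\<And>p. \<bar>T p\<bar> \<le> C1"
    using C1c_bound[OF \<psi>] by metis
  obtain C2 where C2: "0 \<le> C2" "\<And>p::'a \<times> real. \<bar>bump p\<bar> \<le> C2" "\<And>p::'a \<times> real. norm (bumpx p) \<le> C2"
    using C1c_bound[OF bump_C1c] by metis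
  obtain L where L: "0 \<le> L"
    "\<And>x y k. norm x \<le> R \<Longrightarrow> norm y \<le> R \<Longrightarrow> \<bar>k\<bar> \<le> M \<Longrightarrow> norm (f (x, k) - f (y, k)) \<le> L * norm (x - y)"
    "\<And>x k. norm x \<le> R \<Longrightarrow> \<bar>k\<bar> \<le> M \<Longrightarrow> \<bar>flux_div x k\<bar> \<le> L"
    "\<And>x c k. norm x \<le> R \<Longrightarrow> \<bar>c\<bar> \<le> M \<Longrightarrow> \<bar>k\<bar> \<le> M \<Longrightarrow> norm (kflux x c k) \<le> L"
    using local_bounds[of R M] by metis
  have M0: "0 \<le> M" using UM[of "(0,0)"] by simp
  have out: "bump w = 0 \<and> bumpx w = 0 \<or> \<psi> (q + e *\<^sub>R w) = 0 \<and> X (q + e *\<^sub>R w) = 0 \<and> T (q + e *\<^sub>R w) = 0"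
    if e: "0 < e" "e \<le> 1" and qw: "(q, w) \<notin> cball 0 R \<times> cball 0 1" for e q w
  proof (cases "w \<in> cball 0 1 \<and> q + e *\<^sub>R w \<in> K")
    case True
    have "norm q \<le> norm (q + e *\<^sub>R w) + norm (e *\<^sub>R w)"
      using norm_triangle_ineq4[of "q + e *\<^sub>R w" "e *\<^sub>R w"] by simp
    also have "norm (e *\<^sub>R w) \<le> 1" using True e by (simp add: mult_le_one)
    finally have "norm q \<le> R" using R(1)[of "q + e *\<^sub>R w"] True by simp
    then show ?thesis using qw True by auto
  next
    case False
    then show ?thesis using C1cD(3-5)[OF \<psi>] C1cD(3-5)[OF bump_C1c] by blast
  qed
  have bd: "\<bar>doubled U V \<psi> X T e q (q + e *\<^sub>R w)\<bar> \<le> (2 * M * C1 + C1 * L) * C2 + C1 * ((L + L) * C2 + (L + L) * C2)"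
    if e: "0 < e" "e \<le> 1" for e q w
  proof (cases "w \<in> cball 0 1 \<and> q + e *\<^sub>R w \<in> K")
    case False
    then have "bump w = 0 \<and> bumpx w = 0 \<or> \<psi> (q + e *\<^sub>R w) = 0 \<and> X (q + e *\<^sub>R w) = 0 \<and> T (q + e *\<^sub>R w) = 0"
      using C1cD(3-5)[OF \<psi>, of "q + e *\<^sub>R w"] C1cD(3-5)[OF bump_C1c, of w] by blast
    then have "doubled U V \<psi> X T e q (q + e *\<^sub>R w) = 0"
      using e by (auto simp: doubled_def)
    then show ?thesis using M0 C1(1) C2(1) L(1) by simp
  next
    case True
    define p where "p = q + e *\<^sub>R w"
    have p: "(p - q) /\<^sub>R e = w" using e by (simp add: p_def)
    have e_w: "norm (e *\<^sub>R w) \<le> 1" using True e by (simp add: mult_le_one)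
    have "norm q \<le> norm p + norm (e *\<^sub>R w)"
      using norm_triangle_ineq4[of p "e *\<^sub>R w"] by (simp add: p_def)
    then have q: "norm q \<le> R" and pR: "norm p \<le> R" using e_w True R(1)[of p] by (auto simp: p_def)
    have x: "norm (fst p) \<le> R" "norm (fst q) \<le> R"
      using q pR norm_fst_le_norm order.trans by blast+
    let ?u = "U p" and ?v = "V q"
    have uv: "\<bar>?u\<bar> \<le> M" "\<bar>?v\<bar> \<le> M" by (rule UM, rule VM)
    have 1: "\<bar>\<bar>?u - ?v\<bar> * T p\<bar> \<le> 2 * M * C1"
      unfolding abs_mult using uv C1 by (intro mult_mono) auto
    have 2: "\<bar>X p \<bullet> kflux (fst p) ?u ?v\<bar> \<le> C1 * L"
      using C1 L(4)[OF x(1) uv] by (intro order.trans[OF Cauchy_Schwarz_ineq2] mult_mono) auto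
    have "\<bar>\<bar>?u - ?v\<bar> * T p + X p \<bullet> kflux (fst p) ?u ?v\<bar> \<le> 2 * M * C1 + C1 * L" using 1 2 by linarith
    then have 3: "\<bar>(\<bar>?u - ?v\<bar> * T p + X p \<bullet> kflux (fst p) ?u ?v) * bump w\<bar> \<le> (2 * M * C1 + C1 * L) * C2"
      unfolding abs_mult using C2 C1(1) L(1) M0 by (intro mult_mono) auto
    have "norm (kflux (fst p) ?u ?v - kflux (fst q) ?u ?v) \<le> norm (f (fst p, ?u) - f (fst q, ?u) - (f (fst p, ?v) - f (fst q, ?v)))"
      unfolding kflux_def by (auto simp: sgn_real_def algebra_simps norm_minus_commute)
    also have "\<dots> \<le> L * norm (fst p - fst q) + L * norm (fst p - fst q)"
      by (intro order.trans[OF norm_triangle_ineq4] add_mono L(2) x uv)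
    also have "\<dots> \<le> (L + L) * e"
    proof -
      have "norm (fst p - fst q) = norm (fst (e *\<^sub>R w))" by (simp add: p_def)
      also have "\<dots> \<le> norm (e *\<^sub>R w)" by (rule norm_fst_le_norm)
      also have "\<dots> \<le> e" using True e by (simp add: mult_left_le)
      finally show ?thesis using L(1) by (simp add: algebra_simps mult_left_mono)
    qed
    finally have F: "norm (kflux (fst p) ?u ?v - kflux (fst q) ?u ?v) / e \<le> L + L" using e by (simp add: divide_le_eq)
    have "\<bar>(kflux (fst p) ?u ?v - kflux (fst q) ?u ?v) \<bullet> bumpx w / e\<bar> \<le> norm (kflux (fst p) ?u ?v - kflux (fst q) ?u ?v) * norm (bumpx w) / e"
      using e Cauchy_Schwarz_ineq2[of "kflux (fst p) ?u ?v - kflux (fst q) ?u ?v" "bumpx w"] by (simp add: abs_divide divide_right_mono)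
    also have "\<dots> = norm (kflux (fst p) ?u ?v - kflux (fst q) ?u ?v) / e * norm (bumpx w)" by simp
    also have "\<dots> \<le> (L + L) * C2" using F C2 L(1) e by (intro mult_mono) auto
    finally have 4: "\<bar>(kflux (fst p) ?u ?v - kflux (fst q) ?u ?v) \<bullet> bumpx w / e\<bar> \<le> (L + L) * C2" .
    have "\<bar>sgn (?u - ?v) * (flux_div (fst q) ?u - flux_div (fst p) ?v)\<bar> \<le> 1 * (L + L)"
      unfolding abs_mult using L(3)[OF x(2) uv(1)] L(3)[OF x(1) uv(2)]
      by (intro mult_mono) (auto simp: sgn_real_def)
    then have 5: "\<bar>sgn (?u - ?v) * (flux_div (fst q) ?u - flux_div (fst p) ?v) * bump w\<bar> \<le> (L + L) * C2"
      unfolding abs_mult[of _ "bump w"] using C2 L(1) by (intro mult_mono) auto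
    have "\<bar>(kflux (fst p) ?u ?v - kflux (fst q) ?u ?v) \<bullet> bumpx w / e + sgn (?u - ?v) * (flux_div (fst q) ?u - flux_div (fst p) ?v) * bump w\<bar> \<le> (L + L) * C2 + (L + L) * C2"
      using 4 5 by linarith
    then have 6: "\<bar>\<psi> p * ((kflux (fst p) ?u ?v - kflux (fst q) ?u ?v) \<bullet> bumpx w / e + sgn (?u - ?v) * (flux_div (fst q) ?u - flux_div (fst p) ?v) * bump w)\<bar>
      \<le> C1 * ((L + L) * C2 + (L + L) * C2)"
      unfolding abs_mult[of "\<psi> p"] using C1 by (intro mult_mono) auto
    have "doubled U V \<psi> X T e q p = (\<bar>?u - ?v\<bar> * T p + X p \<bullet> kflux (fst p) ?u ?v) * bump w +
      \<psi> p * ((kflux (fst p) ?u ?v - kflux (fst q) ?u ?v) \<bullet> bumpx w / e + sgn (?u - ?v) * (flux_div (fst q) ?u - flux_div (fst p) ?v) * bump w)"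
      unfolding doubled_def p ..
    then show ?thesis unfolding p_def[symmetric] using 3 6 by linarith
  qed
  show thesis by (rule that[OF bd out R])
qed

lemma doubled_measurable:
  assumes \<psi>: "C1c \<psi> X T K" and [measurable]: "U \<in> borel_measurable borel" "V \<in> borel_measurable borel"
    "g \<in> borel_measurable N" "h \<in> borel_measurable N"
  shows "(\<lambda>z. doubled U V \<psi> X T e (g z) (h z)) \<in> borel_measurable N"
proof -
  note [measurable] = C1c_measurable(1-3)[OF \<psi>] C1c_measurable(1-3)[OF bump_C1c]
  show ?thesis unfolding doubled_def by measurable
qed

text \<open>The inequality for \<open>U\<close> is taken in \<open>p\<close> with the constant
  \<open>V q\<close>, the one for \<open>V\<close> in \<open>q\<close> with the constant
  \<open>U p\<close>, and each is integrated over the other variable. The substitution p = q + e w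
  produces a positive power of \<open>e\<close>, which is divided out. The condition on
  \<open>K\<close> keeps the ball of radius \<open>e\<close> around each of its points within
  positive times.\<close>

lemma doubling_inequality:
  assumes \<psi>: "C1c \<psi> X T K" and K: "\<And>p. p \<in> K \<Longrightarrow> e < snd p" and pos: "\<And>p. 0 \<le> \<psi> p"
    and [measurable]: "U \<in> borel_measurable borel" "V \<in> borel_measurable borel"
    and UM: "\<And>p. \<bar>U p\<bar> \<le> M" and VM: "\<And>p. \<bar>V p\<bar> \<le> M"
    and kU: "kruzhkov U" and kV: "kruzhkov V" and e: "0 < e" "e \<le> 1"
  shows "0 \<le> (\<integral>z. doubled U V \<psi> X T e (fst z) (fst z + e *\<^sub>R snd z) \<partial>lborel)"
proof -
  define b where "b q p = bump ((p - q) /\<^sub>R e)" for q p :: "'a \<times> real"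
  define X1 where "X1 q p = b q p *\<^sub>R X p + (\<psi> p / e) *\<^sub>R bumpx ((p - q) /\<^sub>R e)" for q p
  define T1 where "T1 q p = b q p * T p + (\<psi> p / e) * bumpt ((p - q) /\<^sub>R e)" for q p
  define X2 where "X2 p q = (- \<psi> p / e) *\<^sub>R bumpx ((p - q) /\<^sub>R e)" for q p :: "'a \<times> real"
  define T2 where "T2 p q = (- \<psi> p / e) * bumpt ((p - q) /\<^sub>R e)" for q p :: "'a \<times> real"
  define I1 where "I1 q p = T1 q p * \<bar>U p - V q\<bar> - (\<psi> p * b q p) * (sgn (U p - V q) * flux_div (fst p) (V q)) + X1 q p \<bullet> kflux (fst p) (U p) (V q)" for q p
  define I2 where "I2 q p = T2 p q * \<bar>V q - U p\<bar> - (\<psi> p * b q p) * (sgn (V q - U p) * flux_div (fst q) (U p)) + X2 p q \<bullet> kflux (fst q) (V q) (U p)" for q p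
  note [measurable] = C1c_measurable[OF \<psi>] C1c_measurable(1-3)[OF bump_C1c]
  have meas: "(\<lambda>z. I1 (fst z) (snd z)) \<in> borel_measurable borel" "(\<lambda>z. I2 (fst z) (snd z)) \<in> borel_measurable borel"
    unfolding I1_def I2_def T1_def T2_def X1_def X2_def b_def by measurable
  obtain R0 where R0: "\<And>p. p \<in> K \<Longrightarrow> norm p \<le> R0"
    using C1cD(1)[OF \<psi>] compact_imp_bounded bounded_iff by metis
  define S where "S = (cball 0 (\<bar>R0\<bar> + 1) \<times> cball 0 (\<bar>R0\<bar> + 1) :: (('a \<times> real) \<times> ('a \<times> real)) set)"
  have S: "compact S" unfolding S_def by (intro compact_Times compact_cball)
  have bz: "bump ((p - q) /\<^sub>R e) = 0" "bumpx ((p - q) /\<^sub>R e) = 0" "bumpt ((p - q) /\<^sub>R e) = 0" if "e < norm (p - q)" for p q :: "'a \<times> real"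
  proof -
    have "1 < norm (p - q) / e" using e that by (simp add: less_divide_eq)
    also have "norm (p - q) / e = norm ((p - q) /\<^sub>R e)" using e by (simp add: divide_inverse mult.commute)
    finally have "(p - q) /\<^sub>R e \<notin> cball 0 1" by (simp only: mem_cball_0 not_le)
    note bb = C1cD(3-5)[OF bump_C1c this]
    show "bump ((p - q) /\<^sub>R e) = 0" "bumpx ((p - q) /\<^sub>R e) = 0" "bumpt ((p - q) /\<^sub>R e) = 0"
      by (fact bb)+
  qed
  have out: "(bump ((p - q) /\<^sub>R e) = 0 \<and> bumpx ((p - q) /\<^sub>R e) = 0 \<and> bumpt ((p - q) /\<^sub>R e) = 0) \<or> (\<psi> p = 0 \<and> X p = 0 \<and> T p = 0)"
    if "(q, p) \<notin> S" for q p
  proof (cases "p \<in> K \<and> norm (p - q) \<le> e")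
    case True
    then have "norm q \<le> norm p + e" using norm_triangle_ineq4[of p "p - q"] by simp
    then show ?thesis using that True R0[of p] e by (auto simp: S_def)
  next
    case False
    then show ?thesis using bz[of p q] C1cD(3-5)[OF \<psi>, of p] by fastforce
  qed
  have zero: "I1 q p = 0" "I2 q p = 0" if "(q, p) \<notin> S" for q p
    using out[OF that] by (auto simp: I1_def I2_def T1_def T2_def X1_def X2_def b_def)
  obtain C1 where C1: "0 \<le> C1" "\<And>p. \<bar>\<psi> p\<bar> \<le> C1" "\<And>p. norm (X p) \<le> C1" "\<And>p. \<bar>T p\<bar> \<le> C1"
    using C1c_bound[OF \<psi>] by metis
  obtain C2 where C2: "0 \<le> C2" "\<And>p::'a \<times> real. \<bar>bump p\<bar> \<le> C2" "\<And>p::'a \<times> real. norm (bumpx p) \<le> C2" "\<And>p::'a \<times> real. \<bar>bumpt p\<bar> \<le> C2"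
    using C1c_bound[OF bump_C1c] by metis
  obtain L where L: "0 \<le> L"
    "\<And>x k. norm x \<le> \<bar>R0\<bar> + 1 \<Longrightarrow> \<bar>k\<bar> \<le> M \<Longrightarrow> \<bar>flux_div x k\<bar> \<le> L"
    "\<And>x c k. norm x \<le> \<bar>R0\<bar> + 1 \<Longrightarrow> \<bar>c\<bar> \<le> M \<Longrightarrow> \<bar>k\<bar> \<le> M \<Longrightarrow> norm (kflux x c k) \<le> L"
    using local_bounds[of "\<bar>R0\<bar> + 1" M] by metis
  have M0: "0 \<le> M" using UM[of "(0,0)"] by simp
  \<comment> \<open>Bounds the derivatives of both test functions for this fixed \<open>e\<close>.
    It serves the integrability that Fubini's theorem requires, so its growth as \<open>e\<close>
    tends to 0 does no harm.\<close>
  define CC where "CC = C2 * C1 + C1 / e * C2"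
  have CC0: "0 \<le> CC" using C1(1) C2(1) e by (simp add: CC_def)
  have bd_gen: "\<bar>t * \<bar>c\<bar> - ph * (sgn c * d) + x \<bullet> F\<bar> \<le> CC * (2 * M) + C1 * C2 * L + CC * L"
    if "\<bar>t\<bar> \<le> CC" "\<bar>c\<bar> \<le> 2 * M" "\<bar>ph\<bar> \<le> C1 * C2" "\<bar>d\<bar> \<le> L" "norm x \<le> CC" "norm F \<le> L" for t c ph d :: real and x F :: 'a
  proof -
    have "\<bar>t * \<bar>c\<bar>\<bar> \<le> CC * (2 * M)" unfolding abs_mult using that CC0 by (intro mult_mono) auto
    moreover have "\<bar>sgn c * d\<bar> \<le> L" using that(4) L(1) by (simp add: sgn_real_def)
    then have "\<bar>ph * (sgn c * d)\<bar> \<le> C1 * C2 * L" unfolding abs_mult[of ph] using that C1(1) C2(1) by (intro mult_mono) auto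
    moreover have "\<bar>x \<bullet> F\<bar> \<le> CC * L" using that CC0 by (intro order.trans[OF Cauchy_Schwarz_ineq2] mult_mono) auto
    ultimately show ?thesis by linarith
  qed
  have pe: "\<bar>\<psi> p / e\<bar> \<le> C1 / e" "\<bar>- \<psi> p / e\<bar> \<le> C1 / e" for p
    using C1(2)[of p] e by (auto simp: abs_divide divide_right_mono)
  have C1e: "0 \<le> C1 / e" using C1(1) e by simp
  have t1: "\<bar>T1 q p\<bar> \<le> CC" for q p
  proof -
    have "\<bar>b q p * T p\<bar> \<le> C2 * C1" unfolding abs_mult b_def by (rule mult_mono[OF C2(2) C1(4) C2(1)]) simp
    moreover have "\<bar>\<psi> p / e * bumpt ((p - q) /\<^sub>R e)\<bar> \<le> C1 / e * C2"
      unfolding abs_mult by (rule mult_mono[OF pe(1) C2(4) C1e]) simp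
    ultimately show ?thesis unfolding T1_def CC_def by linarith
  qed
  have x1: "norm (X1 q p) \<le> CC" for q p
  proof -
    have "norm (b q p *\<^sub>R X p) \<le> C2 * C1" unfolding norm_scaleR b_def by (rule mult_mono[OF C2(2) C1(3) C2(1)]) simp
    moreover have "norm ((\<psi> p / e) *\<^sub>R bumpx ((p - q) /\<^sub>R e)) \<le> C1 / e * C2"
      unfolding norm_scaleR by (rule mult_mono[OF pe(1) C2(3) C1e]) simp
    ultimately show ?thesis unfolding X1_def CC_def by (rule order.trans[OF norm_triangle_ineq add_mono])
  qed
  have CC_ge: "C1 / e * C2 \<le> CC" using C1(1) C2(1) by (simp add: CC_def)
  have t2: "\<bar>T2 p q\<bar> \<le> CC" for q p
    unfolding T2_def abs_mult by (rule order.trans[OF mult_mono[OF pe(2) C2(4) C1e] CC_ge]) simp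
  have x2: "norm (X2 p q) \<le> CC" for q p
    unfolding X2_def norm_scaleR by (rule order.trans[OF mult_mono[OF pe(2) C2(3) C1e] CC_ge]) simp
  have ph: "\<bar>\<psi> p * b q p\<bar> \<le> C1 * C2" for q p
    unfolding abs_mult b_def by (rule mult_mono[OF C1(2) C2(2) C1(1)]) simp
  have uv: "\<bar>U p - V q\<bar> \<le> 2 * M" "\<bar>V q - U p\<bar> \<le> 2 * M" for p q
    using UM[of p] VM[of q] by auto
  have inS: "norm (fst q) \<le> \<bar>R0\<bar> + 1" "norm (fst p) \<le> \<bar>R0\<bar> + 1" if "(q, p) \<in> S" for q p
    using that norm_fst_le_norm[of q] norm_fst_le_norm[of p] by (auto simp: S_def)
  have int1: "integrable lborel (\<lambda>z. I1 (fst z) (snd z))"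
  proof (rule integrable_lborel_bounded_compact[OF meas(1) S])
    fix z assume "z \<in> S"
    then have z: "(fst z, snd z) \<in> S" by simp
    show "norm (I1 (fst z) (snd z)) \<le> CC * (2 * M) + C1 * C2 * L + CC * L"
      unfolding I1_def real_norm_def by (intro bd_gen t1 uv ph L inS[OF z] UM VM x1)
  next
    fix z assume "z \<notin> S"
    then show "I1 (fst z) (snd z) = 0" by (intro zero) simp
  qed
  have int2: "integrable lborel (\<lambda>z. I2 (fst z) (snd z))"
  proof (rule integrable_lborel_bounded_compact[OF meas(2) S])
    fix z assume "z \<in> S"
    then have z: "(fst z, snd z) \<in> S" by simp
    show "norm (I2 (fst z) (snd z)) \<le> CC * (2 * M) + C1 * C2 * L + CC * L"
      unfolding I2_def real_norm_def by (intro bd_gen t2 uv ph L inS[OF z] UM VM x2)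
  next
    fix z assume "z \<notin> S"
    then show "I2 (fst z) (snd z) = 0" by (intro zero) simp
  qed
  have i1: "integrable (lborel \<Otimes>\<^sub>M lborel) (case_prod I1)" and i2: "integrable (lborel \<Otimes>\<^sub>M lborel) (case_prod I2)"
    using int1 int2 unfolding lborel_prod by (simp_all add: case_prod_unfold)
  have Ksub: "K \<subseteq> UNIV \<times> {0<..}" using K e by force
  have k1: "0 \<le> (\<integral>p. I1 q p \<partial>lborel)" for q
  proof -
    have "\<forall>p. 0 \<le> \<psi> p * bump ((p - q) /\<^sub>R e)" using pos bump_nonneg by (intro allI mult_nonneg_nonneg)
    from kU[unfolded kruzhkov_def, rule_format, OF C1c_times_bump[OF \<psi>, of e q] Ksub, of "V q"] this e
    show ?thesis unfolding I1_def T1_def X1_def b_def by simp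
  qed
  have k2: "0 \<le> (\<integral>q. I2 q p \<partial>lborel)" for p
  proof (cases "p \<in> K")
    case True
    have sub: "cball p e \<subseteq> UNIV \<times> {0<..}"
    proof
      fix q assume "q \<in> cball p e"
      then have "norm (p - q) \<le> e" by (simp add: dist_norm)
      then have "norm (snd (p - q)) \<le> e" using norm_snd_le_norm[of "p - q"] by linarith
      then have "0 < snd q" using K[OF True] by simp
      then show "q \<in> UNIV \<times> {0<..}" by (cases q) auto
    qed
    have "\<forall>q. 0 \<le> \<psi> p * bump ((p - q) /\<^sub>R e)" using pos bump_nonneg by (intro allI mult_nonneg_nonneg)
    from kV[unfolded kruzhkov_def, rule_format, OF C1c_bump_reflect[OF e(1) pos, of p p] sub, of "U p"] this
    show ?thesis unfolding I2_def T2_def X2_def b_def by simp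
  next
    \<comment> \<open>Outside \<open>K\<close> the ball around \<open>p\<close> may leave the
      half-space, but there the factor \<open>\<psi> p\<close> removes the integrand.\<close>
    case False
    then have "I2 q p = 0" for q by (simp add: I2_def T2_def X2_def C1cD[OF \<psi>])
    then show ?thesis by simp
  qed
  have sum: "I1 q p + I2 q p = doubled U V \<psi> X T e q p" for q p
  proof -
    have s: "sgn (V q - U p) = - sgn (U p - V q)" using sgn_minus[of "U p - V q"] by simp
    show ?thesis
      unfolding I1_def I2_def T1_def T2_def X1_def X2_def b_def doubled_def kflux_sym[of "fst q" "V q"] s abs_minus_commute[of "V q"]
      by (simp add: algebra_simps inner_add_left inner_diff_left inner_commute[of "bumpx _"] add_divide_distrib diff_divide_distrib inner_diff_right)
  qed
  have "0 \<le> (\<integral>q. (\<integral>p. I1 q p \<partial>lborel) \<partial>lborel) + (\<integral>p. (\<integral>q. I2 q p \<partial>lborel) \<partial>lborel)"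
    by (intro add_nonneg_nonneg integral_nonneg_AE AE_I2 k1 k2)
  also have "\<dots> = (\<integral>z. I1 (fst z) (snd z) \<partial>lborel) + (\<integral>z. I2 (fst z) (snd z) \<partial>lborel)"
    using lborel_pair.integral_fst[OF i1] lborel_pair.integral_snd[OF i2] unfolding lborel_prod by (simp add: case_prod_unfold)
  also have "\<dots> = (\<integral>z. doubled U V \<psi> X T e (fst z) (snd z) \<partial>lborel)"
    by (subst Bochner_Integration.integral_add[OF int1 int2, symmetric]) (simp add: sum)
  also have "\<dots> = (\<integral>q. (\<integral>p. doubled U V \<psi> X T e q p \<partial>lborel) \<partial>lborel)"
  proof -
    have "integrable (lborel \<Otimes>\<^sub>M lborel) (case_prod (doubled U V \<psi> X T e))"
      using Bochner_Integration.integrable_add[OF int1 int2] unfolding lborel_prod by (simp add: case_prod_unfold sum)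
    from lborel_pair.integral_fst[OF this] show ?thesis unfolding lborel_prod by (simp add: case_prod_unfold)
  qed
  also have "\<dots> = (\<integral>q. e ^ DIM('a \<times> real) * (\<integral>w. doubled U V \<psi> X T e q (q + e *\<^sub>R w) \<partial>lborel) \<partial>lborel)"
  proof (intro Bochner_Integration.integral_cong refl)
    fix q :: "'a \<times> real"
    have "(\<lambda>p. doubled U V \<psi> X T e q p) \<in> borel_measurable borel"
      by (intro doubled_measurable[OF \<psi>]) measurable
    from integral_lborel_affine[OF this, of e q] e
    show "(\<integral>p. doubled U V \<psi> X T e q p \<partial>lborel) = e ^ DIM('a \<times> real) * (\<integral>w. doubled U V \<psi> X T e q (q + e *\<^sub>R w) \<partial>lborel)"
      by simp
  qed
  also have "\<dots> = e ^ DIM('a \<times> real) * (\<integral>q. (\<integral>w. doubled U V \<psi> X T e q (q + e *\<^sub>R w) \<partial>lborel) \<partial>lborel)"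
    by simp
  also have "(\<integral>q. (\<integral>w. doubled U V \<psi> X T e q (q + e *\<^sub>R w) \<partial>lborel) \<partial>lborel) = (\<integral>z. doubled U V \<psi> X T e (fst z) (fst z + e *\<^sub>R snd z) \<partial>lborel)"
  proof -
    obtain C R where C: "\<And>e q w. 0 < e \<Longrightarrow> e \<le> 1 \<Longrightarrow> \<bar>doubled U V \<psi> X T e q (q + e *\<^sub>R w)\<bar> \<le> C"
      and out: "\<And>e q w. 0 < e \<Longrightarrow> e \<le> 1 \<Longrightarrow> (q, w) \<notin> cball 0 R \<times> cball 0 1 \<Longrightarrow>
        bump w = 0 \<and> bumpx w = 0 \<or> \<psi> (q + e *\<^sub>R w) = 0 \<and> X (q + e *\<^sub>R w) = 0 \<and> T (q + e *\<^sub>R w) = 0"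
      using doubled_bound[where U = U and V = V, OF \<psi> UM VM] by metis
    have "integrable lborel (\<lambda>z. doubled U V \<psi> X T e (fst z) (fst z + e *\<^sub>R snd z))"
    proof (rule integrable_lborel_bounded_compact)
      show "compact (cball 0 R \<times> cball 0 1 :: (('a \<times> real) \<times> ('a \<times> real)) set)" by (intro compact_Times compact_cball)
      show "(\<lambda>z. doubled U V \<psi> X T e (fst z) (fst z + e *\<^sub>R snd z)) \<in> borel_measurable borel"
        by (intro doubled_measurable[OF \<psi>]) measurable
      show "norm (doubled U V \<psi> X T e (fst z) (fst z + e *\<^sub>R snd z)) \<le> C" for z using C[OF e] by simp
      fix z assume "z \<notin> (cball 0 R \<times> cball 0 1 :: (('a \<times> real) \<times> ('a \<times> real)) set)"
      then have "(fst z, snd z) \<notin> cball 0 R \<times> cball 0 1" by simp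
      from out[OF e this] show "doubled U V \<psi> X T e (fst z) (fst z + e *\<^sub>R snd z) = 0"
        using e by (auto simp: doubled_def)
    qed
    then have "integrable (lborel \<Otimes>\<^sub>M lborel) (case_prod (\<lambda>q w. doubled U V \<psi> X T e q (q + e *\<^sub>R w)))"
      unfolding lborel_prod by (simp add: case_prod_unfold)
    from lborel_pair.integral_fst[OF this] show ?thesis unfolding lborel_prod by (simp add: case_prod_unfold)
  qed
  finally have "0 \<le> e ^ DIM('a \<times> real) * (\<integral>z. doubled U V \<psi> X T e (fst z) (fst z + e *\<^sub>R snd z) \<partial>lborel)" .
  moreover have "0 < e ^ DIM('a \<times> real)" using e by (intro zero_less_power)
  ultimately show ?thesis
    using mult_pos_neg not_le by blast
qed

end

subsection \<open>The diagonal limit\<close>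

text \<open>By translation invariance the difference quotients of \<open>g\<close> have integral 0.
  They are dominated because \<open>g\<close> is Lipschitz with compact support, so the directional
  derivative inherits the value.\<close>

lemma C1c_integral_gradient:
  assumes C: "C1c g X T K"
  shows "(\<integral>p. X p \<bullet> d \<partial>lborel) = 0"
proof -
  define v where "v = (d, 0::real)"
  obtain R where R: "\<And>p. p \<in> K \<Longrightarrow> norm p \<le> R"
    using C1cD(1)[OF C] compact_imp_bounded bounded_iff by metis
  define S where "S = cball (0::'a \<times> real) (\<bar>R\<bar> + norm v)"
  have S: "compact S" unfolding S_def by (rule compact_cball)
  obtain L where L: "L-lipschitz_on UNIV g"
    using C1c_Lip_c[OF C subset_UNIV] by (auto simp: Lip_c_def)
  have L0: "0 \<le> L" using L by (rule lipschitz_on_nonneg)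
  note [measurable] = C1c_measurable(1-3)[OF C]
  define h where "h n = 1 / real (Suc n)" for n
  have h: "h \<longlonglongrightarrow> 0" "\<And>n. h n \<noteq> 0" "\<And>n. 0 < h n" "\<And>n. h n \<le> 1"
    unfolding h_def using LIMSEQ_Suc[OF lim_inverse_n'] by auto
  have gint: "integrable lborel g"
  proof -
    obtain c where "\<And>p. \<bar>g p\<bar> \<le> c" using C1c_bound[OF C] by metis
    then show ?thesis
      by (intro integrable_lborel_bounded_compact[OF _ C1cD(1)[OF C], of g c]) (auto simp: C1cD(3)[OF C])
  qed
  have zero: "g (p + h n *\<^sub>R v) - g p = 0" if "p \<notin> S" for n p
  proof -
    have hv: "norm (h n *\<^sub>R v) \<le> norm v" using h(3,4)[of n] by (simp add: mult_left_le_one_le)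
    have "\<bar>R\<bar> + norm v < norm p" using that by (simp add: S_def)
    moreover have "norm p \<le> norm (p + h n *\<^sub>R v) + norm (h n *\<^sub>R v)"
      using norm_triangle_ineq4[of "p + h n *\<^sub>R v" "h n *\<^sub>R v"] by simp
    ultimately have "\<not> norm p \<le> R" "\<not> norm (p + h n *\<^sub>R v) \<le> R" using hv norm_ge_zero[of v] by linarith+
    then have "p \<notin> K" "p + h n *\<^sub>R v \<notin> K" using R by blast+
    then show ?thesis by (simp add: C1cD(3)[OF C])
  qed
  have "(\<lambda>n. \<integral>p. (g (p + h n *\<^sub>R v) - g p) / h n \<partial>lborel) \<longlonglongrightarrow> (\<integral>p. X p \<bullet> d \<partial>lborel)"
  proof (rule integral_dominated_convergence)
    show "integrable lborel (\<lambda>p. L * norm v * indicator S p)"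
      using S by (intro integrable_mult_right integrable_real_indicator) (auto intro: emeasure_lborel_compact_finite borel_compact)
    show "(\<lambda>p. (g (p + h n *\<^sub>R v) - g p) / h n) \<in> borel_measurable lborel" for n by measurable
    show "AE p in lborel. norm ((g (p + h n *\<^sub>R v) - g p) / h n) \<le> L * norm v * indicator S p" for n
    proof (rule AE_I2)
      fix p
      have "\<bar>g (p + h n *\<^sub>R v) - g p\<bar> \<le> L * (h n * norm v)"
        using lipschitz_onD[OF L, of "p + h n *\<^sub>R v" p] h(3)[of n] by (simp add: dist_norm)
      then have "\<bar>g (p + h n *\<^sub>R v) - g p\<bar> / h n \<le> L * norm v" using h(3)[of n] by (simp add: divide_le_eq mult.commute mult.left_commute)
      then show "norm ((g (p + h n *\<^sub>R v) - g p) / h n) \<le> L * norm v * indicator S p"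
        using zero[of p n] h(3)[of n] by (cases "p \<in> S") auto
    qed
    show "AE p in lborel. (\<lambda>n. (g (p + h n *\<^sub>R v) - g p) / h n) \<longlonglongrightarrow> X p \<bullet> d"
    proof (rule AE_I2)
      fix p
      have "((\<lambda>s. p + s *\<^sub>R v) has_derivative (\<lambda>s. s *\<^sub>R v)) (at 0)"
        by (auto intro!: derivative_eq_intros)
      then have "((\<lambda>s. g (p + s *\<^sub>R v)) has_derivative (\<lambda>s. X p \<bullet> fst (s *\<^sub>R v) + T p * snd (s *\<^sub>R v))) (at 0)"
        by (rule has_derivative_compose[where g = g]) (use C1cD(2)[OF C] in simp)
      then have "((\<lambda>s. g (p + s *\<^sub>R v)) has_vector_derivative X p \<bullet> d) (at 0)"
        by (simp add: has_vector_derivative_def v_def)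
      from has_vector_derivative_LIMSEQ[OF this h(1,2)] show "(\<lambda>n. (g (p + h n *\<^sub>R v) - g p) / h n) \<longlonglongrightarrow> X p \<bullet> d"
        by (simp add: divide_inverse mult.commute)
    qed
  qed measurable
  moreover have "(\<integral>p. (g (p + h n *\<^sub>R v) - g p) / h n \<partial>lborel) = 0" for n
  proof -
    have tr: "(\<integral>p. g p \<partial>lborel) = (\<integral>p. g (p + h n *\<^sub>R v) \<partial>lborel)"
      using integral_lborel_affine[of g 1 "h n *\<^sub>R v"] by (simp add: add.commute)
    have "integrable lborel (\<lambda>p. g (p + h n *\<^sub>R v))"
    proof -
      have "integrable (distr lborel borel ((+) (h n *\<^sub>R v))) g" using gint by (simp only: lborel_distr_plus)
      then show ?thesis by (subst (asm) integrable_distr_eq) (simp_all add: add.commute)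
    qed
    then show ?thesis using gint tr by simp
  qed
  ultimately have "(\<lambda>n. 0) \<longlonglongrightarrow> (\<integral>p. X p \<bullet> d \<partial>lborel)" by (simp only:)
  then show ?thesis using LIMSEQ_unique tendsto_const by blast
qed

text \<open>Integration by parts: the gradient of the compactly supported function
  \<open>(fst w \<bullet> b) * bump w\<close>, paired with \<open>d\<close>, has integral 0. With
  \<open>d\<close> the derivative of \<open>f\<close> in direction \<open>b\<close>, summation over
  \<open>b\<close> turns the right-hand side into minus a divergence, which is the cancellation
  sought on the diagonal.\<close>

lemma bump_moment:
  fixes b d :: "'a::euclidean_space"
  assumes b: "b \<in> Basis"
  shows "(\<integral>w. (fst w \<bullet> b) * (bumpx w \<bullet> d) \<partial>(lborel :: ('a \<times> real) measure)) = - (d \<bullet> b) * (\<integral>w. bump w \<partial>(lborel :: ('a \<times> real) measure))"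
    and "integrable lborel (\<lambda>w::'a::euclidean_space \<times> real. (fst w \<bullet> b) * (bumpx w \<bullet> d))"
    and "integrable lborel (bump :: 'a \<times> real \<Rightarrow> real)"
proof -
  note B = bump_C1c[where 'a = 'a]
  note [measurable] = C1c_measurable(1-3)[OF B]
  have out: "bump w = 0" "bumpx w = 0" "bumpt w = 0" if "w \<notin> cball 0 1" for w :: "'a \<times> real"
    using C1cD(3-5)[OF B that] by auto
  have C: "C1c (\<lambda>w::'a \<times> real. (fst w \<bullet> b) * bump w) (\<lambda>w. bump w *\<^sub>R b + (fst w \<bullet> b) *\<^sub>R bumpx w) (\<lambda>w. (fst w \<bullet> b) * bumpt w) (cball 0 1)"
    unfolding C1c_def
  proof (intro conjI allI impI)
    show "continuous_on UNIV (\<lambda>w::'a \<times> real. bump w *\<^sub>R b + (fst w \<bullet> b) *\<^sub>R bumpx w)" "continuous_on UNIV (\<lambda>w::'a \<times> real. (fst w \<bullet> b) * bumpt w)"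
      by (intro continuous_intros C1c_cont[OF B])+
    fix w :: "'a \<times> real"
    have "((\<lambda>w::'a \<times> real. fst w \<bullet> b) has_derivative (\<lambda>h. fst h \<bullet> b)) (at w)"
      by (auto intro!: derivative_eq_intros)
    from has_derivative_mult[OF this C1cD(2)[OF B]]
    show "((\<lambda>w. (fst w \<bullet> b) * bump w) has_derivative (\<lambda>h. (bump w *\<^sub>R b + (fst w \<bullet> b) *\<^sub>R bumpx w) \<bullet> fst h + (fst w \<bullet> b) * bumpt w * snd h)) (at w)"
      by (rule has_derivative_eq_rhs) (rule ext, simp add: algebra_simps inner_add_left inner_commute)
  qed (simp_all add: out del: mem_cball_0)
  obtain C2 where C2: "0 \<le> C2" "\<And>p::'a \<times> real. \<bar>bump p\<bar> \<le> C2" "\<And>p::'a \<times> real. norm (bumpx p) \<le> C2"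
    using C1c_bound[OF B] by metis
  show i1: "integrable lborel (bump :: 'a \<times> real \<Rightarrow> real)"
    by (rule integrable_lborel_bounded_compact[OF _ compact_cball[of 0 1], of _ C2]) (use C2(2) out(1) in \<open>auto simp del: mem_cball_0\<close>)
  show i2: "integrable lborel (\<lambda>w::'a \<times> real. (fst w \<bullet> b) * (bumpx w \<bullet> d))"
  proof (rule integrable_lborel_bounded_compact[OF _ compact_cball[of 0 1]])
    fix w :: "'a \<times> real" assume "w \<in> cball 0 1"
    then have "norm (fst w) \<le> 1" using norm_fst_le_norm[of w] by simp
    then have "\<bar>fst w \<bullet> b\<bar> \<le> 1" using Basis_le_norm[OF b, of "fst w"] by simp
    moreover have "\<bar>bumpx w \<bullet> d\<bar> \<le> C2 * norm d"
      by (rule order.trans[OF Cauchy_Schwarz_ineq2 mult_right_mono[OF C2(3)]]) simp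
    ultimately show "norm ((fst w \<bullet> b) * (bumpx w \<bullet> d)) \<le> 1 * (C2 * norm d)"
      unfolding real_norm_def abs_mult by (intro mult_mono) auto
  qed (measurable, simp add: out del: mem_cball_0)
  have "0 = (\<integral>w. (bump w *\<^sub>R b + (fst w \<bullet> b) *\<^sub>R bumpx w) \<bullet> d \<partial>(lborel :: ('a \<times> real) measure))"
    using C1c_integral_gradient[OF C, of d] by simp
  also have "\<dots> = (\<integral>w. (b \<bullet> d) * bump w + (fst w \<bullet> b) * (bumpx w \<bullet> d) \<partial>(lborel :: ('a \<times> real) measure))"
    by (simp add: inner_add_left mult.commute)
  also have "\<dots> = (b \<bullet> d) * (\<integral>w. bump w \<partial>(lborel :: ('a \<times> real) measure)) + (\<integral>w. (fst w \<bullet> b) * (bumpx w \<bullet> d) \<partial>(lborel :: ('a \<times> real) measure))"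
    using i1 i2 by simp
  finally show "(\<integral>w. (fst w \<bullet> b) * (bumpx w \<bullet> d) \<partial>(lborel :: ('a \<times> real) measure)) = - (d \<bullet> b) * (\<integral>w. bump w \<partial>(lborel :: ('a \<times> real) measure))"
    by (simp add: inner_commute)
qed

lemma bump_integral_pos: "0 < (\<integral>w. bump w \<partial>(lborel :: ('a::euclidean_space \<times> real) measure))"
proof -
  let ?S = "cball (0::'a \<times> real) (1 / 2)"
  \<comment> \<open>On the ball of radius 1/2 the number \<open>1 - w \<bullet> w\<close> is at
    least 3/4, and the bump is its square.\<close>
  have "9 / 16 * indicator ?S w \<le> bump w" for w :: "'a \<times> real"
  proof (cases "w \<in> ?S")
    case True
    then have "(norm w)\<^sup>2 \<le> (1 / 2)\<^sup>2" by (intro power_mono) auto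
    then have "w \<bullet> w \<le> 1 / 4" unfolding power2_norm_eq_inner by (simp add: power2_eq_square)
    then have "3 / 4 \<le> max 0 (1 - w \<bullet> w)" by simp
    then have "(3 / 4)\<^sup>2 \<le> bump w" unfolding bump_def by (intro power_mono) (assumption, simp)
    then show ?thesis using True by (simp add: power2_eq_square)
  qed (use bump_nonneg in simp)
  then have "(\<integral>w. 9 / 16 * indicator ?S w \<partial>lborel) \<le> (\<integral>w. bump w \<partial>(lborel :: ('a \<times> real) measure))"
    by (intro integral_mono[OF _ bump_moment(3)[OF SOME_Basis]] integrable_mult_right integrable_real_indicator)
       (auto intro: emeasure_lborel_compact_finite)
  moreover have "(\<integral>w. 9 / 16 * indicator ?S w \<partial>lborel) = 9 / 16 * measure lborel ?S" by simp
  moreover have "0 < measure lborel ?S" using content_cball_pos[of "1/2" "0::'a \<times> real"] by simp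
  ultimately show ?thesis by linarith
qed

text \<open>For fixed second component the map is a translation. The shear later recentres a
  remainder term at the shifted point, so that the position in the divergence stays fixed and only
  the state \<open>V\<close> is translated.\<close>

lemma lborel_distr_shear:
  "distr lborel borel (\<lambda>z::'e::euclidean_space \<times> 'e. (fst z + e *\<^sub>R snd z, snd z)) = lborel"
proof (rule measure_eqI)
  fix A :: "('e \<times> 'e) set" assume "A \<in> sets (distr lborel borel (\<lambda>z. (fst z + e *\<^sub>R snd z, snd z)))"
  then have [measurable]: "A \<in> sets borel" by simp
  have "emeasure (distr lborel borel (\<lambda>z::'e \<times> 'e. (fst z + e *\<^sub>R snd z, snd z))) A = (\<integral>\<^sup>+z. indicator A z \<partial>distr lborel borel (\<lambda>z::'e \<times> 'e. (fst z + e *\<^sub>R snd z, snd z)))"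
    by simp
  also have "\<dots> = (\<integral>\<^sup>+z. indicator A (fst z + e *\<^sub>R snd z, snd z) \<partial>lborel)"
    by (subst nn_integral_distr) measurable
  also have "\<dots> = (\<integral>\<^sup>+w. \<integral>\<^sup>+q. indicator A (q + e *\<^sub>R w, w) \<partial>lborel \<partial>lborel)"
    unfolding lborel_prod[symmetric]
    by (subst lborel_pair.nn_integral_snd[symmetric]) (simp_all add: lborel_prod, measurable)
  also have "\<dots> = (\<integral>\<^sup>+w. \<integral>\<^sup>+q. indicator A (q, w) \<partial>lborel \<partial>lborel)"
    by (intro nn_integral_cong nn_integral_lborel_translate[where f = "\<lambda>q. indicator A (q, _)"]) measurable
  also have "\<dots> = (\<integral>\<^sup>+z. indicator A z \<partial>lborel)"
    unfolding lborel_prod[symmetric]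
    by (subst lborel_pair.nn_integral_snd[symmetric]) (simp_all add: lborel_prod)
  finally show "emeasure (distr lborel borel (\<lambda>z::'e \<times> 'e. (fst z + e *\<^sub>R snd z, snd z))) A = emeasure lborel A"
    by simp
qed simp

lemma AE_lborel_fst:
  fixes P :: "'a::euclidean_space \<Rightarrow> bool"
  assumes "AE x in lborel. P x"
  shows "AE z in (lborel :: ('a \<times> 'b::euclidean_space) measure). P (fst z)"
proof -
  obtain N where N: "{x \<in> space lborel. \<not> P x} \<subseteq> N" "emeasure lborel N = 0" "N \<in> sets lborel"
    by (rule AE_E[OF assms])
  have "emeasure (lborel \<Otimes>\<^sub>M lborel) (N \<times> (UNIV :: 'b set)) = emeasure lborel N * emeasure lborel (UNIV :: 'b set)"
    using N(3) by (intro lborel.emeasure_pair_measure_Times) auto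
  then have "N \<times> (UNIV :: 'b set) \<in> null_sets lborel"
    using N(2,3) unfolding lborel_prod[symmetric] by (auto simp: null_sets_def)
  then show ?thesis
    by (rule AE_I') (use N(1) in auto)
qed

text \<open>The jump of \<open>sgn\<close> at 0 is harmless where its factor tends to 0. Fluxes and
  divergences occur as differences between two states, which vanish when the states agree.\<close>

lemma tendsto_sgn_scaleR:
  fixes g :: "nat \<Rightarrow> 'b::real_normed_vector"
  assumes c: "c \<longlonglongrightarrow> (c0::real)" and g: "g \<longlonglongrightarrow> g0" and z: "c0 = k \<Longrightarrow> g0 = 0"
  shows "(\<lambda>n. sgn (c n - k) *\<^sub>R g n) \<longlonglongrightarrow> sgn (c0 - k) *\<^sub>R g0"
proof (cases "c0 = k")
  case False
  have "(\<lambda>n. sgn (c n - k)) \<longlonglongrightarrow> sgn (c0 - k)"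
    by (intro tendsto_sgn tendsto_intros c) (use False in simp)
  then show ?thesis by (intro tendsto_scaleR g)
next
  case True
  have "(\<lambda>n. norm (g n)) \<longlonglongrightarrow> 0" using g z[OF True] tendsto_norm_zero by auto
  then have "(\<lambda>n. sgn (c n - k) *\<^sub>R g n) \<longlonglongrightarrow> 0"
    by (rule Lim_null_comparison[rotated]) (auto simp: sgn_real_def)
  then show ?thesis using z[OF True] by simp
qed

section \<open>Pointwise limits on the diagonal\<close>

context flux begin

lemma f_tendsto: "x \<longlonglongrightarrow> x0 \<Longrightarrow> c \<longlonglongrightarrow> c0 \<Longrightarrow> (\<lambda>n. f (x n, c n)) \<longlonglongrightarrow> f (x0, c0)"
  using continuous_f by (intro isCont_tendsto_compose[of _ f] tendsto_Pair) (auto simp: continuous_on_eq_continuous_at)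

lemma flux_div_tendsto: "c \<longlonglongrightarrow> c0 \<Longrightarrow> (\<lambda>n. flux_div x (c n)) \<longlonglongrightarrow> flux_div x c0"
  using flux_div_cont by (intro isCont_tendsto_compose[of _ "flux_div x"]) (auto simp: continuous_on_eq_continuous_at)

lemma D_tendsto: "c \<longlonglongrightarrow> c0 \<Longrightarrow> (\<lambda>n. D x (c n) b) \<longlonglongrightarrow> D x c0 b"
  using D_cont by (intro isCont_tendsto_compose[of _ "\<lambda>k. D x k b"]) (auto simp: continuous_on_eq_continuous_at)

lemma kflux_tendsto:
  assumes "x \<longlonglongrightarrow> x0" "c \<longlonglongrightarrow> c0"
  shows "(\<lambda>n. kflux (x n) (c n) k) \<longlonglongrightarrow> kflux x0 c0 k"
  unfolding kflux_def by (intro tendsto_sgn_scaleR tendsto_diff f_tendsto assms tendsto_const) simp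

text \<open>The state moves along with the step. All states lie in one compact interval, on which
  the expansion of \<open>f\<close> in \<open>x\<close> is uniform, and the resulting linear term
  follows the state by continuity of \<open>D\<close>.\<close>

lemma difference_quotient_tendsto:
  assumes x: "x \<notin> B" and c: "c \<longlonglongrightarrow> c0" and e: "e \<longlonglongrightarrow> 0" "\<And>n. 0 < e n"
  shows "(\<lambda>n. (f (x + e n *\<^sub>R z, c n) - f (x, c n)) /\<^sub>R e n) \<longlonglongrightarrow> (\<Sum>b\<in>Basis. (z \<bullet> b) *\<^sub>R D x c0 b)"
proof -
  let ?S = "\<lambda>k. \<Sum>b\<in>Basis. (z \<bullet> b) *\<^sub>R D x k b"
  have 1: "(\<lambda>n. ?S (c n)) \<longlonglongrightarrow> ?S c0" by (intro tendsto_intros D_tendsto c)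
  obtain A where A: "\<And>n. \<bar>c n\<bar> \<le> A"
    using convergent_imp_Bseq[OF convergentI[OF c]] by (auto simp: Bseq_def)
  have "(\<lambda>n. (f (x + e n *\<^sub>R z, c n) - f (x, c n)) /\<^sub>R e n - ?S (c n)) \<longlonglongrightarrow> 0"
  proof (rule tendstoI)
    fix r :: real assume r: "0 < r"
    \<comment> \<open>This gives r' * norm z < r; the summand 1 covers z = 0.\<close>
    define r' where "r' = r / (norm z + 1)"
    have r': "0 < r'" using r norm_ge_zero[of z] by (auto simp: r'_def intro!: divide_pos_pos add_nonneg_pos)
    obtain d where "d > 0" and d: "\<And>y k. norm (y - x) < d \<Longrightarrow> k \<in> {-A..A} \<Longrightarrow>
       norm (f (y, k) - f (x, k) - (\<Sum>b\<in>Basis. ((y - x) \<bullet> b) *\<^sub>R D x k b)) \<le> r' * norm (y - x)"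
      using D_unif[OF x compact_Icc r', of "-A" A] by metis
    have "(\<lambda>n. norm (e n *\<^sub>R z)) \<longlonglongrightarrow> norm (0 *\<^sub>R z)" by (intro tendsto_intros e)
    then have "\<forall>\<^sub>F n in sequentially. norm (e n *\<^sub>R z) < d" using \<open>d > 0\<close> by (intro order_tendstoD(2)) auto
    then show "\<forall>\<^sub>F n in sequentially. dist ((f (x + e n *\<^sub>R z, c n) - f (x, c n)) /\<^sub>R e n - ?S (c n)) 0 < r"
    proof eventually_elim
      case (elim n)
      have cn: "c n \<in> {-A..A}" using A[of n] by auto
      have S: "(\<Sum>b\<in>Basis. ((e n *\<^sub>R z) \<bullet> b) *\<^sub>R D x (c n) b) = e n *\<^sub>R ?S (c n)" by (simp add: scaleR_sum_right)
      have "norm (f (x + e n *\<^sub>R z, c n) - f (x, c n) - e n *\<^sub>R ?S (c n)) \<le> r' * (e n * norm z)"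
        using d[of "x + e n *\<^sub>R z" "c n"] elim cn S e(2)[of n] by simp
      then have "norm (f (x + e n *\<^sub>R z, c n) - f (x, c n) - e n *\<^sub>R ?S (c n)) / e n \<le> r' * norm z"
        using e(2)[of n] by (simp add: divide_le_eq mult.commute mult.left_commute)
      moreover have "(f (x + e n *\<^sub>R z, c n) - f (x, c n)) /\<^sub>R e n - ?S (c n) = (f (x + e n *\<^sub>R z, c n) - f (x, c n) - e n *\<^sub>R ?S (c n)) /\<^sub>R e n"
        using e(2)[of n] by (simp add: scaleR_diff_right)
      moreover have "norm ((f (x + e n *\<^sub>R z, c n) - f (x, c n) - e n *\<^sub>R ?S (c n)) /\<^sub>R e n) = norm (f (x + e n *\<^sub>R z, c n) - f (x, c n) - e n *\<^sub>R ?S (c n)) / e n"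
        using e(2)[of n] by (simp add: divide_inverse mult.commute)
      moreover have "r' * norm z < r"
      proof -
        have "r' * norm z < r' * (norm z + 1)" using r' by simp
        also have "\<dots> = r" using add_nonneg_pos[OF norm_ge_zero[of z] zero_less_one] by (simp add: r'_def)
        finally show ?thesis .
      qed
      ultimately show ?case by simp
    qed
  qed
  from tendsto_add[OF this 1] show ?thesis by simp
qed

text \<open>The part of \<open>doubled\<close> in which both divergences are taken at
  \<open>fst q\<close>. At a fixed position their continuity in the state is enough for a pointwise
  limit.\<close>

definition doubled_main where
  "doubled_main U V \<psi> X T e q w =
     (\<bar>U (q + e *\<^sub>R w) - V q\<bar> * T (q + e *\<^sub>R w) + X (q + e *\<^sub>R w) \<bullet> kflux (fst (q + e *\<^sub>R w)) (U (q + e *\<^sub>R w)) (V q)) * bump w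
     + \<psi> (q + e *\<^sub>R w) * ((kflux (fst (q + e *\<^sub>R w)) (U (q + e *\<^sub>R w)) (V q) - kflux (fst q) (U (q + e *\<^sub>R w)) (V q)) \<bullet> bumpx w / e
       + sgn (U (q + e *\<^sub>R w) - V q) * (flux_div (fst q) (U (q + e *\<^sub>R w)) - flux_div (fst q) (V q)) * bump w)"

text \<open>This part has no pointwise limit, because \<open>flux_div\<close> is merely measurable in \<open>x\<close>; it tends to \<open>0\<close> in
  \<open>L\<^sup>1\<close> after comparison with translates of \<open>flux_div (fst q) (V q)\<close> and of \<open>V\<close>.\<close>

definition doubled_rem where
  "doubled_rem U V \<psi> e q w = \<psi> (q + e *\<^sub>R w) * bump w * (sgn (U (q + e *\<^sub>R w) - V q) * (flux_div (fst q) (V q) - flux_div (fst (q + e *\<^sub>R w)) (V q)))"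

definition doubled_lim where
  "doubled_lim U V \<psi> X T q w =
     (\<bar>U q - V q\<bar> * T q + X q \<bullet> kflux (fst q) (U q) (V q)) * bump w
     + \<psi> q * ((sgn (U q - V q) *\<^sub>R ((\<Sum>b\<in>Basis. (fst w \<bullet> b) *\<^sub>R D (fst q) (U q) b) - (\<Sum>b\<in>Basis. (fst w \<bullet> b) *\<^sub>R D (fst q) (V q) b))) \<bullet> bumpx w
       + sgn (U q - V q) * (flux_div (fst q) (U q) - flux_div (fst q) (V q)) * bump w)"

lemma doubled_split:
  assumes "e \<noteq> 0"
  shows "doubled U V \<psi> X T e q (q + e *\<^sub>R w) = doubled_main U V \<psi> X T e q w + doubled_rem U V \<psi> e q w"
  using assms by (simp add: doubled_def doubled_main_def doubled_rem_def algebra_simps)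

lemma doubled_main_tendsto:
  assumes \<psi>: "C1c \<psi> X T K" and x: "fst q \<notin> B" and U: "(\<lambda>n. U (q + e n *\<^sub>R w)) \<longlonglongrightarrow> U q"
    and e: "e \<longlonglongrightarrow> 0" "\<And>n. 0 < e n"
  shows "(\<lambda>n. doubled_main U V \<psi> X T (e n) q w) \<longlonglongrightarrow> doubled_lim U V \<psi> X T q w"
proof -
  have p: "(\<lambda>n. q + e n *\<^sub>R w) \<longlonglongrightarrow> q"
    using tendsto_add[OF tendsto_const tendsto_scaleR[OF e(1) tendsto_const], of q w] by simp
  have c: "(\<lambda>n. \<psi> (q + e n *\<^sub>R w)) \<longlonglongrightarrow> \<psi> q" "(\<lambda>n. X (q + e n *\<^sub>R w)) \<longlonglongrightarrow> X q" "(\<lambda>n. T (q + e n *\<^sub>R w)) \<longlonglongrightarrow> T q"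
    by (intro continuous_on_tendsto_compose[OF _ p UNIV_I] C1c_cont[OF \<psi>]; simp)+
  have xp: "(\<lambda>n. fst (q + e n *\<^sub>R w)) \<longlonglongrightarrow> fst q" by (rule tendsto_fst[OF p])
  let ?u = "\<lambda>n. U (q + e n *\<^sub>R w)" and ?v = "V q"
  let ?S = "\<lambda>k. \<Sum>b\<in>Basis. (fst w \<bullet> b) *\<^sub>R D (fst q) k b"
  have F: "(\<lambda>n. kflux (fst (q + e n *\<^sub>R w)) (?u n) ?v) \<longlonglongrightarrow> kflux (fst q) (U q) ?v"
    by (rule kflux_tendsto[OF xp U])
  have dq: "(\<lambda>n. (f (fst q + e n *\<^sub>R fst w, ?u n) - f (fst q, ?u n)) /\<^sub>R e n - (f (fst q + e n *\<^sub>R fst w, ?v) - f (fst q, ?v)) /\<^sub>R e n) \<longlonglongrightarrow> ?S (U q) - ?S ?v"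
    by (intro tendsto_diff difference_quotient_tendsto x U e tendsto_const)
  have "(\<lambda>n. sgn (?u n - ?v) *\<^sub>R ((f (fst q + e n *\<^sub>R fst w, ?u n) - f (fst q, ?u n)) /\<^sub>R e n - (f (fst q + e n *\<^sub>R fst w, ?v) - f (fst q, ?v)) /\<^sub>R e n)) \<longlonglongrightarrow> sgn (U q - ?v) *\<^sub>R (?S (U q) - ?S ?v)"
    by (rule tendsto_sgn_scaleR[OF U dq]) simp
  also have "(\<lambda>n. sgn (?u n - ?v) *\<^sub>R ((f (fst q + e n *\<^sub>R fst w, ?u n) - f (fst q, ?u n)) /\<^sub>R e n - (f (fst q + e n *\<^sub>R fst w, ?v) - f (fst q, ?v)) /\<^sub>R e n)) =
     (\<lambda>n. (kflux (fst (q + e n *\<^sub>R w)) (?u n) ?v - kflux (fst q) (?u n) ?v) /\<^sub>R e n)"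
    by (rule ext) (simp add: kflux_def scaleR_diff_right algebra_simps)
  finally have G: "(\<lambda>n. (kflux (fst (q + e n *\<^sub>R w)) (?u n) ?v - kflux (fst q) (?u n) ?v) /\<^sub>R e n) \<longlonglongrightarrow> sgn (U q - ?v) *\<^sub>R (?S (U q) - ?S ?v)" .
  have "(\<lambda>n. ((kflux (fst (q + e n *\<^sub>R w)) (?u n) ?v - kflux (fst q) (?u n) ?v) /\<^sub>R e n) \<bullet> bumpx w) \<longlonglongrightarrow> (sgn (U q - ?v) *\<^sub>R (?S (U q) - ?S ?v)) \<bullet> bumpx w"
    by (intro tendsto_intros G)
  then have G': "(\<lambda>n. (kflux (fst (q + e n *\<^sub>R w)) (?u n) ?v - kflux (fst q) (?u n) ?v) \<bullet> bumpx w / e n) \<longlonglongrightarrow> (sgn (U q - ?v) *\<^sub>R (?S (U q) - ?S ?v)) \<bullet> bumpx w"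
    by (simp add: divide_inverse mult.commute)
  have H: "(\<lambda>n. sgn (?u n - ?v) * (flux_div (fst q) (?u n) - flux_div (fst q) ?v)) \<longlonglongrightarrow> sgn (U q - ?v) * (flux_div (fst q) (U q) - flux_div (fst q) ?v)"
    using tendsto_sgn_scaleR[OF U, of "\<lambda>n. flux_div (fst q) (?u n) - flux_div (fst q) ?v" "flux_div (fst q) (U q) - flux_div (fst q) ?v" ?v]
      tendsto_diff[OF flux_div_tendsto[OF U] tendsto_const] by simp
  show ?thesis unfolding doubled_main_def doubled_lim_def
    by (intro tendsto_add tendsto_mult tendsto_inner tendsto_rabs tendsto_diff U c F G' H tendsto_const)
qed

lemma doubled_lim_measurable:
  assumes \<psi>: "C1c \<psi> X T K" and [measurable]: "U \<in> borel_measurable borel" "V \<in> borel_measurable borel"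
  shows "(\<lambda>z. doubled_lim U V \<psi> X T (fst z) (snd z)) \<in> borel_measurable borel"
    "(\<lambda>z. doubled_main U V \<psi> X T e (fst z) (snd z)) \<in> borel_measurable borel"
    "(\<lambda>z. doubled_rem U V \<psi> e (fst z) (snd z)) \<in> borel_measurable borel"
proof -
  note [measurable] = C1c_measurable(1-3)[OF \<psi>] C1c_measurable(1-3)[OF bump_C1c]
  show "(\<lambda>z. doubled_lim U V \<psi> X T (fst z) (snd z)) \<in> borel_measurable borel"
    unfolding doubled_lim_def by measurable
  show "(\<lambda>z. doubled_main U V \<psi> X T e (fst z) (snd z)) \<in> borel_measurable borel"
    unfolding doubled_main_def by measurable
  show "(\<lambda>z. doubled_rem U V \<psi> e (fst z) (snd z)) \<in> borel_measurable borel"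
    unfolding doubled_rem_def by measurable
qed

text \<open>The difference quotients have become linear in \<open>w\<close>, so
  \<open>bump_moment\<close> turns their pairing with the gradient of the bump into minus the
  difference of divergences. All terms with the factor \<open>\<psi> q\<close> cancel, and no
  derivative of \<open>f\<close> survives.\<close>

lemma doubled_lim_integral_w:
  "(\<integral>w. doubled_lim U V \<psi> X T q w \<partial>lborel) =
    (\<bar>U q - V q\<bar> * T q + X q \<bullet> kflux (fst q) (U q) (V q)) * (\<integral>w. bump w \<partial>(lborel :: ('a \<times> real) measure))"
proof -
  define \<kappa> where "\<kappa> = (\<integral>w. bump w \<partial>(lborel :: ('a \<times> real) measure))"
  define A where "A = \<bar>U q - V q\<bar> * T q + X q \<bullet> kflux (fst q) (U q) (V q)"
  define s where "s = \<psi> q * sgn (U q - V q)"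
  define d where "d b = D (fst q) (U q) b - D (fst q) (V q) b" for b
  have dd: "flux_div (fst q) (U q) - flux_div (fst q) (V q) = (\<Sum>b\<in>Basis. d b \<bullet> b)"
    by (simp add: flux_div_def d_def inner_diff_left sum_subtractf)
  have "doubled_lim U V \<psi> X T q w = A * bump w + s * ((\<Sum>b\<in>Basis. (fst w \<bullet> b) * (bumpx w \<bullet> d b)) + (\<Sum>b\<in>Basis. d b \<bullet> b) * bump w)" for w
  proof -
    have "(\<Sum>b\<in>Basis. (fst w \<bullet> b) *\<^sub>R D (fst q) (U q) b) - (\<Sum>b\<in>Basis. (fst w \<bullet> b) *\<^sub>R D (fst q) (V q) b) = (\<Sum>b\<in>Basis. (fst w \<bullet> b) *\<^sub>R d b)"
      by (simp add: d_def scaleR_diff_right sum_subtractf)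
    moreover have "(\<Sum>b\<in>Basis. (fst w \<bullet> b) *\<^sub>R d b) \<bullet> bumpx w = (\<Sum>b\<in>Basis. (fst w \<bullet> b) * (bumpx w \<bullet> d b))"
      unfolding inner_sum_left by (intro sum.cong refl) (simp add: inner_commute)
    ultimately show ?thesis
      unfolding doubled_lim_def dd A_def s_def by (simp add: algebra_simps)
  qed
  then have "(\<integral>w. doubled_lim U V \<psi> X T q w \<partial>lborel) = (\<integral>w. A * bump w + s * ((\<Sum>b\<in>Basis. (fst w \<bullet> b) * (bumpx w \<bullet> d b)) + (\<Sum>b\<in>Basis. d b \<bullet> b) * bump w) \<partial>lborel)"
    by simp
  also have "\<dots> = A * \<kappa> + s * ((\<Sum>b\<in>Basis. (\<integral>w. (fst w \<bullet> b) * (bumpx w \<bullet> d b) \<partial>lborel)) + (\<Sum>b\<in>Basis. d b \<bullet> b) * \<kappa>)"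
  proof -
    have ib: "integrable lborel (\<lambda>w::'a \<times> real. c * bump w)" for c :: real
      by (intro integrable_mult_right bump_moment(3)[OF SOME_Basis])
    have iS: "integrable lborel (\<lambda>w::'a \<times> real. \<Sum>b\<in>Basis. (fst w \<bullet> b) * (bumpx w \<bullet> d b))"
      by (intro Bochner_Integration.integrable_sum bump_moment(2))
    have iT: "integrable lborel (\<lambda>w::'a \<times> real. s * ((\<Sum>b\<in>Basis. (fst w \<bullet> b) * (bumpx w \<bullet> d b)) + (\<Sum>b\<in>Basis. d b \<bullet> b) * bump w))"
      by (intro integrable_mult_right Bochner_Integration.integrable_add ib iS)
    have "(\<integral>w. (\<Sum>b\<in>Basis. (fst w \<bullet> b) * (bumpx w \<bullet> d b)) \<partial>(lborel :: ('a \<times> real) measure)) = (\<Sum>b\<in>Basis. (\<integral>w. (fst w \<bullet> b) * (bumpx w \<bullet> d b) \<partial>lborel))"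
      by (intro Bochner_Integration.integral_sum bump_moment(2))
    then show ?thesis
      unfolding Bochner_Integration.integral_add[OF ib iT] \<kappa>_def
      by (simp add: Bochner_Integration.integral_add[OF iS ib])
  qed
  also have "(\<Sum>b\<in>Basis. (\<integral>w. (fst w \<bullet> b) * (bumpx w \<bullet> d b) \<partial>lborel)) = (\<Sum>b\<in>Basis. - (d b \<bullet> b) * \<kappa>)"
    unfolding \<kappa>_def by (intro sum.cong refl bump_moment(1))
  also have "\<dots> = - ((\<Sum>b\<in>Basis. d b \<bullet> b) * \<kappa>)" by (simp add: sum_distrib_right sum_negf)
  finally show ?thesis by (simp add: A_def \<kappa>_def)
qed

end

section \<open>Kato's inequality for the difference of two solutions\<close>

context flux begin

text \<open>The main part converges by dominated convergence. In the remainder, with p = q + e w,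
  the divergence at (p, V p) is inserted between those at (q, V q) and (p, V q): one difference is a
  translation of a fixed bounded function, the other changes only the state at the fixed position
  \<open>p\<close>. Both vanish in the limit in the integral norm.\<close>

lemma kato_inequality:
  assumes \<psi>: "C1c \<psi> X T K" and K: "K \<subseteq> UNIV \<times> {0<..}" and pos: "\<And>p. 0 \<le> \<psi> p"
    and U [measurable]: "U \<in> borel_measurable borel" and V [measurable]: "V \<in> borel_measurable borel"
    and UM: "\<And>p. \<bar>U p\<bar> \<le> M" and VM: "\<And>p. \<bar>V p\<bar> \<le> M"
    and kU: "kruzhkov U" and kV: "kruzhkov V"
  shows "0 \<le> (\<integral>p. \<bar>U p - V p\<bar> * T p + X p \<bullet> kflux (fst p) (U p) (V p) \<partial>lborel)"
proof -
  have cK: "compact K" by (rule C1cD(1)[OF \<psi>])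
  obtain a where a: "0 < a" "a \<le> 1" "\<And>p. p \<in> K \<Longrightarrow> a < snd p"
  proof (cases "K = {}")
    case True
    then show thesis using that[of 1] by simp
  next
    case False
    obtain p0 where p0: "p0 \<in> K" "\<And>p. p \<in> K \<Longrightarrow> snd p0 \<le> snd p"
      using continuous_attains_inf[OF cK False continuous_on_snd[OF continuous_on_id]] by metis
    have "0 < snd p0" using K p0(1) by auto
    then show thesis using p0(2) by (intro that[of "min 1 (snd p0 / 2)"]) (auto simp: min_less_iff_disj simp del: split_paired_All dest!: p0(2))
  qed
  obtain C R where C: "\<And>e q w. 0 < e \<Longrightarrow> e \<le> 1 \<Longrightarrow> \<bar>doubled U V \<psi> X T e q (q + e *\<^sub>R w)\<bar> \<le> C"
      and out: "\<And>e q w. 0 < e \<Longrightarrow> e \<le> 1 \<Longrightarrow> (q, w) \<notin> cball 0 R \<times> cball 0 1 \<Longrightarrow>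
        bump w = 0 \<and> bumpx w = 0 \<or> \<psi> (q + e *\<^sub>R w) = 0 \<and> X (q + e *\<^sub>R w) = 0 \<and> T (q + e *\<^sub>R w) = 0"
      and R: "\<And>p. p \<in> K \<Longrightarrow> norm p + 1 \<le> R" "1 \<le> R"
    using doubled_bound[where U = U and V = V, OF \<psi> UM VM] by metis
  obtain L where L: "0 \<le> L" "\<And>x k. norm x \<le> R + 2 \<Longrightarrow> \<bar>k\<bar> \<le> M \<Longrightarrow> \<bar>flux_div x k\<bar> \<le> L"
    using local_bounds[of "R + 2" M] by metis
  obtain C1 where C1: "0 \<le> C1" "\<And>p. \<bar>\<psi> p\<bar> \<le> C1" using C1c_bound[OF \<psi>] by metis
  obtain C2 where C2: "0 \<le> C2" "\<And>p::'a \<times> real. \<bar>bump p\<bar> \<le> C2" using C1c_bound[OF bump_C1c] by metis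
  define S where "S = (cball 0 R \<times> cball 0 1 :: (('a \<times> real) \<times> ('a \<times> real)) set)"
  \<comment> \<open>The shear sends the first component to q + e w, of norm up to R + 1; this set
    contains \<open>S\<close> and its sheared images.\<close>
  define S' where "S' = (cball 0 (R + 1) \<times> cball 0 (R + 1) :: (('a \<times> real) \<times> ('a \<times> real)) set)"
  have SS': "S \<subseteq> S'" using R(2) by (auto simp: S_def S'_def)
  have cS: "compact S" "compact S'" unfolding S_def S'_def by (intro compact_Times compact_cball)+
  have [measurable]: "S \<in> sets borel" "S' \<in> sets borel" using cS by (auto intro: borel_compact)
  \<comment> \<open>The divergence along \<open>V\<close>, cut off so as to be bounded everywhere.
    The cutoff radius exceeds R + 1, so \<open>h\<close> is the true divergence at all points met
    below.\<close>
  define h where "h q = indicator (cball 0 (R + 2)) (fst q) * flux_div (fst q) (V q)" for q :: "'a \<times> real"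
  have h [measurable]: "h \<in> borel_measurable borel" unfolding h_def[abs_def] by measurable
  have hL: "\<bar>h q\<bar> \<le> L" for q using L VM[of q] by (auto simp: h_def indicator_def)
  \<comment> \<open>All shifts are at most \<open>a\<close>, which lies below every time in
    \<open>K\<close>, so the doubling inequality applies to each of them.\<close>
  define e0 where "e0 n = a / real (Suc n)" for n
  have e0: "e0 \<longlonglongrightarrow> 0"
    unfolding e0_def using tendsto_mult[OF tendsto_const LIMSEQ_Suc[OF lim_inverse_n'], of a] by (simp add: divide_inverse)
  have e0': "0 < e0 n" "e0 n \<le> a" for n using a(1) by (auto simp: e0_def divide_le_eq)
  \<comment> \<open>Three nested subsequences: for \<open>U\<close> with shift e, for
    \<open>V\<close> with shift -e, and for \<open>h\<close> with shift e. The sign for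
    \<open>V\<close> is reversed because its shift is seen from p back to q.\<close>
  obtain r1 where r1: "strict_mono r1"
    "AE z in lborel. z \<in> S' \<longrightarrow> (\<lambda>n. U (fst z + e0 (r1 n) *\<^sub>R snd z)) \<longlonglongrightarrow> U (fst z)"
    by (rule translation_AE_subseq[where h = U and N = "R + 1", OF U UM e0, folded S'_def]) (rule that; assumption)
  have "(\<lambda>n. e0 (r1 n)) \<longlonglongrightarrow> 0" using LIMSEQ_subseq_LIMSEQ[OF e0 r1(1)] by (simp add: o_def)
  then have "(\<lambda>n. - e0 (r1 n)) \<longlonglongrightarrow> 0" using tendsto_minus by fastforce
  note V_seq = translation_AE_subseq[where h = V and N = "R + 1", OF V VM this, folded S'_def]
  obtain r2 where r2: "strict_mono r2"
    "AE z in lborel. z \<in> S' \<longrightarrow> (\<lambda>n. V (fst z + (- e0 (r1 (r2 n))) *\<^sub>R snd z)) \<longlonglongrightarrow> V (fst z)"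
    by (rule V_seq) (rule that; assumption)
  have r12: "strict_mono (r1 \<circ> r2)" using r1(1) r2(1) by (rule strict_mono_o)
  have "(\<lambda>n. e0 (r1 (r2 n))) \<longlonglongrightarrow> 0" using LIMSEQ_subseq_LIMSEQ[OF e0 r12] by (simp add: o_def)
  note h_seq = translation_AE_subseq[where h = h and N = "R + 1", OF h hL this, folded S'_def]
  obtain r3 where r3: "strict_mono r3"
    "AE z in lborel. z \<in> S' \<longrightarrow> (\<lambda>n. h (fst z + e0 (r1 (r2 (r3 n))) *\<^sub>R snd z)) \<longlonglongrightarrow> h (fst z)"
    by (rule h_seq) (rule that; assumption)
  define e where "e n = e0 (r1 (r2 (r3 n)))" for n
  have e: "0 < e n" "e n \<le> a" "e n \<le> 1" "e n \<noteq> 0" for n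
    using e0'[of "r1 (r2 (r3 n))"] a(2) by (auto simp: e_def)
  have r23: "strict_mono (r2 \<circ> r3)" using r2(1) r3(1) by (rule strict_mono_o)
  have r123: "strict_mono (r1 \<circ> (r2 \<circ> r3))" using r1(1) r23 by (rule strict_mono_o)
  have elim: "e \<longlonglongrightarrow> 0" using LIMSEQ_subseq_LIMSEQ[OF e0 r123] by (simp add: o_def e_def[abs_def])
  have aeU: "AE z in lborel. z \<in> S' \<longrightarrow> (\<lambda>n. U (fst z + e n *\<^sub>R snd z)) \<longlonglongrightarrow> U (fst z)"
    using r1(2)
  proof eventually_elim
    case (elim z)
    then show ?case using LIMSEQ_subseq_LIMSEQ[OF _ r23, of "\<lambda>n. U (fst z + e0 (r1 n) *\<^sub>R snd z)"] by (auto simp: o_def e_def)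
  qed
  have aeV: "AE z in lborel. z \<in> S' \<longrightarrow> (\<lambda>n. V (fst z - e n *\<^sub>R snd z)) \<longlonglongrightarrow> V (fst z)"
    using r2(2)
  proof eventually_elim
    case (elim z)
    then show ?case using LIMSEQ_subseq_LIMSEQ[OF _ r3(1), of "\<lambda>n. V (fst z + (- e0 (r1 (r2 n))) *\<^sub>R snd z)"] by (auto simp: o_def e_def)
  qed
  have aeh: "AE z in lborel. z \<in> S' \<longrightarrow> (\<lambda>n. h (fst z + e n *\<^sub>R snd z)) \<longlonglongrightarrow> h (fst z)"
    using r3(2) by (simp add: e_def)
  have aeB: "AE z in (lborel :: (('a \<times> real) \<times> ('a \<times> real)) measure). fst (fst z) \<notin> B"
    by (rule AE_lborel_fst[where P = "\<lambda>p. fst p \<notin> B"], rule AE_lborel_fst[where P = "\<lambda>x. x \<notin> B"], rule AE_not_in[OF B_null])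
  let ?main = "\<lambda>n z. doubled_main U V \<psi> X T (e n) (fst z) (snd z)"
  let ?rem = "\<lambda>n z. doubled_rem U V \<psi> (e n) (fst z) (snd z)"
  let ?lim = "\<lambda>z. doubled_lim U V \<psi> X T (fst z) (snd z)"
  note mm = doubled_lim_measurable[OF \<psi> U V]
  have near: "norm (fst (fst z)) \<le> R" "norm (fst (fst z + e n *\<^sub>R snd z)) \<le> R + 1" "norm (fst z + e n *\<^sub>R snd z) \<le> R + 1" if "z \<in> S" for z n
  proof -
    have z: "norm (fst z) \<le> R" "norm (snd z) \<le> 1" using that by (auto simp: S_def)
    have "norm (e n *\<^sub>R snd z) \<le> 1" using z(2) e(1,3)[of n] by (simp add: mult_le_one)
    then show 1: "norm (fst z + e n *\<^sub>R snd z) \<le> R + 1" using norm_triangle_ineq[of "fst z" "e n *\<^sub>R snd z"] z(1) by linarith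
    show "norm (fst (fst z)) \<le> R" using norm_fst_le_norm[of "fst z"] z(1) by linarith
    show "norm (fst (fst z + e n *\<^sub>R snd z)) \<le> R + 1" using norm_fst_le_norm[of "fst z + e n *\<^sub>R snd z"] 1 by linarith
  qed
  have zero: "?main n z = 0" "?rem n z = 0" if "z \<notin> S" for n z
  proof -
    have "(fst z, snd z) \<notin> cball 0 R \<times> cball 0 1" using that by (simp add: S_def)
    from out[OF e(1,3) this, of n] show "?main n z = 0" "?rem n z = 0"
      by (fastforce simp: doubled_main_def doubled_rem_def)+
  qed
  have rem_le: "\<bar>?rem n z\<bar> \<le> C1 * C2 * \<bar>flux_div (fst (fst z)) (V (fst z)) - flux_div (fst (fst z + e n *\<^sub>R snd z)) (V (fst z))\<bar>" for n z
  proof -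
    have "\<bar>\<psi> (fst z + e n *\<^sub>R snd z) * bump (snd z)\<bar> \<le> C1 * C2"
      unfolding abs_mult by (rule mult_mono[OF C1(2) C2(2) C1(1)]) simp
    moreover have "\<bar>sgn (U (fst z + e n *\<^sub>R snd z) - V (fst z)) * (flux_div (fst (fst z)) (V (fst z)) - flux_div (fst (fst z + e n *\<^sub>R snd z)) (V (fst z)))\<bar>
      \<le> \<bar>flux_div (fst (fst z)) (V (fst z)) - flux_div (fst (fst z + e n *\<^sub>R snd z)) (V (fst z))\<bar>"
      by (simp add: abs_mult sgn_real_def)
    ultimately show ?thesis
      unfolding doubled_rem_def abs_mult[of "\<psi> _ * bump _"] using C1(1) C2(1) by (intro mult_mono) auto
  qed
  have rem_bd: "\<bar>?rem n z\<bar> \<le> C1 * C2 * (2 * L)" if z: "z \<in> S" for n z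
  proof -
    have "\<bar>flux_div (fst (fst z)) (V (fst z)) - flux_div (fst (fst z + e n *\<^sub>R snd z)) (V (fst z))\<bar> \<le> 2 * L"
      using L(2)[of "fst (fst z)" "V (fst z)"] L(2)[of "fst (fst z + e n *\<^sub>R snd z)" "V (fst z)"] near(1)[OF z] near(2)[OF z, of n] VM[of "fst z"] by linarith
    then show ?thesis using C1(1) C2(1) by (intro order.trans[OF rem_le] mult_left_mono) auto
  qed
  have main_bd: "\<bar>?main n z\<bar> \<le> C + C1 * C2 * (2 * L)" if z: "z \<in> S" for n z
    using doubled_split[OF e(4)[of n], of U V \<psi> X T "fst z" "snd z"]
      C[OF e(1)[of n] e(3)[of n], of "fst z" "snd z"] rem_bd[OF z, of n] by linarith
  have indint: "integrable lborel (\<lambda>z. c * indicator A z)" if "compact A" for c :: real and A :: "(('a \<times> real) \<times> ('a \<times> real)) set"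
    using that by (intro integrable_mult_right integrable_real_indicator) (auto intro: emeasure_lborel_compact_finite borel_compact)
  have int_main: "integrable lborel (?main n)" and int_rem: "integrable lborel (?rem n)" for n
  proof -
    show "integrable lborel (?main n)"
    proof (rule integrable_lborel_bounded_compact[OF mm(2) cS(1)])
      show "norm (?main n z) \<le> C + C1 * C2 * (2 * L)" if "z \<in> S" for z
        unfolding real_norm_def by (rule main_bd[OF that])
    qed (rule zero(1))
    show "integrable lborel (?rem n)"
    proof (rule integrable_lborel_bounded_compact[OF mm(3) cS(1)])
      show "norm (?rem n z) \<le> C1 * C2 * (2 * L)" if "z \<in> S" for z
        unfolding real_norm_def by (rule rem_bd[OF that])
    qed (rule zero(2))
  qed
  have dct1: "AE z in lborel. (\<lambda>n. ?main n z) \<longlonglongrightarrow> ?lim z"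
    using aeU aeB
  proof eventually_elim
    case (elim z)
    show ?case
    proof (cases "z \<in> S")
      case True
      then show ?thesis using SS' elim by (intro doubled_main_tendsto[OF \<psi>] \<open>e \<longlonglongrightarrow> 0\<close> e(1)) auto
    next
      case False
      have "?lim z = 0"
      proof (cases "snd z \<in> cball 0 1")
        case True
        then have "\<not> norm (fst z) \<le> R" using False by (cases z) (auto simp: S_def)
        then have "fst z \<notin> K" using R(1)[of "fst z"] by auto
        then show ?thesis by (simp add: doubled_lim_def C1cD[OF \<psi>])
      qed (simp add: doubled_lim_def C1cD[OF bump_C1c] del: mem_cball_0)
      then show ?thesis using False zero by simp
    qed
  qed
  have bd1: "AE z in lborel. norm (?main n z) \<le> (C + C1 * C2 * (2 * L)) * indicator S z" for n
  proof (rule AE_I2)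
    fix z
    show "norm (?main n z) \<le> (C + C1 * C2 * (2 * L)) * indicator S z"
      using main_bd[of z n] zero(1)[of z n] by (cases "z \<in> S") simp_all
  qed
  have m1: "?lim \<in> borel_measurable lborel" "?main n \<in> borel_measurable lborel" for n using mm by auto
  have lim_main: "(\<lambda>n. \<integral>z. ?main n z \<partial>lborel) \<longlonglongrightarrow> (\<integral>z. ?lim z \<partial>lborel)"
    by (rule integral_dominated_convergence[OF m1 indint[OF cS(1)] dct1 bd1])
  have int_lim: "integrable lborel ?lim"
    by (rule integrable_dominated_convergence[OF m1 indint[OF cS(1)] dct1 bd1])
  let ?c = "C1 * C2"
  have c0: "0 \<le> ?c" using C1(1) C2(1) by simp
  \<comment> \<open>\<open>g1\<close> carries the translation of \<open>h\<close>. The first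
    component of \<open>G\<close> stands for the shifted point p, so that \<open>G\<close> has a
    pointwise limit; its value at the sheared point is the second part of the remainder.\<close>
  define g1 where "g1 n z = ?c * (indicator S z * \<bar>h (fst z + e n *\<^sub>R snd z) - h (fst z)\<bar>)" for n z
  define G where "G n z = ?c * (indicator S (fst z - e n *\<^sub>R snd z, snd z) * \<bar>flux_div (fst (fst z)) (V (fst z)) - flux_div (fst (fst z)) (V (fst z - e n *\<^sub>R snd z))\<bar>)" for n z
  have g1m: "g1 n \<in> borel_measurable borel" and Gm [measurable]: "G n \<in> borel_measurable borel" for n
    unfolding g1_def[abs_def] G_def[abs_def] by measurable
  have lim_g1: "(\<lambda>n. \<integral>z. g1 n z \<partial>lborel) \<longlonglongrightarrow> (\<integral>z. 0 \<partial>(lborel :: (('a \<times> real) \<times> ('a \<times> real)) measure))"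
    and int_g1: "\<And>n. integrable lborel (g1 n)"
  proof -
    have b: "norm (g1 n z) \<le> (?c * (2 * L)) * indicator S z" for n z
    proof -
      have "\<bar>h (fst z + e n *\<^sub>R snd z) - h (fst z)\<bar> \<le> 2 * L" using hL[of "fst z + e n *\<^sub>R snd z"] hL[of "fst z"] by linarith
      from mult_left_mono[OF this c0] show ?thesis using c0 C1(1) C2(1) by (simp add: g1_def indicator_def abs_mult)
    qed
    show "integrable lborel (g1 n)" for n
    proof (rule Bochner_Integration.integrable_bound[OF indint[OF cS(1), of "?c * (2 * L)"]])
      show "AE z in lborel. norm (g1 n z) \<le> norm ((?c * (2 * L)) * indicator S z)"
        by (rule AE_I2, rule order.trans[OF b]) (simp only: real_norm_def abs_ge_self)
    qed (use g1m in simp)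
    show "(\<lambda>n. \<integral>z. g1 n z \<partial>lborel) \<longlonglongrightarrow> (\<integral>z. 0 \<partial>(lborel :: (('a \<times> real) \<times> ('a \<times> real)) measure))"
    proof (rule integral_dominated_convergence[OF _ _ indint[OF cS(1), of "?c * (2 * L)"]])
      show "AE z in lborel. (\<lambda>n. g1 n z) \<longlonglongrightarrow> 0"
        using aeh
      proof eventually_elim
        case (elim z)
        show ?case
        proof (cases "z \<in> S")
          case True
          then have "(\<lambda>n. h (fst z + e n *\<^sub>R snd z)) \<longlonglongrightarrow> h (fst z)" using elim SS' by auto
          then have "(\<lambda>n. ?c * (indicator S z * \<bar>h (fst z + e n *\<^sub>R snd z) - h (fst z)\<bar>)) \<longlonglongrightarrow> ?c * (indicator S z * \<bar>h (fst z) - h (fst z)\<bar>)"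
            by (intro tendsto_intros)
          then show ?thesis by (simp add: g1_def)
        qed (simp add: g1_def)
      qed
      show "AE z in lborel. norm (g1 n z) \<le> (?c * (2 * L)) * indicator S z" for n
        by (rule AE_I2, rule b)
    qed (use g1m in simp_all)
  qed
  have lim_G: "(\<lambda>n. \<integral>z. G n z \<partial>lborel) \<longlonglongrightarrow> (\<integral>z. 0 \<partial>(lborel :: (('a \<times> real) \<times> ('a \<times> real)) measure))"
    and int_G: "\<And>n. integrable lborel (G n)"
  proof -
    have inS': "z \<in> S'" "norm (fst (fst z)) \<le> R + 2" if "(fst z - e n *\<^sub>R snd z, snd z) \<in> S" for z n
    proof -
      have w: "norm (snd z) \<le> R + 1" using that R(2) by (auto simp: S_def)
      have p: "norm (fst z) \<le> R + 1" "norm (fst (fst z)) \<le> R + 1" using near(2,3)[OF that, of n] by auto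
      show "z \<in> S'" using w p(1) by (cases z) (auto simp: S'_def)
      show "norm (fst (fst z)) \<le> R + 2" using p(2) by simp
    qed
    have b: "norm (G n z) \<le> (?c * (2 * L)) * indicator S' z" for n z
    proof (cases "(fst z - e n *\<^sub>R snd z, snd z) \<in> S")
      case True
      have "\<bar>flux_div (fst (fst z)) (V (fst z)) - flux_div (fst (fst z)) (V (fst z - e n *\<^sub>R snd z))\<bar> \<le> 2 * L"
        using L(2)[OF inS'(2)[OF True] VM, of "fst z"] L(2)[OF inS'(2)[OF True] VM, of "fst z - e n *\<^sub>R snd z"] by linarith
      from mult_left_mono[OF this c0] show ?thesis using c0 C1(1) C2(1) inS'(1)[OF True] True by (simp add: G_def abs_mult)
    qed (use c0 L(1) in \<open>simp add: G_def\<close>)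
    show "integrable lborel (G n)" for n
    proof (rule Bochner_Integration.integrable_bound[OF indint[OF cS(2), of "?c * (2 * L)"]])
      show "AE z in lborel. norm (G n z) \<le> norm ((?c * (2 * L)) * indicator S' z)"
        by (rule AE_I2, rule order.trans[OF b]) (simp only: real_norm_def abs_ge_self)
    qed (use Gm in simp)
    show "(\<lambda>n. \<integral>z. G n z \<partial>lborel) \<longlonglongrightarrow> (\<integral>z. 0 \<partial>(lborel :: (('a \<times> real) \<times> ('a \<times> real)) measure))"
    proof (rule integral_dominated_convergence[OF _ _ indint[OF cS(2), of "?c * (2 * L)"]])
      show "AE z in lborel. (\<lambda>n. G n z) \<longlonglongrightarrow> 0"
        using aeV
      proof eventually_elim
        case (elim z)
        show ?case
        proof (cases "z \<in> S'")
          case True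
          then have "(\<lambda>n. flux_div (fst (fst z)) (V (fst z - e n *\<^sub>R snd z))) \<longlonglongrightarrow> flux_div (fst (fst z)) (V (fst z))"
            using elim by (intro flux_div_tendsto) auto
          then have "(\<lambda>n. ?c * \<bar>flux_div (fst (fst z)) (V (fst z)) - flux_div (fst (fst z)) (V (fst z - e n *\<^sub>R snd z))\<bar>) \<longlonglongrightarrow> ?c * \<bar>flux_div (fst (fst z)) (V (fst z)) - flux_div (fst (fst z)) (V (fst z))\<bar>"
            by (intro tendsto_intros)
          then have "(\<lambda>n. ?c * \<bar>flux_div (fst (fst z)) (V (fst z)) - flux_div (fst (fst z)) (V (fst z - e n *\<^sub>R snd z))\<bar>) \<longlonglongrightarrow> 0" by simp
          then show ?thesis
            by (rule Lim_null_comparison[rotated]) (use c0 C1(1) C2(1) in \<open>auto simp: G_def indicator_def abs_mult\<close>)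
        next
          case False
          then have "G n z = 0" for n using b[of n z] by simp
          then show ?thesis by simp
        qed
      qed
      show "AE z in lborel. norm (G n z) \<le> (?c * (2 * L)) * indicator S' z" for n
        by (rule AE_I2, rule b)
    qed (use Gm in simp_all)
  qed
  have shear: "(\<integral>z. G n (fst z + e n *\<^sub>R snd z, snd z) \<partial>lborel) = (\<integral>z. G n z \<partial>lborel)"
    and int_G': "integrable lborel (\<lambda>z. G n (fst z + e n *\<^sub>R snd z, snd z))" for n
  proof -
    have "(\<integral>z. G n z \<partial>lborel) = (\<integral>z. G n z \<partial>distr lborel borel (\<lambda>z. (fst z + e n *\<^sub>R snd z, snd z)))"
      by (simp only: lborel_distr_shear)
    also have "\<dots> = (\<integral>z. G n (fst z + e n *\<^sub>R snd z, snd z) \<partial>lborel)"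
      by (rule integral_distr) measurable
    finally show "(\<integral>z. G n (fst z + e n *\<^sub>R snd z, snd z) \<partial>lborel) = (\<integral>z. G n z \<partial>lborel)" ..
    have "integrable (distr lborel borel (\<lambda>z. (fst z + e n *\<^sub>R snd z, snd z))) (G n)"
      using int_G by (simp only: lborel_distr_shear)
    then show "integrable lborel (\<lambda>z. G n (fst z + e n *\<^sub>R snd z, snd z))"
      by (subst (asm) integrable_distr_eq) measurable
  qed
  have rem_le': "norm (?rem n z) \<le> g1 n z + G n (fst z + e n *\<^sub>R snd z, snd z)" for n z
  proof (cases "z \<in> S")
    case True
    let ?p = "fst z + e n *\<^sub>R snd z"
    have hq: "h (fst z) = flux_div (fst (fst z)) (V (fst z))" and hp: "h ?p = flux_div (fst ?p) (V ?p)"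
      using near(1)[OF True] near(2)[OF True, of n] by (auto simp: h_def)
    have "\<bar>flux_div (fst (fst z)) (V (fst z)) - flux_div (fst ?p) (V (fst z))\<bar> \<le> \<bar>h ?p - h (fst z)\<bar> + \<bar>flux_div (fst ?p) (V ?p) - flux_div (fst ?p) (V (fst z))\<bar>"
      unfolding hq hp by linarith
    from mult_left_mono[OF this c0] rem_le[of n z] True show ?thesis
      by (simp add: g1_def G_def distrib_left)
  next
    case False
    then show ?thesis using c0 zero by (simp add: g1_def G_def)
  qed
  have "(\<lambda>n. \<integral>z. ?rem n z \<partial>lborel) \<longlonglongrightarrow> 0"
  proof (rule Lim_null_comparison)
    have "norm (\<integral>z. ?rem n z \<partial>lborel) \<le> (\<integral>z. g1 n z \<partial>lborel) + (\<integral>z. G n z \<partial>lborel)" for n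
    proof -
      have "norm (\<integral>z. ?rem n z \<partial>lborel) \<le> (\<integral>z. norm (?rem n z) \<partial>lborel)" by (rule integral_norm_bound)
      also have "\<dots> \<le> (\<integral>z. g1 n z + G n (fst z + e n *\<^sub>R snd z, snd z) \<partial>lborel)"
        by (intro integral_mono integrable_norm int_rem Bochner_Integration.integrable_add int_g1 int_G' rem_le')
      also have "\<dots> = (\<integral>z. g1 n z \<partial>lborel) + (\<integral>z. G n z \<partial>lborel)"
        by (simp add: Bochner_Integration.integral_add[OF int_g1 int_G'] shear)
      finally show ?thesis .
    qed
    then show "\<forall>\<^sub>F n in sequentially. norm (\<integral>z. ?rem n z \<partial>lborel) \<le> (\<integral>z. g1 n z \<partial>lborel) + (\<integral>z. G n z \<partial>lborel)"
      by (rule always_eventually[OF allI])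
    show "(\<lambda>n. (\<integral>z. g1 n z \<partial>lborel) + (\<integral>z. G n z \<partial>lborel)) \<longlonglongrightarrow> 0"
      using tendsto_add[OF lim_g1 lim_G] by simp
  qed
  from tendsto_add[OF lim_main this]
  have "(\<lambda>n. (\<integral>z. ?main n z \<partial>lborel) + (\<integral>z. ?rem n z \<partial>lborel)) \<longlonglongrightarrow> (\<integral>z. ?lim z \<partial>lborel)" by simp
  moreover have "0 \<le> (\<integral>z. ?main n z \<partial>lborel) + (\<integral>z. ?rem n z \<partial>lborel)" for n
  proof -
    have "e n < snd p" if "p \<in> K" for p using a(3)[OF that] e(2)[of n] by linarith
    from doubling_inequality[OF \<psi> this pos U V UM VM kU kV e(1,3)]
    have "0 \<le> (\<integral>z. ?main n z + ?rem n z \<partial>lborel)" by (simp add: doubled_split[OF e(4)])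
    then show ?thesis by (simp add: Bochner_Integration.integral_add[OF int_main int_rem])
  qed
  ultimately have "0 \<le> (\<integral>z. ?lim z \<partial>lborel)"
    by (intro LIMSEQ_le_const) auto
  also have "\<dots> = (\<integral>q. (\<integral>w. doubled_lim U V \<psi> X T q w \<partial>lborel) \<partial>lborel)"
  proof -
    have "integrable (lborel \<Otimes>\<^sub>M lborel) (case_prod (doubled_lim U V \<psi> X T))"
      using int_lim unfolding lborel_prod by (simp add: case_prod_unfold)
    from lborel_pair.integral_fst[OF this] show ?thesis unfolding lborel_prod by (simp add: case_prod_unfold)
  qed
  also have "\<dots> = (\<integral>q. \<bar>U q - V q\<bar> * T q + X q \<bullet> kflux (fst q) (U q) (V q) \<partial>lborel) * (\<integral>w. bump w \<partial>(lborel :: ('a \<times> real) measure))"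
    unfolding doubled_lim_integral_w by simp
  finally show ?thesis
    using bump_integral_pos[where 'a = 'a] by (simp add: zero_le_mult_iff)
qed

end

subsection \<open>Contraction in the integral norm\<close>

text \<open>The square root is a smooth substitute for the norm of \<open>x\<close>. Where the value
  is positive, it is less than R + N * (T0 - t), a radius that shrinks at speed
  \<open>N\<close>.\<close>

definition cone_arg :: "real \<Rightarrow> real \<Rightarrow> real \<Rightarrow> 'a::euclidean_space \<times> real \<Rightarrow> real" where
  "cone_arg N R T0 p = 1 + N * (T0 - snd p) / R - sqrt (1 + fst p \<bullet> fst p) / R"

definition cone_weight :: "real \<Rightarrow> real \<Rightarrow> real \<Rightarrow> 'a::euclidean_space \<times> real \<Rightarrow> real" where
  "cone_weight N R T0 p = (max 0 (cone_arg N R T0 p))\<^sup>2"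

definition cone_weight_x :: "real \<Rightarrow> real \<Rightarrow> real \<Rightarrow> 'a::euclidean_space \<times> real \<Rightarrow> 'a" where
  "cone_weight_x N R T0 p = (- 2 * max 0 (cone_arg N R T0 p) / (R * sqrt (1 + fst p \<bullet> fst p))) *\<^sub>R fst p"

definition cone_weight_t :: "real \<Rightarrow> real \<Rightarrow> real \<Rightarrow> 'a::euclidean_space \<times> real \<Rightarrow> real" where
  "cone_weight_t N R T0 p = - 2 * max 0 (cone_arg N R T0 p) * N / R"

lemma one_plus_inner_pos: "0 < 1 + x \<bullet> x"
  by (simp add: add_pos_nonneg)

lemma cone_arg_cont: "R \<noteq> 0 \<Longrightarrow> continuous_on UNIV (cone_arg N R T0)"
  unfolding cone_arg_def[abs_def] by (intro continuous_intros) auto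

lemma cone_nonneg: "0 \<le> cone_weight N R T0 p"
  by (simp add: cone_weight_def)

lemma cone_cont:
  assumes "R \<noteq> 0"
  shows "continuous_on UNIV (cone_weight N R T0 :: 'a::euclidean_space \<times> real \<Rightarrow> real)"
    "continuous_on UNIV (cone_weight_x N R T0 :: 'a \<times> real \<Rightarrow> 'a)"
    "continuous_on UNIV (cone_weight_t N R T0 :: 'a \<times> real \<Rightarrow> real)"
proof -
  have m: "continuous_on UNIV (\<lambda>p::'a \<times> real. max 0 (cone_arg N R T0 p))"
    by (intro continuous_on_max continuous_on_const cone_arg_cont assms)
  have q: "continuous_on UNIV (\<lambda>p::'a \<times> real. R * sqrt (1 + fst p \<bullet> fst p))"
    by (intro continuous_intros)
  have q0: "R * sqrt (1 + fst p \<bullet> fst p) \<noteq> 0" for p :: "'a \<times> real"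
    using assms one_plus_inner_pos[of "fst p"] by simp
  show "continuous_on UNIV (cone_weight N R T0 :: 'a \<times> real \<Rightarrow> real)"
    unfolding cone_weight_def[abs_def] by (intro continuous_on_power m)
  show "continuous_on UNIV (cone_weight_x N R T0 :: 'a \<times> real \<Rightarrow> 'a)"
    unfolding cone_weight_x_def[abs_def]
    by (intro continuous_on_scaleR continuous_on_divide continuous_on_mult m q continuous_on_const continuous_on_fst continuous_on_id) (use q0 in blast)
  show "continuous_on UNIV (cone_weight_t N R T0 :: 'a \<times> real \<Rightarrow> real)"
    unfolding cone_weight_t_def[abs_def]
    by (intro continuous_on_divide continuous_on_mult m continuous_on_const) (use assms in blast)
qed

lemma cone_deriv:
  assumes R: "R \<noteq> 0"
  shows "(cone_weight N R T0 has_derivative (\<lambda>h. cone_weight_x N R T0 p \<bullet> fst h + cone_weight_t N R T0 p * snd h)) (at p)"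
proof -
  let ?q = "sqrt (1 + fst p \<bullet> fst p)"
  have "((\<lambda>p. 1 + fst p \<bullet> fst p) has_derivative (\<lambda>h. 2 * (fst p \<bullet> fst h))) (at p)"
    by (auto intro!: derivative_eq_intros simp: inner_commute)
  from has_derivative_real_sqrt[OF one_plus_inner_pos this]
  have "((\<lambda>p. sqrt (1 + fst p \<bullet> fst p)) has_derivative (\<lambda>h. (fst p \<bullet> fst h) / ?q)) (at p)"
    by (rule has_derivative_eq_rhs) (simp add: fun_eq_iff field_simps)
  then have "((\<lambda>p. sqrt (1 + fst p \<bullet> fst p) / R) has_derivative (\<lambda>h. (fst p \<bullet> fst h) / ?q / R)) (at p)"
    by (rule bounded_linear.has_derivative[OF bounded_linear_divide])
  moreover have "((\<lambda>p. (1 + N * T0 / R) + (- N / R) * snd p) has_derivative (\<lambda>h. 0 + (- N / R) * snd h)) (at p)"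
    by (intro has_derivative_add has_derivative_const has_derivative_mult_right has_derivative_snd has_derivative_ident)
  then have "((\<lambda>p. 1 + N * (T0 - snd p) / R) has_derivative (\<lambda>h. - N * snd h / R)) (at p)"
    by (simp add: right_diff_distrib diff_divide_distrib add_diff_eq)
  ultimately have "(cone_arg N R T0 has_derivative (\<lambda>h. - N * snd h / R - (fst p \<bullet> fst h) / ?q / R)) (at p)"
    unfolding cone_arg_def[abs_def] by (intro has_derivative_diff)
  from has_derivative_compose[OF this max0_square_deriv[unfolded has_field_derivative_def]]
  have "(cone_weight N R T0 has_derivative (\<lambda>h. 2 * max 0 (cone_arg N R T0 p) * (- N * snd h / R - (fst p \<bullet> fst h) / ?q / R))) (at p)"
    unfolding cone_weight_def[abs_def] .
  then show ?thesis
    by (rule has_derivative_eq_rhs) (simp add: fun_eq_iff cone_weight_x_def cone_weight_t_def algebra_simps)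
qed

text \<open>At nonnegative times the radius R + N * (T0 - t) is at most R + N * T0, hence at most
  2R. This fixes the ball on which the speed of the flux has to be controlled.\<close>

lemma cone_support:
  assumes R: "0 < R" and N: "0 \<le> N" "N * T0 \<le> R" and t: "0 \<le> snd p" and p: "cone_arg N R T0 p > 0"
  shows "norm (fst p) < 2 * R"
proof -
  have "norm (fst p) \<le> sqrt (1 + fst p \<bullet> fst p)" by (intro real_le_rsqrt) (simp add: power2_norm_eq_inner)
  moreover have "sqrt (1 + fst p \<bullet> fst p) < R + N * (T0 - snd p)"
  proof -
    have "0 < cone_arg N R T0 p * R" using p R by simp
    also have "\<dots> = R + N * (T0 - snd p) - sqrt (1 + fst p \<bullet> fst p)"
      using R by (simp add: cone_arg_def left_diff_distrib distrib_right)
    finally show ?thesis by simp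
  qed
  moreover have "N * (T0 - snd p) \<le> R"
    unfolding right_diff_distrib using N mult_nonneg_nonneg[OF N(1) t] by linarith
  ultimately show ?thesis by linarith
qed

text \<open>The bound tends to 1 as N / R tends to 0, so it loses nothing in the limit of infinite
  radius.\<close>

lemma cone_le:
  assumes R: "0 < R" and N: "0 \<le> N" and t: "0 \<le> snd p"
  shows "cone_weight N R T0 p \<le> (1 + N * \<bar>T0\<bar> / R)\<^sup>2"
proof -
  have "cone_arg N R T0 p \<le> 1 + N * \<bar>T0\<bar> / R"
  proof -
    have "N * (T0 - snd p) \<le> N * \<bar>T0\<bar>" using N t by (intro mult_left_mono) auto
    then have "N * (T0 - snd p) / R \<le> N * \<bar>T0\<bar> / R" using R by (intro divide_right_mono) auto
    moreover have "0 \<le> sqrt (1 + fst p \<bullet> fst p) / R" using R by (intro divide_nonneg_pos) auto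
    ultimately show ?thesis unfolding cone_arg_def by linarith
  qed
  moreover have "0 \<le> 1 + N * \<bar>T0\<bar> / R" using R N by simp
  ultimately show ?thesis unfolding cone_weight_def by (intro power_mono) auto
qed

text \<open>The quotient of the norm of \<open>x\<close> by the square root is at most 1. Multiplied
  by \<open>N\<close>, the right-hand side is exactly minus the time derivative of the
  weight.\<close>

lemma norm_conex_le:
  assumes R: "0 < R"
  shows "norm (cone_weight_x N R T0 p) \<le> 2 * max 0 (cone_arg N R T0 p) / R"
proof -
  let ?q = "sqrt (1 + fst p \<bullet> fst p)" and ?m = "max 0 (cone_arg N R T0 p)"
  have q: "0 < ?q" using one_plus_inner_pos[of "fst p"] by simp
  have "norm (fst p) \<le> ?q" by (intro real_le_rsqrt) (simp add: power2_norm_eq_inner)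
  then have "norm (fst p) / ?q \<le> 1" using q by simp
  have "norm (cone_weight_x N R T0 p) = 2 * ?m / R * (norm (fst p) / ?q)"
    using R q by (simp add: cone_weight_x_def abs_mult)
  also have "\<dots> \<le> 2 * ?m / R * 1"
    using R by (intro mult_left_mono \<open>norm (fst p) / ?q \<le> 1\<close>) auto
  finally show ?thesis by simp
qed

text \<open>A C1 step that rises only within \<open>{0..h}\<close>. The difference of two of its
  translates is a nonnegative cutoff in time with compact support.\<close>

lemma plateau_primitive:
  fixes j :: "real \<Rightarrow> real"
  assumes j: "continuous_on UNIV j" "\<And>s. 0 \<le> j s" "\<And>s. s \<notin> {0..h} \<Longrightarrow> j s = 0" and h: "0 \<le> h"
  obtains A where "\<And>s. (A has_real_derivative j s) (at s)" "\<And>s t. s \<le> t \<Longrightarrow> A s \<le> A t"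
    "\<And>s. s \<le> 0 \<Longrightarrow> A s = A 0" "\<And>s. h \<le> s \<Longrightarrow> A s = A h"
proof -
  obtain A where "\<And>s. (A has_vector_derivative j s) (at s)"
    using einterval_antiderivative[of "-\<infinity>" "\<infinity>" j] j(1) by (auto simp: continuous_on_eq_continuous_at)
  then have A: "(A has_real_derivative j s) (at s)" for s by (simp add: has_real_derivative_iff_has_vector_derivative)
  have mono: "A s \<le> A t" if "s \<le> t" for s t
    using DERIV_nonneg_imp_nondecreasing[OF that, of A] A j(2) by blast
  have l: "A s = A 0" if s: "s \<le> 0" for s
  proof (cases "s = 0")
    case False
    then obtain z where "s < z" "z < 0" "A 0 - A s = (0 - s) * j z"
      using MVT2[of s 0 A j] A s by auto
    then show ?thesis using j(3)[of z] by simp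
  qed simp
  have r: "A s = A h" if s: "h \<le> s" for s
  proof (cases "s = h")
    case False
    then obtain z where "h < z" "z < s" "A s - A h = (s - h) * j z"
      using MVT2[of h s A j] A s by auto
    then show ?thesis using j(3)[of z] by simp
  qed simp
  show thesis by (rule that[OF A mono l r])
qed

section \<open>Monotonicity in time of the weighted integral\<close>

context flux begin

text \<open>Kato's inequality is tested with \<open>g\<close> times the cone weight. The flux is at
  most \<open>N\<close> times the difference of the states, so the spatial term is absorbed by the
  decrease of the weight in time, and only the derivative of \<open>g\<close> remains.\<close>

lemma weighted_time_inequality:
  assumes U [measurable]: "U \<in> borel_measurable borel" and V [measurable]: "V \<in> borel_measurable borel"
    and UM: "\<And>p. \<bar>U p\<bar> \<le> M" and VM: "\<And>p. \<bar>V p\<bar> \<le> M" and kU: "kruzhkov U" and kV: "kruzhkov V"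
    and R: "0 < R" and N: "0 \<le> N" "N * T0 \<le> R"
    and speed: "\<And>x c k. norm x < 2 * R \<Longrightarrow> \<bar>c\<bar> \<le> M \<Longrightarrow> \<bar>k\<bar> \<le> M \<Longrightarrow> norm (kflux x c k) \<le> N * \<bar>c - k\<bar>"
    and g: "\<And>t. (g has_real_derivative g' t) (at t)" "continuous_on UNIV g'" "\<And>t. 0 \<le> g t"
    and ab: "0 < a" "\<And>t. t \<notin> {a..b} \<Longrightarrow> g t = 0 \<and> g' t = 0"
  shows "0 \<le> (\<integral>t. g' t * (\<integral>x. \<bar>U (x, t) - V (x, t)\<bar> * cone_weight N R T0 (x, t) \<partial>lborel) \<partial>lborel)"
    and "integrable lborel (\<lambda>p. \<bar>U p - V p\<bar> * (g' (snd p) * cone_weight N R T0 p))"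
proof -
  define K where "K = cball (0::'a) (2 * R) \<times> {a..b}"
  have cK: "compact K" unfolding K_def by (intro compact_Times compact_cball compact_Icc)
  have R0: "R \<noteq> 0" using R by simp
  have gc: "continuous_on UNIV g" using g(1) DERIV_continuous_on has_field_derivative_at_within by blast
  have out: "cone_weight N R T0 p = 0 \<and> cone_weight_x N R T0 p = 0 \<and> cone_weight_t N R T0 p = 0 \<or> g (snd p) = 0 \<and> g' (snd p) = 0" if "p \<notin> K" for p
  proof (cases "snd p \<in> {a..b}")
    case True
    then have "\<not> norm (fst p) < 2 * R" using that by (cases p) (auto simp: K_def)
    then have "\<not> cone_arg N R T0 p > 0" using cone_support[OF R N, of p] True ab(1) by auto
    then have "max 0 (cone_arg N R T0 p) = 0" by simp
    then show ?thesis by (simp add: cone_weight_def cone_weight_x_def cone_weight_t_def)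
  qed (use ab(2) in blast)
  define \<psi> where "\<psi> p = g (snd p) * cone_weight N R T0 p" for p :: "'a \<times> real"
  define X where "X p = g (snd p) *\<^sub>R cone_weight_x N R T0 p" for p :: "'a \<times> real"
  define T where "T p = g' (snd p) * cone_weight N R T0 p + g (snd p) * cone_weight_t N R T0 p" for p :: "'a \<times> real"
  have \<psi>: "C1c \<psi> X T K"
    unfolding C1c_def
  proof (intro conjI allI impI cK)
    have c: "continuous_on UNIV (\<lambda>p::'a \<times> real. g (snd p))" "continuous_on UNIV (\<lambda>p::'a \<times> real. g' (snd p))"
      by (intro continuous_on_compose2[OF gc] continuous_on_compose2[OF g(2)] continuous_intros; simp)+
    show "continuous_on UNIV X" "continuous_on UNIV T"
      unfolding X_def T_def by (intro continuous_intros c cone_cont R0)+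
    fix p :: "'a \<times> real"
    have "((\<lambda>p::'a \<times> real. snd p) has_derivative snd) (at p)" by (intro derivative_intros)
    from has_derivative_compose[OF this g(1)[unfolded has_field_derivative_def]]
    have "((\<lambda>p::'a \<times> real. g (snd p)) has_derivative (\<lambda>h. g' (snd p) * snd h)) (at p)" .
    from has_derivative_mult[OF this cone_deriv[OF R0]]
    show "(\<psi> has_derivative (\<lambda>h. X p \<bullet> fst h + T p * snd h)) (at p)"
      unfolding \<psi>_def by (rule has_derivative_eq_rhs) (simp add: fun_eq_iff X_def T_def algebra_simps)
    assume "p \<notin> K"
    from out[OF this] show "\<psi> p = 0" "X p = 0" "T p = 0" by (auto simp: \<psi>_def X_def T_def)
  qed
  have pos: "0 \<le> \<psi> p" for p unfolding \<psi>_def by (rule mult_nonneg_nonneg[OF g(3) cone_nonneg])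
  have Ksub: "K \<subseteq> UNIV \<times> {0<..}" using ab(1) by (auto simp: K_def)
  have [measurable]: "(cone_weight N R T0 :: 'a \<times> real \<Rightarrow> real) \<in> borel_measurable borel" "g' \<in> borel_measurable borel"
    using cone_cont(1)[OF R0] g(2) by (auto intro: borel_measurable_continuous_onI)
  have [measurable]: "X \<in> borel_measurable borel" "T \<in> borel_measurable borel" using C1c_measurable[OF \<psi>] by auto
  let ?I = "\<lambda>p. \<bar>U p - V p\<bar> * (g' (snd p) * cone_weight N R T0 p)"
  let ?J = "\<lambda>p. \<bar>U p - V p\<bar> * T p + X p \<bullet> kflux (fst p) (U p) (V p)"
  obtain C where C: "0 \<le> C" "\<And>p. norm (X p) \<le> C" "\<And>p. \<bar>T p\<bar> \<le> C" using C1c_bound[OF \<psi>] by metis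
  have M0: "0 \<le> M" using UM[of "(0,0)"] by simp
  have UV: "\<bar>U p - V p\<bar> \<le> 2 * M" for p using UM[of p] VM[of p] by linarith
  obtain L where L: "0 \<le> L" "\<And>x c k. norm x \<le> 2 * R \<Longrightarrow> \<bar>c\<bar> \<le> M \<Longrightarrow> \<bar>k\<bar> \<le> M \<Longrightarrow> norm (kflux x c k) \<le> L"
    using local_bounds[of "2 * R" M] by metis
  have intJ: "integrable lborel ?J"
  proof (rule integrable_lborel_bounded_compact[OF _ cK])
    fix p assume "p \<in> K"
    then have x: "norm (fst p) \<le> 2 * R" by (auto simp: K_def)
    have "\<bar>\<bar>U p - V p\<bar> * T p\<bar> \<le> 2 * M * C" unfolding abs_mult using UV[of p] C(1,3) M0 by (intro mult_mono) auto
    moreover have "\<bar>X p \<bullet> kflux (fst p) (U p) (V p)\<bar> \<le> C * L"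
      by (rule order.trans[OF Cauchy_Schwarz_ineq2 mult_mono[OF C(2) L(2)[OF x UM VM] C(1)]]) simp
    ultimately show "norm (?J p) \<le> 2 * M * C + C * L" by simp
  qed (measurable, simp add: C1cD[OF \<psi>])
  have "bounded ((\<lambda>p::'a \<times> real. g' (snd p) * cone_weight N R T0 p) ` K)"
    by (intro compact_imp_bounded compact_continuous_image cK continuous_intros continuous_on_compose2[OF g(2)] continuous_on_subset[OF cone_cont(1)[OF R0]]) auto
  then obtain C' where C': "\<And>p. p \<in> K \<Longrightarrow> norm (g' (snd p) * cone_weight N R T0 p) \<le> C'"
    unfolding bounded_iff by (metis (no_types, lifting) imageI)
  show intI: "integrable lborel ?I"
  proof (rule integrable_lborel_bounded_compact[OF _ cK])
    fix p assume p: "p \<in> K"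
    show "norm (?I p) \<le> 2 * M * C'"
      unfolding norm_mult[of "\<bar>U p - V p\<bar>"]
      by (rule mult_mono[OF _ C'[OF p]]) (use UV[of p] M0 in auto)
  next
    fix p assume "p \<notin> K"
    from out[OF this] show "?I p = 0" by auto
  qed measurable
  have le: "?J p \<le> ?I p" for p
  proof (cases "p \<in> K \<and> cone_arg N R T0 p > 0")
    case True
    let ?m = "cone_arg N R T0 p"
    have m: "max 0 ?m = ?m" "0 < ?m" using True by auto
    have t: "0 \<le> snd p" using True ab(1) by (auto simp: K_def)
    have "cone_weight_x N R T0 p \<bullet> kflux (fst p) (U p) (V p) \<le> norm (cone_weight_x N R T0 p) * norm (kflux (fst p) (U p) (V p))"
      by (rule norm_cauchy_schwarz)
    also have "\<dots> \<le> (2 * ?m / R) * (N * \<bar>U p - V p\<bar>)"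
      using norm_conex_le[OF R, of N T0 p] speed[OF cone_support[OF R N t m(2)] UM VM, of p p] m R by (intro mult_mono) auto
    also have "\<dots> = - (\<bar>U p - V p\<bar> * cone_weight_t N R T0 p)" by (simp add: cone_weight_t_def m(1))
    finally have "\<bar>U p - V p\<bar> * cone_weight_t N R T0 p + cone_weight_x N R T0 p \<bullet> kflux (fst p) (U p) (V p) \<le> 0" by simp
    then have "g (snd p) * (\<bar>U p - V p\<bar> * cone_weight_t N R T0 p + cone_weight_x N R T0 p \<bullet> kflux (fst p) (U p) (V p)) \<le> 0"
      using g(3) by (simp add: mult_nonneg_nonpos)
    then show ?thesis by (simp add: T_def X_def algebra_simps)
  next
    case False
    then have "\<not> cone_arg N R T0 p > 0 \<or> g (snd p) = 0 \<or> cone_weight_x N R T0 p = 0 \<and> cone_weight_t N R T0 p = 0" using out[of p] by blast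
    then have "X p = 0" "g (snd p) * cone_weight_t N R T0 p = 0"
      by (auto simp: X_def cone_weight_x_def cone_weight_t_def max_def not_less)
    then show ?thesis by (auto simp: T_def)
  qed
  have "0 \<le> (\<integral>p. ?J p \<partial>lborel)"
    by (rule kato_inequality[OF \<psi> Ksub pos U V UM VM kU kV])
  also have "\<dots> \<le> (\<integral>p. ?I p \<partial>lborel)" by (rule integral_mono[OF intJ intI le])
  also have "\<dots> = (\<integral>t. (\<integral>x. ?I (x, t) \<partial>lborel) \<partial>lborel)"
  proof -
    have "integrable (lborel \<Otimes>\<^sub>M lborel) (case_prod (\<lambda>x t. ?I (x, t)))"
      using intI unfolding lborel_prod by (simp add: case_prod_unfold)
    from lborel_pair.integral_snd[OF this] show ?thesis unfolding lborel_prod by (simp add: case_prod_unfold)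
  qed
  also have "\<dots> = (\<integral>t. g' t * (\<integral>x. \<bar>U (x, t) - V (x, t)\<bar> * cone_weight N R T0 (x, t) \<partial>lborel) \<partial>lborel)"
    by (simp add: mult.left_commute)
  finally show "0 \<le> (\<integral>t. g' t * (\<integral>x. \<bar>U (x, t) - V (x, t)\<bar> * cone_weight N R T0 (x, t) \<partial>lborel) \<partial>lborel)" .
qed

text \<open>With \<open>g\<close> rising just after \<rho> and falling just after \<tau>, the
  inequality compares averages over \<open>{\<rho>..\<rho> + h}\<close> and
  \<open>{\<tau>..\<tau> + h}\<close>. Lebesgue differentiation turns them into values as
  \<open>h\<close> tends to 0, outside one null set that serves for all pairs of times.\<close>

lemma weighted_decreasing:
  assumes U [measurable]: "U \<in> borel_measurable borel" and V [measurable]: "V \<in> borel_measurable borel"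
    and UM: "\<And>p. \<bar>U p\<bar> \<le> M" and VM: "\<And>p. \<bar>V p\<bar> \<le> M" and kU: "kruzhkov U" and kV: "kruzhkov V"
    and R: "0 < R" and N: "0 \<le> N" "N * T0 \<le> R"
    and speed: "\<And>x c k. norm x < 2 * R \<Longrightarrow> \<bar>c\<bar> \<le> M \<Longrightarrow> \<bar>k\<bar> \<le> M \<Longrightarrow> norm (kflux x c k) \<le> N * \<bar>c - k\<bar>"
  obtains Z where "Z \<in> null_sets lebesgue"
    "\<And>\<rho> \<tau>. 0 < \<rho> \<Longrightarrow> \<rho> \<le> \<tau> \<Longrightarrow> \<tau> < T0 \<Longrightarrow> \<rho> \<notin> Z \<Longrightarrow> \<tau> \<notin> Z \<Longrightarrow>
      (\<integral>x. \<bar>U (x, \<tau>) - V (x, \<tau>)\<bar> * cone_weight N R T0 (x, \<tau>) \<partial>lborel) \<le> (\<integral>x. \<bar>U (x, \<rho>) - V (x, \<rho>)\<bar> * cone_weight N R T0 (x, \<rho>) \<partial>lborel)"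
    "\<And>t. 0 < t \<Longrightarrow> integrable lborel (\<lambda>x. \<bar>U (x, t) - V (x, t)\<bar> * cone_weight N R T0 (x, t))"
proof -
  have R0: "R \<noteq> 0" using R by simp
  have [measurable]: "(cone_weight N R T0 :: 'a \<times> real \<Rightarrow> real) \<in> borel_measurable borel"
    using cone_cont(1)[OF R0] by (rule borel_measurable_continuous_onI)
  have M0: "0 \<le> M" using UM[of "(0,0)"] by simp
  have UV: "\<bar>U p - V p\<bar> \<le> 2 * M" for p using UM[of p] VM[of p] by linarith
  define c where "c = (1 + N * \<bar>T0\<bar> / R)\<^sup>2"
  have c0: "0 \<le> c" by (simp add: c_def)
  define w where "w t x = \<bar>U (x, t) - V (x, t)\<bar> * cone_weight N R T0 (x, t)" for t x
  have w_meas: "w t \<in> borel_measurable borel" for t unfolding w_def[abs_def] by measurable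
  have w0: "0 \<le> w t x" for t x unfolding w_def by (intro mult_nonneg_nonneg cone_nonneg) simp
  have w_le: "w t x \<le> 2 * M * c * indicator (cball 0 (2 * R)) x" if t: "0 < t" for t x
  proof (cases "norm x \<le> 2 * R")
    case True
    have "w t x \<le> 2 * M * c"
      unfolding w_def c_def using UV[of "(x, t)"] cone_le[OF R N(1), of "(x, t)" T0] t M0
      by (intro mult_mono cone_nonneg) auto
    then show ?thesis using True by simp
  next
    case False
    then have "\<not> cone_arg N R T0 (x, t) > 0" using cone_support[OF R N, of "(x, t)"] t by auto
    then show ?thesis using False by (simp add: w_def cone_weight_def max_def)
  qed
  have int_ind: "integrable lborel (\<lambda>x::'a. 2 * M * c * indicator (cball 0 (2 * R)) x)"
    by (intro integrable_mult_right integrable_real_indicator) (auto intro: emeasure_lborel_compact_finite)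
  have w_int: "integrable lborel (w t)" if t: "0 < t" for t
  proof (rule integrable_lborel_bounded_compact[OF w_meas compact_cball[of 0 "2 * R"]])
    show "norm (w t x) \<le> 2 * M * c" if "x \<in> cball 0 (2 * R)" for x
      using w_le[OF t, of x] w0[of t x] that by simp
    show "w t x = 0" if "x \<notin> cball 0 (2 * R)" for x
      using w_le[OF t, of x] w0[of t x] that by simp
  qed
  define CW where "CW = (\<integral>x. 2 * M * c * indicator (cball 0 (2 * R)) x \<partial>(lborel :: 'a measure))"
  have I_le: "(\<integral>x. w t x \<partial>lborel) \<le> CW" if t: "0 < t" for t
    unfolding CW_def by (rule integral_mono[OF w_int[OF t] int_ind w_le[OF t]])
  have I0: "0 \<le> (\<integral>x. w t x \<partial>lborel)" for t by (rule Bochner_Integration.integral_nonneg) (rule w0)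
  have CW0: "0 \<le> CW" using I0[of 1] I_le[of 1] by linarith
  \<comment> \<open>The cutoff to the times in use makes \<open>W\<close> bounded on the whole real
    line, hence integrable on every interval.\<close>
  define W where "W t = indicator {0<..<T0} t * (\<integral>x. w t x \<partial>lborel)" for t
  have W_meas [measurable]: "W \<in> borel_measurable borel" unfolding W_def[abs_def] w_def by measurable
  have W_bd: "\<bar>W t\<bar> \<le> CW" for t using I0[of t] I_le[of t] CW0 by (simp add: W_def indicator_def)
  have W_ind_int: "integrable lborel (\<lambda>t. indicator {s..s'} t * W t)" for s s'
  proof (rule integrable_lborel_bounded_compact[OF _ compact_Icc[of s s']])
    show "norm (indicator {s..s'} t * W t) \<le> CW" for t using W_bd[of t] CW0 by (simp add: indicator_def)
  qed auto
  have avg: "(\<integral>t. indicator {\<tau>..\<tau> + h} t * W t \<partial>lborel) \<le> (\<integral>t. indicator {\<rho>..\<rho> + h} t * W t \<partial>lborel)"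
    if \<rho>: "0 < \<rho>" "\<rho> \<le> \<tau>" "\<tau> + h < T0" and h: "0 < h" for \<rho> \<tau> h
  proof -
    \<comment> \<open>Continuous approximations from below to the indicator of
      \<open>{0<..<h}\<close>: the derivative of the time cutoff has to be continuous.\<close>
    define j where "j n s = max 0 (min 1 (real n * min s (h - s)))" for n s
    have j_cont: "continuous_on UNIV (j n)" for n
      unfolding j_def[abs_def] by (intro continuous_on_max continuous_on_min continuous_on_mult continuous_on_diff continuous_on_const continuous_on_id)
    have j01: "0 \<le> j n s" "j n s \<le> 1" for n s by (auto simp: j_def)
    have j_out: "j n s = 0" if "s \<notin> {0..h}" for n s
    proof -
      have "min s (h - s) \<le> 0" using that by auto
      then have "real n * min s (h - s) \<le> 0" by (intro mult_nonneg_nonpos) auto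
      then show ?thesis by (simp add: j_def)
    qed
    have [measurable]: "j n \<in> borel_measurable borel" for n using j_cont by (rule borel_measurable_continuous_onI)
    have j_lim: "(\<lambda>n. j n s) \<longlonglongrightarrow> indicator {0<..<h} s" for s
    proof (cases "s \<in> {0<..<h}")
      case True
      then have m: "0 < min s (h - s)" by auto
      obtain n0 :: nat where n0: "1 / min s (h - s) \<le> real n0" using real_arch_simple by blast
      have "j n s = 1" if "n \<ge> n0" for n
      proof -
        have "1 / min s (h - s) \<le> real n" using n0 that by linarith
        then have "1 \<le> real n * min s (h - s)" using m by (simp add: divide_le_eq)
        then show ?thesis by (simp add: j_def)
      qed
      then have "\<forall>\<^sub>F n in sequentially. j n s = indicator {0<..<h} s"
        using True by (auto simp: eventually_sequentially)
      then show ?thesis by (rule tendsto_eventually)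
    next
      case False
      have "j n s = 0" for n
      proof -
        have "min s (h - s) \<le> 0" using False by auto
        then have "real n * min s (h - s) \<le> 0" by (intro mult_nonneg_nonpos) auto
        then show ?thesis by (simp add: j_def)
      qed
      then show ?thesis using False by simp
    qed
    have step: "0 \<le> (\<integral>t. (j n (t - \<rho>) - j n (t - \<tau>)) * W t \<partial>lborel)" for n
    proof -
      obtain A where A: "\<And>s. (A has_real_derivative j n s) (at s)" "\<And>s t. s \<le> t \<Longrightarrow> A s \<le> A t"
        "\<And>s. s \<le> 0 \<Longrightarrow> A s = A 0" "\<And>s. h \<le> s \<Longrightarrow> A s = A h"
        using plateau_primitive[OF j_cont[of n] j01(1) j_out less_imp_le[OF h]] by metis
      have dA: "((\<lambda>t. A (t - r)) has_real_derivative j n (t - r)) (at t)" for r t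
      proof -
        have "((\<lambda>t. t - r) has_real_derivative 1) (at t)" by (auto intro!: derivative_eq_intros)
        from DERIV_chain2[OF A(1) this] show ?thesis by simp
      qed
      have ab: "A (t - \<rho>) - A (t - \<tau>) = 0 \<and> j n (t - \<rho>) - j n (t - \<tau>) = 0" if "t \<notin> {\<rho>..\<tau> + h}" for t
      proof (cases "t < \<rho>")
        case True
        then show ?thesis using \<rho> A(3)[of "t - \<rho>"] A(3)[of "t - \<tau>"] j_out[of "t - \<rho>"] j_out[of "t - \<tau>"] by simp
      next
        case False
        then have "\<tau> + h < t" using that by auto
        then show ?thesis using \<rho> A(4)[of "t - \<rho>"] A(4)[of "t - \<tau>"] j_out[of "t - \<rho>"] j_out[of "t - \<tau>"] by simp
      qed
      have "0 \<le> (\<integral>t. (j n (t - \<rho>) - j n (t - \<tau>)) * (\<integral>x. \<bar>U (x, t) - V (x, t)\<bar> * cone_weight N R T0 (x, t) \<partial>lborel) \<partial>lborel)"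
      proof (rule weighted_time_inequality(1)[where g = "\<lambda>t. A (t - \<rho>) - A (t - \<tau>)" and a = \<rho> and b = "\<tau> + h", OF U V UM VM kU kV R N speed])
        show "((\<lambda>t. A (t - \<rho>) - A (t - \<tau>)) has_real_derivative j n (t - \<rho>) - j n (t - \<tau>)) (at t)" for t
          by (rule DERIV_diff[OF dA dA])
        show "continuous_on UNIV (\<lambda>t. j n (t - \<rho>) - j n (t - \<tau>))"
          by (intro continuous_intros continuous_on_compose2[OF j_cont]) auto
        show "0 \<le> A (t - \<rho>) - A (t - \<tau>)" for t using A(2)[of "t - \<tau>" "t - \<rho>"] \<rho> by simp
      qed (assumption+, rule \<rho>(1), rule ab)
      also have "(\<integral>t. (j n (t - \<rho>) - j n (t - \<tau>)) * (\<integral>x. \<bar>U (x, t) - V (x, t)\<bar> * cone_weight N R T0 (x, t) \<partial>lborel) \<partial>lborel)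
        = (\<integral>t. (j n (t - \<rho>) - j n (t - \<tau>)) * W t \<partial>lborel)"
      proof (rule Bochner_Integration.integral_cong[OF refl])
        fix t
        show "(j n (t - \<rho>) - j n (t - \<tau>)) * (\<integral>x. \<bar>U (x, t) - V (x, t)\<bar> * cone_weight N R T0 (x, t) \<partial>lborel) = (j n (t - \<rho>) - j n (t - \<tau>)) * W t"
        proof (cases "t \<in> {\<rho>..\<tau> + h}")
          case True
          then show ?thesis using \<rho> by (simp add: W_def w_def)
        next
          case False
          then show ?thesis using ab[OF False] by simp
        qed
      qed
      finally show ?thesis .
    qed
    have "(\<lambda>n. \<integral>t. (j n (t - \<rho>) - j n (t - \<tau>)) * W t \<partial>lborel) \<longlonglongrightarrow> (\<integral>t. (indicator {0<..<h} (t - \<rho>) - indicator {0<..<h} (t - \<tau>)) * W t \<partial>lborel)"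
    proof (rule integral_dominated_convergence)
      show "integrable lborel (\<lambda>t. CW * indicator {\<rho>..\<tau> + h} t)"
        by (intro integrable_mult_right integrable_real_indicator) (auto intro: emeasure_lborel_compact_finite)
      show "AE t in lborel. (\<lambda>n. (j n (t - \<rho>) - j n (t - \<tau>)) * W t) \<longlonglongrightarrow> (indicator {0<..<h} (t - \<rho>) - indicator {0<..<h} (t - \<tau>)) * W t"
        by (intro AE_I2 tendsto_intros j_lim)
      show "AE t in lborel. norm ((j n (t - \<rho>) - j n (t - \<tau>)) * W t) \<le> CW * indicator {\<rho>..\<tau> + h} t" for n
      proof (rule AE_I2)
        fix t
        show "norm ((j n (t - \<rho>) - j n (t - \<tau>)) * W t) \<le> CW * indicator {\<rho>..\<tau> + h} t"
        proof (cases "t \<in> {\<rho>..\<tau> + h}")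
          case True
          have "\<bar>j n (t - \<rho>) - j n (t - \<tau>)\<bar> \<le> 1" using j01[of n "t - \<rho>"] j01[of n "t - \<tau>"] by linarith
          from mult_mono[OF this W_bd[of t]] True show ?thesis by (simp add: abs_mult)
        next
          case False
          then have "t - \<rho> \<notin> {0..h}" "t - \<tau> \<notin> {0..h}" using \<rho> by auto
          then show ?thesis using False j_out by simp
        qed
      qed
    qed measurable
    then have "0 \<le> (\<integral>t. (indicator {0<..<h} (t - \<rho>) - indicator {0<..<h} (t - \<tau>)) * W t \<partial>lborel)"
      by (rule LIMSEQ_le_const) (use step in auto)
    also have "\<dots> = (\<integral>t. indicator {\<rho>..\<rho> + h} t * W t - indicator {\<tau>..\<tau> + h} t * W t \<partial>lborel)"
    proof (rule integral_cong_AE)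
      have "AE t in lborel. t \<noteq> \<rho> \<and> t \<noteq> \<rho> + h \<and> t \<noteq> \<tau> \<and> t \<noteq> \<tau> + h"
        by (intro AE_conjI AE_lborel_singleton)
      then show "AE t in lborel. (indicator {0<..<h} (t - \<rho>) - indicator {0<..<h} (t - \<tau>)) * W t = indicator {\<rho>..\<rho> + h} t * W t - indicator {\<tau>..\<tau> + h} t * W t"
        by eventually_elim (auto simp: indicator_def)
    qed measurable
    also have "\<dots> = (\<integral>t. indicator {\<rho>..\<rho> + h} t * W t \<partial>lborel) - (\<integral>t. indicator {\<tau>..\<tau> + h} t * W t \<partial>lborel)"
      by (rule Bochner_Integration.integral_diff[OF W_ind_int W_ind_int])
    finally show ?thesis by simp
  qed
  have set_int: "set_integrable lborel {s..s'} W" for s s'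
    using W_ind_int[of s s'] by (simp add: set_integrable_def)
  have HK: "integral {s..s'} W = (\<integral>t. indicator {s..s'} t * W t \<partial>lborel)" for s s'
    using set_borel_integral_eq_integral(2)[OF set_int[of s s']] by (simp add: set_lebesgue_integral_def)
  have "W integrable_on cbox s s'" for s s'
    using set_borel_integral_eq_integral(1)[OF set_int[of s s']] by simp
  \<comment> \<open>The averages extend to the right of each point, which matches the windows in
    \<open>avg\<close>.\<close>
  from integrable_ccontinuous_explicit[OF this]
  obtain Z where Z: "negligible Z" and
    lim: "\<And>x e. x \<notin> Z \<Longrightarrow> 0 < e \<Longrightarrow> \<exists>d>0. \<forall>h. 0 < h \<and> h < d \<longrightarrow>
       norm (integral (cbox x (x + h *\<^sub>R One)) W /\<^sub>R h ^ DIM(real) - W x) < e"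
    by metis
  have lim': "\<exists>d>0. \<forall>h. 0 < h \<longrightarrow> h < d \<longrightarrow> \<bar>integral {x..x + h} W / h - W x\<bar> < e" if xe: "x \<notin> Z" "0 < e" for x e
  proof -
    obtain d where "d > 0" and d: "\<And>h. 0 < h \<Longrightarrow> h < d \<Longrightarrow> norm (integral (cbox x (x + h *\<^sub>R One)) W /\<^sub>R h ^ DIM(real) - W x) < e"
      using lim[OF xe] by metis
    have "\<bar>integral {x..x + h} W / h - W x\<bar> < e" if "0 < h" "h < d" for h
      using d[OF that] by (simp add: divide_inverse mult.commute)
    then show ?thesis using \<open>d > 0\<close> by blast
  qed
  show thesis
  proof (rule that[of Z])
    show "Z \<in> null_sets lebesgue" using Z by (simp add: negligible_iff_null_sets)
    show "integrable lborel (\<lambda>x. \<bar>U (x, t) - V (x, t)\<bar> * cone_weight N R T0 (x, t))" if "0 < t" for t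
      using w_int[OF that] by (simp add: w_def[abs_def])
    fix \<rho> \<tau> assume \<rho>: "0 < \<rho>" "\<rho> \<le> \<tau>" "\<tau> < T0" and z: "\<rho> \<notin> Z" "\<tau> \<notin> Z"
    have "W \<tau> \<le> W \<rho> + e" if e: "0 < e" for e
    proof -
      obtain d1 where d1: "d1 > 0" "\<And>h. 0 < h \<Longrightarrow> h < d1 \<Longrightarrow> \<bar>integral {\<rho>..\<rho> + h} W / h - W \<rho>\<bar> < e / 2"
        using lim'[OF z(1) half_gt_zero[OF e]] by metis
      obtain d2 where d2: "d2 > 0" "\<And>h. 0 < h \<Longrightarrow> h < d2 \<Longrightarrow> \<bar>integral {\<tau>..\<tau> + h} W / h - W \<tau>\<bar> < e / 2"
        using lim'[OF z(2) half_gt_zero[OF e]] by metis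
      define m where "m = min (min d1 d2) (T0 - \<tau>)"
      have m: "0 < m" "m \<le> d1" "m \<le> d2" "m \<le> T0 - \<tau>" using d1(1) d2(1) \<rho>(3) by (auto simp: m_def)
      define h where "h = m / 2"
      have h: "0 < h" "h < d1" "h < d2" "\<tau> + h < T0" using m unfolding h_def by linarith+
      have "integral {\<tau>..\<tau> + h} W / h \<le> integral {\<rho>..\<rho> + h} W / h"
        unfolding HK using avg[OF \<rho>(1,2) h(4,1)] h(1) by (intro divide_right_mono) auto
      then show ?thesis using d1(2)[OF h(1,2)] d2(2)[OF h(1,3)] by linarith
    qed
    then have "W \<tau> \<le> W \<rho>" by (rule field_le_epsilon)
    then show "(\<integral>x. \<bar>U (x, \<tau>) - V (x, \<tau>)\<bar> * cone_weight N R T0 (x, \<tau>) \<partial>lborel) \<le> (\<integral>x. \<bar>U (x, \<rho>) - V (x, \<rho>)\<bar> * cone_weight N R T0 (x, \<rho>) \<partial>lborel)"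
      using \<rho> by (simp add: W_def w_def)
  qed
qed

end

section \<open>Borel representatives and the limit of infinite radius\<close>

lemma Linf_norm_nonneg:
  "0 \<le> Linf_norm (lebesgue_on (UNIV \<times> {0<..} :: ('a::euclidean_space \<times> real) set)) u"
proof (rule ccontr)
  let ?S = "UNIV \<times> {0<..} :: ('a \<times> real) set"
  assume neg: "\<not> ?thesis"
  have op: "open ?S" by (intro open_Times) auto
  have "AE p in lebesgue_on ?S. False"
    using esssup_AE[of "\<lambda>p. ereal \<bar>u p\<bar>" "lebesgue_on ?S"]
  proof eventually_elim
    case (elim p)
    then have "ereal \<bar>u p\<bar> < 0" using neg unfolding Linf_norm_def by (metis not_le order.strict_trans1)
    then show ?case by simp
  qed
  then have "emeasure (lebesgue_on ?S) (space (lebesgue_on ?S)) = 0"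
    by (auto simp: AE_iff_null dest: null_setsD1)
  then have "emeasure lebesgue ?S = 0"
    using op by (simp add: emeasure_restrict_space)
  then have "negligible ?S"
    using op by (simp add: negligible_iff_emeasure0)
  \<comment> \<open>On a space of measure 0 the essential supremum could be negative; the half-space
    is open and nonempty, hence not negligible.\<close>
  moreover have "(0, 1) \<in> ?S" by simp
  ultimately show False using open_not_negligible[OF op] by auto
qed

text \<open>A Lebesgue measurable function agrees almost everywhere with a Borel one. Clamping turns
  the essential bound into a bound at every point, including the times outside the
  half-space.\<close>

lemma Linf_borel_representative:
  fixes u :: "'a::euclidean_space \<times> real \<Rightarrow> real"
  assumes u: "u \<in> Linf (lebesgue_on (UNIV \<times> {0<..}))"
    and M: "Linf_norm (lebesgue_on (UNIV \<times> {0<..})) u \<le> ereal M"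
  obtains U where "U \<in> borel_measurable borel" "\<And>p. \<bar>U p\<bar> \<le> M" "AE p in lborel. 0 < snd p \<longrightarrow> U p = u p"
proof -
  let ?S = "UNIV \<times> {0<..} :: ('a \<times> real) set"
  have S: "?S \<in> sets lebesgue" by (intro borel_open open_Times sets_completionI_sets) (auto simp: open_Times)
  have M0: "0 \<le> M" using order.trans[OF Linf_norm_nonneg M] by simp
  have "(\<lambda>p. indicator ?S p *\<^sub>R u p) \<in> borel_measurable lebesgue"
    using u S by (simp add: Linf_def borel_measurable_restrict_space_iff)
  then obtain g where g [measurable]: "g \<in> borel_measurable lborel" and ae: "AE p in lborel. indicator ?S p *\<^sub>R u p = g p"
    using completion_ex_borel_measurable_real by blast
  have "AE p in lebesgue_on ?S. \<bar>u p\<bar> \<le> M"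
    using esssup_AE[of "\<lambda>p. ereal \<bar>u p\<bar>" "lebesgue_on ?S"]
  proof eventually_elim
    case (elim p)
    then have "ereal \<bar>u p\<bar> \<le> ereal M" using M unfolding Linf_norm_def by (rule order.trans)
    then show ?case by simp
  qed
  then have "AE p in lebesgue. p \<in> ?S \<longrightarrow> \<bar>u p\<bar> \<le> M"
    using S by (subst (asm) AE_restrict_space_iff) auto
  then have ae': "AE p in lborel. p \<in> ?S \<longrightarrow> \<bar>u p\<bar> \<le> M" by (simp add: AE_completion_iff)
  define U where "U p = max (- M) (min M (g p))" for p
  show thesis
  proof (rule that[of U])
    show "U \<in> borel_measurable borel" unfolding U_def using g by measurable
    show "\<bar>U p\<bar> \<le> M" for p using M0 by (auto simp: U_def)
    show "AE p in lborel. 0 < snd p \<longrightarrow> U p = u p"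
      using ae ae'
    proof eventually_elim
      case (elim p)
      show ?case
      proof
        assume "0 < snd p"
        then have "p \<in> ?S" by (cases p) auto
        then show "U p = u p" using elim by (auto simp: U_def)
      qed
    qed
  qed
qed

lemma cone_weight_tendsto:
  assumes N: "(\<lambda>m. N m / real m) \<longlonglongrightarrow> 0"
  shows "(\<lambda>m. cone_weight (N m) (real m) T0 p) \<longlonglongrightarrow> 1"
proof -
  have "(\<lambda>m. 1 + (N m / real m) * (T0 - snd p) - sqrt (1 + fst p \<bullet> fst p) * (1 / real m)) \<longlonglongrightarrow> 1 + 0 * (T0 - snd p) - sqrt (1 + fst p \<bullet> fst p) * 0"
    by (intro tendsto_intros N lim_1_over_n)
  then have "(\<lambda>m. (max 0 (cone_arg (N m) (real m) T0 p))\<^sup>2) \<longlonglongrightarrow> (max 0 1)\<^sup>2"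
    unfolding cone_arg_def by (intro tendsto_intros) simp
  then show ?thesis by (simp add: cone_weight_def)
qed

text \<open>Fatou's lemma serves the left side, where the weights tend to 1. On the right the
  weights are at most constants that also tend to 1, so a finite integral of \<open>b\<close> bounds
  the limit; an infinite one leaves nothing to prove.\<close>

lemma nn_integral_cone_limit_le:
  fixes a b :: "'a::euclidean_space \<Rightarrow> real"
  assumes [measurable]: "a \<in> borel_measurable borel" "b \<in> borel_measurable borel"
    and a0: "\<And>x. 0 \<le> a x" and b0: "\<And>x. 0 \<le> b x"
    and N: "(\<lambda>m. N m / real m) \<longlonglongrightarrow> 0" "\<And>m. 0 \<le> N m" and \<rho>: "0 \<le> \<rho>"
    and le: "\<forall>\<^sub>F m in sequentially. (\<integral>\<^sup>+x. ennreal (a x * cone_weight (N m) (real m) T0 (x, \<tau>)) \<partial>lborel) \<le>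
      (\<integral>\<^sup>+x. ennreal (b x * cone_weight (N m) (real m) T0 (x, \<rho>)) \<partial>lborel)"
  shows "(\<integral>\<^sup>+x. ennreal (a x) \<partial>lborel) \<le> (\<integral>\<^sup>+x. ennreal (b x) \<partial>lborel)"
proof (cases "(\<integral>\<^sup>+x. ennreal (b x) \<partial>lborel) = \<infinity>")
  case False
  then obtain q where q: "0 \<le> q" "(\<integral>\<^sup>+x. ennreal (b x) \<partial>lborel) = ennreal q"
    by (cases "\<integral>\<^sup>+x. ennreal (b x) \<partial>lborel") auto
  have cm: "(\<lambda>x::'a. cone_weight (N m) (real m) T0 (x, t)) \<in> borel_measurable borel" for m t
    unfolding cone_weight_def cone_arg_def by measurable
  define c where "c m = (1 + N m / real m * \<bar>T0\<bar>)\<^sup>2" for m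
  have c: "(\<lambda>m. c m * q) \<longlonglongrightarrow> (1 + 0 * \<bar>T0\<bar>)\<^sup>2 * q" unfolding c_def by (intro tendsto_intros N)
  have "(\<integral>\<^sup>+x. ennreal (a x) \<partial>lborel) = (\<integral>\<^sup>+x. liminf (\<lambda>m. ennreal (a x * cone_weight (N m) (real m) T0 (x, \<tau>))) \<partial>lborel)"
  proof (rule nn_integral_cong)
    fix x
    have "(\<lambda>m. ennreal (a x * cone_weight (N m) (real m) T0 (x, \<tau>))) \<longlonglongrightarrow> ennreal (a x * 1)"
      by (intro tendsto_intros cone_weight_tendsto N)
    then show "ennreal (a x) = liminf (\<lambda>m. ennreal (a x * cone_weight (N m) (real m) T0 (x, \<tau>)))"
      using lim_imp_Liminf[OF sequentially_bot] by (metis mult.right_neutral)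
  qed
  also have "\<dots> \<le> liminf (\<lambda>m. \<integral>\<^sup>+x. ennreal (a x * cone_weight (N m) (real m) T0 (x, \<tau>)) \<partial>lborel)"
    using cm by (intro nn_integral_liminf) measurable
  also have "\<dots> \<le> liminf (\<lambda>m. ennreal (c m * q))"
  proof (rule Liminf_mono)
    show "\<forall>\<^sub>F m in sequentially. (\<integral>\<^sup>+x. ennreal (a x * cone_weight (N m) (real m) T0 (x, \<tau>)) \<partial>lborel) \<le> ennreal (c m * q)"
      using le eventually_gt_at_top[of 0]
    proof eventually_elim
      case (elim m)
      have cw: "cone_weight (N m) (real m) T0 (x, \<rho>) \<le> c m" for x :: 'a
        using cone_le[of "real m" "N m" "(x, \<rho>)" T0] N(2) \<rho> elim(2) by (simp add: c_def)
      have "(\<integral>\<^sup>+x. ennreal (b x * cone_weight (N m) (real m) T0 (x, \<rho>)) \<partial>lborel) \<le> (\<integral>\<^sup>+x. ennreal (c m) * ennreal (b x) \<partial>lborel)"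
      proof (rule nn_integral_mono)
        fix x
        have "ennreal (b x * cone_weight (N m) (real m) T0 (x, \<rho>)) \<le> ennreal (c m * b x)"
          using mult_left_mono[OF cw b0, of x x] by (intro ennreal_leI) (simp add: mult.commute)
        also have "\<dots> = ennreal (c m) * ennreal (b x)" by (rule ennreal_mult) (auto simp: c_def b0)
        finally show "ennreal (b x * cone_weight (N m) (real m) T0 (x, \<rho>)) \<le> ennreal (c m) * ennreal (b x)" .
      qed
      also have "\<dots> = ennreal (c m) * ennreal q" by (subst nn_integral_cmult) (simp_all add: q(2))
      also have "\<dots> = ennreal (c m * q)" using q(1) by (intro ennreal_mult[symmetric]) (auto simp: c_def)
      finally show ?case using elim(1) by (rule order.trans[rotated])
    qed
  qed
  also have "\<dots> = ennreal ((1 + 0 * \<bar>T0\<bar>)\<^sup>2 * q)"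
    by (rule lim_imp_Liminf[OF sequentially_bot tendsto_ennrealI[OF c]])
  finally show ?thesis using q(2) by simp
qed simp

lemma AE_lborel_exceptional_set:
  assumes "AE t in lborel. P t"
  obtains Z where "Z \<in> null_sets lebesgue" "\<And>t. t \<notin> Z \<Longrightarrow> P t"
proof -
  obtain N where N: "{t \<in> space lborel. \<not> P t} \<subseteq> N" "emeasure lborel N = 0" "N \<in> sets lborel"
    by (rule AE_E[OF assms])
  then have "N \<in> null_sets lebesgue" by (intro null_sets_completionI) (auto simp: null_sets_def)
  then show thesis by (rule that) (use N(1) in auto)
qed

section \<open>From the growth of the flux speed to the contraction\<close>

context flux begin

text \<open>The local Lipschitz constant bounds the quotients, so \<open>Sup\<close> is a true
  supremum. For M = 0 the two states coincide and \<open>kflux\<close> vanishes.\<close>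

lemma flux_speed_nonneg:
  assumes "0 \<le> M" "0 < R" shows "0 \<le> flux_speed f M R"
    and "\<And>x c k. norm x < R \<Longrightarrow> \<bar>c\<bar> \<le> M \<Longrightarrow> \<bar>k\<bar> \<le> M \<Longrightarrow> norm (kflux x c k) \<le> flux_speed f M R * \<bar>c - k\<bar>"
proof -
  let ?A = "{norm (f (x, k) - f (x, k')) / \<bar>k - k'\<bar> | x k k'.
                  x \<in> ball 0 R \<and> k \<in> {-M..M} \<and> k' \<in> {-M..M} \<and> k \<noteq> k'}"
  obtain L where L: "\<And>x k l. norm x \<le> R \<Longrightarrow> \<bar>k\<bar> \<le> M \<Longrightarrow> \<bar>l\<bar> \<le> M \<Longrightarrow> norm (f (x, k) - f (x, l)) \<le> L * \<bar>k - l\<bar>"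
    using local_bounds[of R M] by metis
  have bdd: "bdd_above ?A"
  proof (rule bdd_aboveI)
    fix r assume "r \<in> ?A"
    then obtain x k l where r: "r = norm (f (x, k) - f (x, l)) / \<bar>k - l\<bar>" "norm x \<le> R" "\<bar>k\<bar> \<le> M" "\<bar>l\<bar> \<le> M" "k \<noteq> l"
      by (fastforce simp: abs_le_iff)
    then show "r \<le> L" using L[OF r(2-4)] by (simp add: divide_le_eq)
  qed
  have sup: "norm (f (x, c) - f (x, k)) / \<bar>c - k\<bar> \<le> flux_speed f M R" if "norm x < R" "\<bar>c\<bar> \<le> M" "\<bar>k\<bar> \<le> M" "c \<noteq> k" for x c k
  proof -
    have "M \<noteq> 0" using that by auto
    moreover have "norm (f (x, c) - f (x, k)) / \<bar>c - k\<bar> \<le> Sup ?A"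
    proof (rule cSup_upper[OF _ bdd])
      show "norm (f (x, c) - f (x, k)) / \<bar>c - k\<bar> \<in> ?A"
        unfolding mem_Collect_eq using that
        by (intro exI[of _ x] exI[of _ c] exI[of _ k]) (auto simp: abs_le_iff)
    qed
    ultimately show ?thesis by (simp add: flux_speed_def)
  qed
  show "0 \<le> flux_speed f M R"
  proof (cases "M = 0")
    case False
    have "0 \<le> norm (f (0, M) - f (0, - M)) / \<bar>M - - M\<bar>" by simp
    also have "\<dots> \<le> flux_speed f M R" using assms False by (intro sup) auto
    finally show ?thesis .
  qed (simp add: flux_speed_def)
  show "norm (kflux x c k) \<le> flux_speed f M R * \<bar>c - k\<bar>" if "norm x < R" "\<bar>c\<bar> \<le> M" "\<bar>k\<bar> \<le> M" for x c k
  proof (cases "c = k")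
    case False
    have "norm (kflux x c k) = norm (f (x, c) - f (x, k))" using False by (simp add: kflux_def sgn_real_def)
    then show ?thesis using sup[OF that False] False by (simp add: divide_le_eq)
  qed (simp add: kflux_def)
qed

text \<open>For a fixed time horizon T0 the condition \<open>N m * T0 \<le> real m\<close> holds for
  all large \<open>m\<close>, since the speed grows sublinearly; then the weighted integrals
  decrease in time and the weights tend to 1. Integer radii and integer horizons keep the union of
  the exceptional sets null.\<close>

lemma L1_contraction:
  assumes U [measurable]: "U \<in> borel_measurable borel" and V [measurable]: "V \<in> borel_measurable borel"
    and UM: "\<And>p. \<bar>U p\<bar> \<le> M" and VM: "\<And>p. \<bar>V p\<bar> \<le> M" and kU: "kruzhkov U" and kV: "kruzhkov V"
    and speed: "((\<lambda>R. flux_speed f M R / R) \<longlongrightarrow> 0) at_top"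
  obtains Z where "Z \<in> null_sets lebesgue"
    "\<And>\<rho> \<tau>. 0 < \<rho> \<Longrightarrow> \<rho> \<le> \<tau> \<Longrightarrow> \<rho> \<notin> Z \<Longrightarrow> \<tau> \<notin> Z \<Longrightarrow>
      (\<integral>\<^sup>+x. ennreal \<bar>U (x, \<tau>) - V (x, \<tau>)\<bar> \<partial>lborel) \<le> (\<integral>\<^sup>+x. ennreal \<bar>U (x, \<rho>) - V (x, \<rho>)\<bar> \<partial>lborel)"
proof -
  have M0: "0 \<le> M" using UM[of "(0,0)"] by simp
  \<comment> \<open>The weight of radius \<open>m\<close> lives within radius 2m, so the speed is
    measured there. At m = 0 the ball is empty and its supremum may be unspecified, hence the
    explicit value 0.\<close>
  define N where "N m = (if m = 0 then 0 else flux_speed f M (2 * real m))" for m :: nat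
  have N0: "0 \<le> N m" for m using flux_speed_nonneg(1)[OF M0, of "2 * real m"] by (simp add: N_def)
  have Nlim: "(\<lambda>m. N m / real m) \<longlonglongrightarrow> 0"
  proof -
    have "filterlim (\<lambda>m. 2 * real m) at_top sequentially"
      by (rule filterlim_tendsto_pos_mult_at_top[OF tendsto_const _ filterlim_real_sequentially]) simp
    from tendsto_mult[OF tendsto_const filterlim_compose[OF speed this], of 2]
    have "(\<lambda>m. 2 * (flux_speed f M (2 * real m) / (2 * real m))) \<longlonglongrightarrow> 0" by simp
    then show ?thesis
      by (rule Lim_transform_eventually) (auto simp: N_def)
  qed
  \<comment> \<open>Every pair receives an exceptional set, the empty one where the condition on the
    radius fails, so that a choice function exists on all pairs.\<close>
  define Q where "Q m T0 Z \<longleftrightarrow> Z \<in> null_sets lebesgue \<and> (0 < m \<and> N m * T0 \<le> real m \<longrightarrow>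
    (\<forall>\<rho> \<tau>. 0 < \<rho> \<longrightarrow> \<rho> \<le> \<tau> \<longrightarrow> \<tau> < T0 \<longrightarrow> \<rho> \<notin> Z \<longrightarrow> \<tau> \<notin> Z \<longrightarrow>
      (\<integral>\<^sup>+x. ennreal (\<bar>U (x, \<tau>) - V (x, \<tau>)\<bar> * cone_weight (N m) (real m) T0 (x, \<tau>)) \<partial>lborel) \<le>
      (\<integral>\<^sup>+x. ennreal (\<bar>U (x, \<rho>) - V (x, \<rho>)\<bar> * cone_weight (N m) (real m) T0 (x, \<rho>)) \<partial>lborel)))" for m :: nat and T0 :: real and Z
  have "\<exists>Z. Q m T0 Z" for m T0
  proof (cases "0 < m \<and> N m * T0 \<le> real m")
    case True
    have sp: "norm (kflux x c k) \<le> N m * \<bar>c - k\<bar>" if "norm x < 2 * real m" "\<bar>c\<bar> \<le> M" "\<bar>k\<bar> \<le> M" for x c k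
      using flux_speed_nonneg(2)[OF M0 _ that] True by (simp add: N_def)
    have m: "0 < real m" "N m * T0 \<le> real m" using True by auto
    obtain Z where Z: "Z \<in> null_sets lebesgue"
      and mono: "\<And>\<rho> \<tau>. 0 < \<rho> \<Longrightarrow> \<rho> \<le> \<tau> \<Longrightarrow> \<tau> < T0 \<Longrightarrow> \<rho> \<notin> Z \<Longrightarrow> \<tau> \<notin> Z \<Longrightarrow>
       (\<integral>x. \<bar>U (x, \<tau>) - V (x, \<tau>)\<bar> * cone_weight (N m) (real m) T0 (x, \<tau>) \<partial>lborel) \<le> (\<integral>x. \<bar>U (x, \<rho>) - V (x, \<rho>)\<bar> * cone_weight (N m) (real m) T0 (x, \<rho>) \<partial>lborel)"
      and int: "\<And>t. 0 < t \<Longrightarrow> integrable lborel (\<lambda>x. \<bar>U (x, t) - V (x, t)\<bar> * cone_weight (N m) (real m) T0 (x, t))"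
    proof (rule weighted_decreasing[OF U V UM VM kU kV m(1) N0 m(2)])
      show "norm (kflux x c k) \<le> N m * \<bar>c - k\<bar>" if "norm x < 2 * real m" "\<bar>c\<bar> \<le> M" "\<bar>k\<bar> \<le> M" for x c k
        by (rule sp[OF that])
    qed (rule that; assumption)
    have eq: "(\<integral>\<^sup>+x. ennreal (\<bar>U (x, t) - V (x, t)\<bar> * cone_weight (N m) (real m) T0 (x, t)) \<partial>lborel) =
       ennreal (\<integral>x. \<bar>U (x, t) - V (x, t)\<bar> * cone_weight (N m) (real m) T0 (x, t) \<partial>lborel)" if "0 < t" for t
      by (rule nn_integral_eq_integral[OF int[OF that]]) (auto intro!: mult_nonneg_nonneg cone_nonneg)
    have "Q m T0 Z"
      unfolding Q_def
    proof (intro conjI Z impI allI)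
      fix \<rho> \<tau> assume r: "0 < \<rho>" "\<rho> \<le> \<tau>" "\<tau> < T0" "\<rho> \<notin> Z" "\<tau> \<notin> Z"
      show "(\<integral>\<^sup>+x. ennreal (\<bar>U (x, \<tau>) - V (x, \<tau>)\<bar> * cone_weight (N m) (real m) T0 (x, \<tau>)) \<partial>lborel) \<le>
        (\<integral>\<^sup>+x. ennreal (\<bar>U (x, \<rho>) - V (x, \<rho>)\<bar> * cone_weight (N m) (real m) T0 (x, \<rho>)) \<partial>lborel)"
        unfolding eq[OF r(1)] eq[OF less_le_trans[OF r(1,2)]] by (intro ennreal_leI mono r)
    qed
    then show ?thesis ..
  next
    case False
    have "Q m T0 {}" unfolding Q_def by (intro conjI impI, simp, rule notE[OF False])
    then show ?thesis ..
  qed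
  then have "\<forall>m T0. \<exists>Z. Q m T0 Z" by blast
  then obtain Z' where Z': "\<And>m T0. Q m T0 (Z' m T0)" unfolding choice_iff by blast
  have Z: "\<And>m T0. Z' m T0 \<in> null_sets lebesgue"
    and mono: "\<And>(m::nat) T0 \<rho> \<tau>. 0 < m \<Longrightarrow> N m * T0 \<le> real m \<Longrightarrow> 0 < \<rho> \<Longrightarrow> \<rho> \<le> \<tau> \<Longrightarrow> \<tau> < T0 \<Longrightarrow> \<rho> \<notin> Z' m T0 \<Longrightarrow> \<tau> \<notin> Z' m T0 \<Longrightarrow>
      (\<integral>\<^sup>+x. ennreal (\<bar>U (x, \<tau>) - V (x, \<tau>)\<bar> * cone_weight (N m) (real m) T0 (x, \<tau>)) \<partial>lborel) \<le>
      (\<integral>\<^sup>+x. ennreal (\<bar>U (x, \<rho>) - V (x, \<rho>)\<bar> * cone_weight (N m) (real m) T0 (x, \<rho>)) \<partial>lborel)"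
    using Z' unfolding Q_def by blast+
  define ZZ where "ZZ = (\<Union>m. \<Union>n. Z' m (real n))"
  show thesis
  proof (rule that[of ZZ])
    show "ZZ \<in> null_sets lebesgue" unfolding ZZ_def by (intro null_sets_UN Z)
    fix \<rho> \<tau> assume \<rho>: "0 < \<rho>" "\<rho> \<le> \<tau>" "\<rho> \<notin> ZZ" "\<tau> \<notin> ZZ"
    obtain n :: nat where n: "\<tau> < real n" using reals_Archimedean2 by blast
    have "(\<lambda>m. N m / real m * real n) \<longlonglongrightarrow> 0 * real n" by (intro tendsto_intros Nlim)
    then have "\<forall>\<^sub>F m in sequentially. N m / real m * real n < 1" by (intro order_tendstoD(2)) auto
    then have ev: "\<forall>\<^sub>F m in sequentially. (\<integral>\<^sup>+x. ennreal (\<bar>U (x, \<tau>) - V (x, \<tau>)\<bar> * cone_weight (N m) (real m) (real n) (x, \<tau>)) \<partial>lborel) \<le>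
      (\<integral>\<^sup>+x. ennreal (\<bar>U (x, \<rho>) - V (x, \<rho>)\<bar> * cone_weight (N m) (real m) (real n) (x, \<rho>)) \<partial>lborel)"
      using eventually_gt_at_top[of 0]
    proof eventually_elim
      case (elim m)
      then have "N m * real n \<le> real m" by (simp add: divide_less_eq)
      then show ?case using \<rho> n elim(2) by (intro mono) (auto simp: ZZ_def)
    qed
    show "(\<integral>\<^sup>+x. ennreal \<bar>U (x, \<tau>) - V (x, \<tau>)\<bar> \<partial>lborel) \<le> (\<integral>\<^sup>+x. ennreal \<bar>U (x, \<rho>) - V (x, \<rho>)\<bar> \<partial>lborel)"
      by (rule nn_integral_cone_limit_le[OF _ _ _ _ Nlim N0 _ ev]) (use \<rho>(1) in auto)
  qed
qed

end

theorem corollary5p4: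
  fixes f :: "'a::euclidean_space \<times> real \<Rightarrow> 'a"
    and u v :: "'a \<times> real \<Rightarrow> real"
    and u0 v0 :: "'a \<Rightarrow> real"
    and I :: "real set"
    and M :: real
  assumes "flux_assumption f"
    and "I = {0<..}"
    and "u0 \<in> Linf lebesgue" and "v0 \<in> Linf lebesgue"
    and "entropy_solution I f u0 u"
    and "entropy_solution I f v0 v"
    and "M = real_of_ereal (max (Linf_norm (lebesgue_on (UNIV \<times> I)) u)
                                (Linf_norm (lebesgue_on (UNIV \<times> I)) v))"
    and "((\<lambda>R. flux_speed f M R / R) \<longlongrightarrow> 0) at_top"
  shows "\<exists>N\<subseteq>I. N \<in> null_sets lebesgue \<and>
           (\<forall>\<rho>\<in>I - N. \<forall>\<tau>\<in>I - N. \<rho> \<le> \<tau> \<longrightarrow>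
              (\<integral>\<^sup>+x. ennreal \<bar>u (x, \<tau>) - v (x, \<tau>)\<bar> \<partial>lebesgue)
                \<le> (\<integral>\<^sup>+x. ennreal \<bar>u (x, \<rho>) - v (x, \<rho>)\<bar> \<partial>lebesgue))"
proof -
  obtain B D where "flux f B D" using flux_assumption_imp_flux[OF assms(1)] by blast
  then interpret flux f B D .
  let ?L = "lebesgue_on (UNIV \<times> {0<..} :: ('a \<times> real) set)"
  have sol: "entropy_solution {0<..} f u0 u" "entropy_solution {0<..} f v0 v"
    using assms(2,5,6) by auto
  then have uL: "u \<in> Linf ?L" and vL: "v \<in> Linf ?L" unfolding entropy_solution_def by blast+
  have "max (Linf_norm ?L u) (Linf_norm ?L v) < \<infinity>" using uL vL by (auto simp: Linf_def max_def)
  moreover have "0 \<le> max (Linf_norm ?L u) (Linf_norm ?L v)" by (rule order.trans[OF Linf_norm_nonneg max.cobounded1])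
  \<comment> \<open>Both norms are finite and nonnegative, so \<open>real_of_ereal\<close> returns
    the true value of the maximum and not its default.\<close>
  ultimately have "ereal M = max (Linf_norm ?L u) (Linf_norm ?L v)"
    using assms(2,7) by (simp add: ereal_real)
  then have le: "Linf_norm ?L u \<le> ereal M" "Linf_norm ?L v \<le> ereal M" by simp_all
  obtain U where U: "U \<in> borel_measurable borel" and UM: "\<And>p. \<bar>U p\<bar> \<le> M" and Uu: "AE p in lborel. 0 < snd p \<longrightarrow> U p = u p"
    using Linf_borel_representative[OF uL le(1)] by metis
  obtain V where V: "V \<in> borel_measurable borel" and VM: "\<And>p. \<bar>V p\<bar> \<le> M" and Vv: "AE p in lborel. 0 < snd p \<longrightarrow> V p = v p"
    using Linf_borel_representative[OF vL le(2)] by metis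
  note [measurable] = U V
  have kU: "kruzhkov U" unfolding kruzhkov_def using kruzhkov_inequality[OF sol(1) U UM Uu] by blast
  have kV: "kruzhkov V" unfolding kruzhkov_def using kruzhkov_inequality[OF sol(2) V VM Vv] by blast
  obtain Z where Z: "Z \<in> null_sets lebesgue" and mono: "\<And>\<rho> \<tau>. 0 < \<rho> \<Longrightarrow> \<rho> \<le> \<tau> \<Longrightarrow> \<rho> \<notin> Z \<Longrightarrow> \<tau> \<notin> Z \<Longrightarrow>
      (\<integral>\<^sup>+x. ennreal \<bar>U (x, \<tau>) - V (x, \<tau>)\<bar> \<partial>lborel) \<le> (\<integral>\<^sup>+x. ennreal \<bar>U (x, \<rho>) - V (x, \<rho>)\<bar> \<partial>lborel)"
    by (rule L1_contraction[OF U V UM VM kU kV assms(8)]) (rule that; assumption)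
  \<comment> \<open>Equality almost everywhere in space-time gives equality almost everywhere in
    space at almost every time; the other times join the exceptional set.\<close>
  have "AE p in lborel. 0 < snd p \<longrightarrow> U p = u p \<and> V p = v p"
    using Uu Vv by eventually_elim auto
  from AE_lborel_swap[OF this]
  have "AE t in lborel. AE x in lborel. 0 < t \<longrightarrow> U (x, t) = u (x, t) \<and> V (x, t) = v (x, t)" by simp
  then obtain Z' where Z': "Z' \<in> null_sets lebesgue" and slice: "\<And>t. t \<notin> Z' \<Longrightarrow> AE x in lborel. 0 < t \<longrightarrow> U (x, t) = u (x, t) \<and> V (x, t) = v (x, t)"
    by (rule AE_lborel_exceptional_set) (rule that; assumption)
  have eq: "(\<integral>\<^sup>+x. ennreal \<bar>u (x, t) - v (x, t)\<bar> \<partial>lebesgue) = (\<integral>\<^sup>+x. ennreal \<bar>U (x, t) - V (x, t)\<bar> \<partial>lborel)" if "t \<notin> Z'" "0 < t" for t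
  proof -
    have "AE x in lborel. ennreal \<bar>u (x, t) - v (x, t)\<bar> = ennreal \<bar>U (x, t) - V (x, t)\<bar>"
      using slice[OF that(1)]
    proof eventually_elim
      case (elim x)
      then show ?case using that(2) by simp
    qed
    then have "AE x in lebesgue. ennreal \<bar>u (x, t) - v (x, t)\<bar> = ennreal \<bar>U (x, t) - V (x, t)\<bar>"
      by (rule AE_completion)
    then have "(\<integral>\<^sup>+x. ennreal \<bar>u (x, t) - v (x, t)\<bar> \<partial>lebesgue) = (\<integral>\<^sup>+x. ennreal \<bar>U (x, t) - V (x, t)\<bar> \<partial>lebesgue)"
      by (rule nn_integral_cong_AE)
    also have "\<dots> = (\<integral>\<^sup>+x. ennreal \<bar>U (x, t) - V (x, t)\<bar> \<partial>lborel)" by (simp add: nn_integral_completion)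
    finally show ?thesis .
  qed
  have "(Z \<union> Z') \<inter> I \<in> null_sets lebesgue"
    by (rule null_sets_completion_subset[of _ "Z \<union> Z'"]) (use Z Z' in auto)
  moreover have "\<forall>\<rho>\<in>I - (Z \<union> Z') \<inter> I. \<forall>\<tau>\<in>I - (Z \<union> Z') \<inter> I. \<rho> \<le> \<tau> \<longrightarrow>
      (\<integral>\<^sup>+x. ennreal \<bar>u (x, \<tau>) - v (x, \<tau>)\<bar> \<partial>lebesgue) \<le> (\<integral>\<^sup>+x. ennreal \<bar>u (x, \<rho>) - v (x, \<rho>)\<bar> \<partial>lebesgue)"
  proof (intro ballI impI)
    fix \<rho> \<tau> assume "\<rho> \<in> I - (Z \<union> Z') \<inter> I" "\<tau> \<in> I - (Z \<union> Z') \<inter> I" "\<rho> \<le> \<tau>"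
    then have "0 < \<rho>" "0 < \<tau>" "\<rho> \<notin> Z" "\<tau> \<notin> Z" "\<rho> \<notin> Z'" "\<tau> \<notin> Z'" "\<rho> \<le> \<tau>" using assms(2) by auto
    then show "(\<integral>\<^sup>+x. ennreal \<bar>u (x, \<tau>) - v (x, \<tau>)\<bar> \<partial>lebesgue) \<le> (\<integral>\<^sup>+x. ennreal \<bar>u (x, \<rho>) - v (x, \<rho>)\<bar> \<partial>lebesgue)"
      using mono eq by simp
  qed
  ultimately show ?thesis by blast
qed

end
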